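(* Let $\alpha\in(0,\tfrac73]$ and $F\in H^2(\mathbb{R})$. There exists $M_0>0$ such that for every $M\ge M_0$ the linear system \[ \begin{cases} y\,\partial_x\omega_0-\partial_y^2\omega_0=0, & (x,y)\in\mathbb{R}\times[0,M],\\ \partial_y\omega_0(x,0)=\partial_x|\partial_x|A_0(x),\qquad \int_0^M\omega_0(x,y)\,dy=A_0(x)+F(x), & x\in\mathbb{R}, \end{cases} \] has a solution $(\omega_0,A_0)\in\mathcal{X}_{\alpha,M}$ satisfying \[ \|\omega_0\|_{X_0\cap X_\alpha}+\|A_0\|_{X_{\alpha,\infty}}\le C\|F\|_{H^2(\mathbb{R})}, \] where $C>0$ is independent of $\alpha$, $M$ and $F$.
   Context: $\Omega_M=\mathbb{R}\times[0,M]$ with coordinates $(x,y)$. For functions on $\Omega_M$ or $\mathbb{R}$, $\hat f(\xi,\cdot)$ denotes the Fourier transform in $x$, and $|\partial_x|^s$ is the Fourier multiplier with symbol $|\xi|^s$; $\partial_x|\partial_x|$ has symbol $i\xi|\xi|$. For $\bar\alpha\ge0$ define $\|f\|_{Y_{\bar\alpha}}=\|y|\partial_x|^{\bar\alpha/2}\partial_xf\|_{L^2(\Omega_M)}+\||\partial_x|^{\frac23+\frac{\bar\alpha}2}f\|_{L^2(\Omega_M)}+\||\partial_x|^{\frac13+\frac{\bar\alpha}2}\partial_yf\|_{L^2(\Omega_M)}+\||\partial_x|^{\bar\alpha/2}\partial_y^2f\|_{L^2(\Omega_M)}+\||\partial_x|^{\frac{1+\bar\alpha}2}y^{1/2}\partial_yf\|_{L^2(\Omega_M)}$,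 and $\|f\|_{X_{\bar\alpha}}=\|f\|_{L^2(\Omega_M)}+\||\partial_x|^{1/18}y^{1/6}f\|_{L^2(\Omega_M)}+\|f\|_{Y_{\bar\alpha}}$; $X_{\bar\alpha}$ is the space of $f$ with finite $X_{\bar\alpha}$-norm, and $\|f\|_{X_0\cap X_\alpha}=\|f\|_{X_0}+\|f\|_{X_\alpha}$. For functions on $\mathbb{R}$, $\|A\|_{X_{\alpha,\infty}}=\||\partial_x|^{5/6}A\|_{H^{\frac43+\frac\alpha2}(\mathbb{R})}+\|A\|_{L^\infty(\mathbb{R})}$. $Ai$ is the Airy function (the solution of $Ai''(z)=zAi(z)$ decaying as $z\to+\infty$). Set $(i\xi)^{1/3}=e^{i\pi\,\mathrm{sgn}(\xi)/6}|\xi|^{1/3}$ and $(i\xi)^{2/3}=e^{i\pi\,\mathrm{sgn}(\xi)/3}|\xi|^{2/3}$. The space $\mathcal{X}_{\alpha,M}$ consists of pairs $(\omega,A)$ with $\|(\omega,A)\|_{\mathcal{X}_{\alpha,M}}:=\|\omega\|_{X_0\cap X_\alpha}+\|A\|_{X_{\alpha,\infty}}<\infty$ and the trace condition $\hat\omega(\xi,M)=\frac{Ai((i\xi)^{1/3}M)}{Ai'(0)}(i\xi)^{2/3}|\xi|\hat A(\xi)$ for all $\xi$. *)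

theory Defs
  imports "HOL-Analysis.Analysis"
begin

text \<open>Convention: hat f(xi) = int f(x) e^{-i x xi} dx, so that d/dx has symbol i xi and
  int |f|^2 = (1/(2 pi)) int |hat f|^2.\<close>

definition L2 :: "(real \<Rightarrow> complex) \<Rightarrow> bool" where
  "L2 f \<longleftrightarrow> f \<in> borel_measurable lborel \<and>
     (\<integral>\<^sup>+ x. ennreal ((cmod (f x))\<^sup>2) \<partial>lborel) < \<infinity>"

definition FT_L2 :: "(real \<Rightarrow> complex) \<Rightarrow> (real \<Rightarrow> complex) \<Rightarrow> bool" where
  "FT_L2 f g \<longleftrightarrow> L2 f \<and> L2 g \<and>
     ((\<lambda>R. \<integral>\<^sup>+ \<xi>. ennreal ((cmod (g \<xi> - (LINT x:{-R..R}|lborel. cis (-(\<xi> * x)) * f x)))\<^sup>2) \<partial>lborel)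
        \<longlongrightarrow> 0) at_top"

definition enn_sqrt :: "ennreal \<Rightarrow> ennreal" where
  "enn_sqrt x = (if x = \<infinity> then \<infinity> else ennreal (sqrt (enn2real x)))"

definition mpow :: "real \<Rightarrow> real \<Rightarrow> real" where
  "mpow \<xi> s = (if s = 0 then 1 else \<bar>\<xi>\<bar> powr s)"

text \<open>Fourier-side L2 norm on the strip: sqrt((1/2pi) int_R int_0^M q(xi,y) dy dxi),
  where q is the squared modulus of the Fourier symbol applied to the partial Fourier transform.\<close>
definition fnorm :: "real \<Rightarrow> (real \<Rightarrow> real \<Rightarrow> real) \<Rightarrow> ennreal" where
  "fnorm M q = enn_sqrt (ennreal (1 / (2 * pi)) *
     (\<integral>\<^sup>+ \<xi>. (\<integral>\<^sup>+ y. indicator {0..M} y * ennreal (q \<xi> y) \<partial>lborel) \<partial>lborel))"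

definition L2_strip :: "real \<Rightarrow> (real \<Rightarrow> real \<Rightarrow> real) \<Rightarrow> ennreal" where
  "L2_strip M \<omega> = enn_sqrt
     (\<integral>\<^sup>+ x. (\<integral>\<^sup>+ y. indicator {0..M} y * ennreal ((\<omega> x y)\<^sup>2) \<partial>lborel) \<partial>lborel)"

text \<open>wh = partial Fourier transform in x of omega, w1 = its y-derivative, w2 = second y-derivative.\<close>
definition Y_norm :: "real \<Rightarrow> real \<Rightarrow> (real \<Rightarrow> real \<Rightarrow> complex) \<Rightarrow> (real \<Rightarrow> real \<Rightarrow> complex)
     \<Rightarrow> (real \<Rightarrow> real \<Rightarrow> complex) \<Rightarrow> ennreal" where
  "Y_norm a M wh w1 w2 =
     fnorm M (\<lambda>\<xi> y. y\<^sup>2 * mpow \<xi> a * \<xi>\<^sup>2 * (cmod (wh \<xi> y))\<^sup>2)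
   + fnorm M (\<lambda>\<xi> y. mpow \<xi> (4/3 + a) * (cmod (wh \<xi> y))\<^sup>2)
   + fnorm M (\<lambda>\<xi> y. mpow \<xi> (2/3 + a) * (cmod (w1 \<xi> y))\<^sup>2)
   + fnorm M (\<lambda>\<xi> y. mpow \<xi> a * (cmod (w2 \<xi> y))\<^sup>2)
   + fnorm M (\<lambda>\<xi> y. mpow \<xi> (1 + a) * y * (cmod (w1 \<xi> y))\<^sup>2)"

definition X_norm :: "real \<Rightarrow> real \<Rightarrow> (real \<Rightarrow> real \<Rightarrow> real) \<Rightarrow> (real \<Rightarrow> real \<Rightarrow> complex)
     \<Rightarrow> (real \<Rightarrow> real \<Rightarrow> complex) \<Rightarrow> (real \<Rightarrow> real \<Rightarrow> complex) \<Rightarrow> ennreal" where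
  "X_norm a M \<omega> wh w1 w2 =
     L2_strip M \<omega>
   + fnorm M (\<lambda>\<xi> y. mpow \<xi> (1/9) * y powr (1/3) * (cmod (wh \<xi> y))\<^sup>2)
   + Y_norm a M wh w1 w2"

definition Linf_norm :: "(real \<Rightarrow> real) \<Rightarrow> ennreal" where
  "Linf_norm A = (INF C \<in> {C. AE x in lborel. ennreal \<bar>A x\<bar> \<le> C}. C)"

definition Hs_norm_hat :: "real \<Rightarrow> (real \<Rightarrow> complex) \<Rightarrow> ennreal" where
  "Hs_norm_hat s gh = enn_sqrt (ennreal (1 / (2 * pi)) *
     (\<integral>\<^sup>+ \<xi>. ennreal ((1 + \<xi>\<^sup>2) powr s * (cmod (gh \<xi>))\<^sup>2) \<partial>lborel))"

definition XA_norm :: "real \<Rightarrow> (real \<Rightarrow> real) \<Rightarrow> (real \<Rightarrow> complex) \<Rightarrow> ennreal" where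
  "XA_norm a A Ah = Hs_norm_hat (4/3 + a/2) (\<lambda>\<xi>. of_real (mpow \<xi> (5/6)) * Ah \<xi>) + Linf_norm A"

text \<open>Ai is an entire solution of Ai'' = z Ai, not identically zero, decaying along the positive
  real axis. Such solutions are unique up to a constant factor, and only the scale-invariant
  quotient Ai(z)/Ai'(0) enters below.\<close>
definition Ai :: "complex \<Rightarrow> complex" where
  "Ai = (SOME f. f holomorphic_on UNIV \<and> (\<forall>z. deriv (deriv f) z = z * f z) \<and>
           ((\<lambda>x::real. f (of_real x)) \<longlongrightarrow> 0) at_top \<and> (\<exists>z. f z \<noteq> 0))"

definition ixi13 :: "real \<Rightarrow> complex" where
  "ixi13 \<xi> = cis (pi * sgn \<xi> / 6) * of_real (\<bar>\<xi>\<bar> powr (1/3))"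

definition ixi23 :: "real \<Rightarrow> complex" where
  "ixi23 \<xi> = cis (pi * sgn \<xi> / 3) * of_real (\<bar>\<xi>\<bar> powr (2/3))"

definition strip_rep :: "real \<Rightarrow> (real \<Rightarrow> real \<Rightarrow> real) \<Rightarrow> (real \<Rightarrow> real \<Rightarrow> complex)
     \<Rightarrow> (real \<Rightarrow> real \<Rightarrow> complex) \<Rightarrow> (real \<Rightarrow> real \<Rightarrow> complex) \<Rightarrow> bool" where
  "strip_rep M \<omega> wh w1 w2 \<longleftrightarrow>
     case_prod \<omega> \<in> borel_measurable borel \<and> case_prod wh \<in> borel_measurable borel \<and>
     case_prod w1 \<in> borel_measurable borel \<and> case_prod w2 \<in> borel_measurable borel \<and>
     (AE y in lborel. y \<in> {0..M} \<longrightarrow> FT_L2 (\<lambda>x. of_real (\<omega> x y)) (\<lambda>\<xi>. wh \<xi> y)) \<and>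
     (\<forall>\<xi>. \<forall>y\<in>{0..M}. ((\<lambda>t. wh \<xi> t) has_vector_derivative w1 \<xi> y) (at y within {0..M}) \<and>
                     ((\<lambda>t. w1 \<xi> t) has_vector_derivative w2 \<xi> y) (at y within {0..M}))"

text \<open>The linear system
   y d_x omega - d_y^2 omega = 0 on R x [0,M],
   d_y omega(x,0) = d_x|d_x| A(x),   int_0^M omega(x,y) dy = A(x) + F(x),
  with the differential equations expressed on the Fourier side in x.\<close>
definition solves_system :: "real \<Rightarrow> (real \<Rightarrow> real) \<Rightarrow> (real \<Rightarrow> real \<Rightarrow> real) \<Rightarrow> (real \<Rightarrow> real \<Rightarrow> complex)
     \<Rightarrow> (real \<Rightarrow> real \<Rightarrow> complex) \<Rightarrow> (real \<Rightarrow> real \<Rightarrow> complex) \<Rightarrow> (real \<Rightarrow> real) \<Rightarrow> (real \<Rightarrow> complex) \<Rightarrow> bool" where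
  "solves_system M F \<omega> wh w1 w2 A Ah \<longleftrightarrow>
     strip_rep M \<omega> wh w1 w2 \<and> FT_L2 (\<lambda>x. of_real (A x)) Ah \<and>
     (\<forall>\<xi>. \<forall>y\<in>{0..M}. w2 \<xi> y = \<i> * of_real (\<xi> * y) * wh \<xi> y) \<and>
     (\<forall>\<xi>. w1 \<xi> 0 = \<i> * of_real (\<xi> * \<bar>\<xi>\<bar>) * Ah \<xi>) \<and>
     (AE x in lborel. set_integrable lborel {0..M} (\<omega> x) \<and>
                      (LINT y:{0..M}|lborel. \<omega> x y) = A x + F x)"

definition in_calX :: "real \<Rightarrow> real \<Rightarrow> (real \<Rightarrow> real \<Rightarrow> real) \<Rightarrow> (real \<Rightarrow> real \<Rightarrow> complex)
     \<Rightarrow> (real \<Rightarrow> real \<Rightarrow> complex) \<Rightarrow> (real \<Rightarrow> real \<Rightarrow> complex) \<Rightarrow> (real \<Rightarrow> real) \<Rightarrow> (real \<Rightarrow> complex) \<Rightarrow> bool" where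
  "in_calX a M \<omega> wh w1 w2 A Ah \<longleftrightarrow>
     strip_rep M \<omega> wh w1 w2 \<and> FT_L2 (\<lambda>x. of_real (A x)) Ah \<and>
     X_norm 0 M \<omega> wh w1 w2 < \<infinity> \<and> X_norm a M \<omega> wh w1 w2 < \<infinity> \<and> XA_norm a A Ah < \<infinity> \<and>
     (\<forall>\<xi>. wh \<xi> M = Ai (ixi13 \<xi> * of_real M) / deriv Ai 0 * ixi23 \<xi> * of_real \<bar>\<xi>\<bar> * Ah \<xi>)"

definition in_H2 :: "(real \<Rightarrow> real) \<Rightarrow> (real \<Rightarrow> complex) \<Rightarrow> bool" where
  "in_H2 F Fh \<longleftrightarrow> FT_L2 (\<lambda>x. of_real (F x)) Fh \<and> Hs_norm_hat 2 Fh < \<infinity>"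

end

theory Submission
  imports Defs "HOL-Probability.Probability" "HOL-Complex_Analysis.Complex_Analysis"
begin

text \<open>
  On the Fourier side in x the equation becomes the Airy equation in y, so the trace condition forces
  the solution to be a multiple of Ai(a y)/Ai'(0) with a = (i xi)^(1/3), and the integral constraint
  turns into a scalar equation for the transform of A with symbol
  Phi(xi) = a |xi| G(a M) - 1, where G' = Ai/Ai'(0) and G(0) = 0. In the closed sector |arg z| \<le> pi/6
  the primitive G is bounded and tends to a negative real limit L, so Re (a L) \<le> 0; this gives
  |Phi(xi)| \<ge> c (1 + |xi|^(4/3)) for all M above an absolute threshold. By scaling,
  every norm of the solution is then an integral over xi of a power of |xi|^(1/3) against the H^2 energy of F.

  Decay in the sector comes from Ai(z) being, up to a constant, the integral of exp (p^3/3 - z p) over the line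
  Re p = tau for any tau > 0, with the choice tau = sqrt (Re z); a decaying solution is unique up to a
  constant factor because |h|^2 is convex on the positive half line.
\<close>


section \<open>Continuity of translations in the mean\<close>


text \<open>\<open>FT_L2\<close> describes a transform only as a mean-square limit of truncated
  integrals, so nothing can be computed pointwise before Plancherel and inversion are available.
  After that, the H^2 bound makes the transforms of F, A and omega(., y) integrable, and all
  functions become genuine inverse Fourier integrals to which Fubini applies. Uniformity in M costs
  nothing: M enters only through the product a M. If |a M| is large, G(a M) is close to L; otherwise
  |a| is at most a constant over M, and boundedness of G makes a |xi| G(a M) small against 1. The
  sign of L is obtained without evaluating the integral of Ai. On the positive axis r = Ai/Ai'(0) is
  real, r r' \<le> 0 and r'(0) = 1, so r(0) < 0; since r^2 never increases, r cannot change sign,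
  and its primitive G decreases to L. There is no obstruction at low frequency: the coefficient a^2
  |xi| of the profile vanishes at xi = 0, and no formula divides by a. \<open>Ai\<close> is a
  Hilbert choice, so existence and uniqueness up to a factor are both needed before anything can be
  said about it.\<close>

lemma norm_add_square_le:
  fixes a b :: "'a::real_normed_vector"
  shows "(norm (a + b))\<^sup>2 \<le> 2 * (norm a)\<^sup>2 + 2 * (norm b)\<^sup>2"
proof -
  have "(norm (a + b))\<^sup>2 \<le> (norm a + norm b)\<^sup>2"
    by (intro power_mono norm_triangle_ineq) auto
  also have "\<dots> \<le> 2 * (norm a)\<^sup>2 + 2 * (norm b)\<^sup>2"
    using zero_le_power2[of "norm a - norm b"] by (simp add: power2_eq_square algebra_simps)
  finally show ?thesis .
qed

text \<open>Stands in for the triangle inequality of the L2 norm without square roots in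
  \<open>ennreal\<close>. The lost factor 2 is harmless, as only limits to zero and finiteness are
  drawn from it.\<close>

lemma nn_integral_norm_add_square_le:
  fixes f g :: "'b \<Rightarrow> 'a::{banach, second_countable_topology}"
  assumes [measurable]: "f \<in> borel_measurable M" "g \<in> borel_measurable M"
  shows "(\<integral>\<^sup>+x. ennreal ((norm (f x + g x))\<^sup>2) \<partial>M)
    \<le> 2 * (\<integral>\<^sup>+x. ennreal ((norm (f x))\<^sup>2) \<partial>M) + 2 * (\<integral>\<^sup>+x. ennreal ((norm (g x))\<^sup>2) \<partial>M)"
proof -
  have "(\<integral>\<^sup>+x. ennreal ((norm (f x + g x))\<^sup>2) \<partial>M)
      \<le> (\<integral>\<^sup>+x. 2 * ennreal ((norm (f x))\<^sup>2) + 2 * ennreal ((norm (g x))\<^sup>2) \<partial>M)"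
  proof (rule nn_integral_mono)
    fix x
    have "ennreal ((norm (f x + g x))\<^sup>2) \<le> ennreal (2 * (norm (f x))\<^sup>2 + 2 * (norm (g x))\<^sup>2)"
      by (intro ennreal_leI norm_add_square_le)
    then show "ennreal ((norm (f x + g x))\<^sup>2)
        \<le> 2 * ennreal ((norm (f x))\<^sup>2) + 2 * ennreal ((norm (g x))\<^sup>2)"
      by (simp add: ennreal_plus ennreal_mult)
  qed
  also have "\<dots> = 2 * (\<integral>\<^sup>+x. ennreal ((norm (f x))\<^sup>2) \<partial>M) + 2 * (\<integral>\<^sup>+x. ennreal ((norm (g x))\<^sup>2) \<partial>M)"
    by (simp add: nn_integral_add nn_integral_cmult)
  finally show ?thesis .
qed

abbreviation sq_int :: "(real \<Rightarrow> 'a::real_normed_vector) \<Rightarrow> ennreal" where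
  "sq_int f \<equiv> \<integral>\<^sup>+x. ennreal ((norm (f x))\<^sup>2) \<partial>lborel"

lemma nn_integral_lborel_translate:
  fixes f :: "real \<Rightarrow> ennreal"
  assumes "f \<in> borel_measurable borel"
  shows "(\<integral>\<^sup>+x. f (x + s) \<partial>lborel) = (\<integral>\<^sup>+x. f x \<partial>lborel)"
  using nn_integral_real_affine[OF assms, of 1 s] by (simp add: add.commute)

text \<open>The factor 10 leaves room for every sum of small errors below, the largest being 9 e; it
  also treats an infinite \<open>a\<close> once and for all.\<close>

lemma ennreal_scaled_lt:
  assumes "0 < a"
  obtains e where "e > 0" "ennreal (10 * e) < a"
proof (cases a)
  case (real r)
  with assms have "r > 0" by auto
  then show ?thesis using that[of "r / 20"] real by (auto simp: ennreal_less_iff)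
next
  case top
  then show ?thesis using that[of 1] by (auto simp: ennreal_less_top)
qed

lemma tendsto_0_le_ennreal:
  fixes f g :: "'a \<Rightarrow> ennreal"
  assumes "(g \<longlongrightarrow> 0) F" "\<And>x. f x \<le> g x"
  shows "(f \<longlongrightarrow> 0) F"
  by (rule tendsto_sandwich[OF _ _ tendsto_const assms(1)]) (use assms(2) in auto)

text \<open>Continuity at 0 of s \<mapsto> f(. + s) in L2, phrased with sequences because dominated
  convergence is available for sequences.\<close>

definition translation_continuous :: "(real \<Rightarrow> 'a::{banach, second_countable_topology}) \<Rightarrow> bool" where
  "translation_continuous f \<longleftrightarrow>
     (\<forall>s. s \<longlonglongrightarrow> 0 \<longrightarrow> (\<lambda>n. sq_int (\<lambda>x. f (x + s n) - f x)) \<longlonglongrightarrow> 0)"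

lemma translation_continuous_add:
  fixes f g :: "real \<Rightarrow> 'a::{banach, second_countable_topology}"
  assumes [measurable]: "f \<in> borel_measurable borel" "g \<in> borel_measurable borel"
    and f: "translation_continuous f" and g: "translation_continuous g"
  shows "translation_continuous (\<lambda>x. f x + g x)"
  unfolding translation_continuous_def
proof (intro allI impI)
  fix s :: "nat \<Rightarrow> real" assume s: "s \<longlonglongrightarrow> 0"
  let ?D = "\<lambda>f n. sq_int (\<lambda>x. f (x + s n) - f x)"
  have "?D (\<lambda>x. f x + g x) n \<le> 2 * ?D f n + 2 * ?D g n" for n
  proof -
    have "?D (\<lambda>x. f x + g x) n = sq_int (\<lambda>x. (f (x + s n) - f x) + (g (x + s n) - g x))"
      by (simp add: algebra_simps)
    also have "\<dots> \<le> 2 * ?D f n + 2 * ?D g n"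
      by (rule nn_integral_norm_add_square_le) measurable
    finally show ?thesis .
  qed
  moreover have "(\<lambda>n. 2 * ?D f n + 2 * ?D g n) \<longlonglongrightarrow> 2 * 0 + 2 * 0"
    using f g s unfolding translation_continuous_def
    by (intro tendsto_add ennreal_tendsto_cmult) auto
  ultimately show "?D (\<lambda>x. f x + g x) \<longlonglongrightarrow> 0"
    by - (rule tendsto_0_le_ennreal[where g = "\<lambda>n. 2 * ?D f n + 2 * ?D g n"], simp_all)
qed

lemma translation_continuous_bounded_linear:
  fixes f :: "real \<Rightarrow> 'a::{banach, second_countable_topology}"
    and L :: "'a \<Rightarrow> 'b::{banach, second_countable_topology}"
  assumes [measurable]: "f \<in> borel_measurable borel"
    and f: "translation_continuous f" and L: "bounded_linear L"
  shows "translation_continuous (\<lambda>x. L (f x))"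
  unfolding translation_continuous_def
proof (intro allI impI)
  fix s :: "nat \<Rightarrow> real" assume s: "s \<longlonglongrightarrow> 0"
  obtain K where K: "\<And>x. norm (L x) \<le> norm x * K"
    using bounded_linear.bounded[OF L] by blast
  let ?D = "\<lambda>n. sq_int (\<lambda>x. f (x + s n) - f x)"
  have "sq_int (\<lambda>x. L (f (x + s n)) - L (f x)) \<le> ennreal (K\<^sup>2) * ?D n" for n
  proof -
    have "sq_int (\<lambda>x. L (f (x + s n)) - L (f x))
        \<le> (\<integral>\<^sup>+x. ennreal (K\<^sup>2) * ennreal ((norm (f (x + s n) - f x))\<^sup>2) \<partial>lborel)"
    proof (rule nn_integral_mono)
      fix x
      have "norm (L (f (x + s n)) - L (f x)) \<le> norm (f (x + s n) - f x) * K"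
        using K[of "f (x + s n) - f x"] by (simp add: bounded_linear.linear[OF L] linear_diff)
      then have "(norm (L (f (x + s n)) - L (f x)))\<^sup>2 \<le> (norm (f (x + s n) - f x) * K)\<^sup>2"
        by (intro power_mono) auto
      then show "ennreal ((norm (L (f (x + s n)) - L (f x)))\<^sup>2)
          \<le> ennreal (K\<^sup>2) * ennreal ((norm (f (x + s n) - f x))\<^sup>2)"
        by (simp add: ennreal_mult[symmetric] power_mult_distrib mult.commute ennreal_leI)
    qed
    also have "\<dots> = ennreal (K\<^sup>2) * ?D n" by (rule nn_integral_cmult) measurable
    finally show ?thesis .
  qed
  moreover have "(\<lambda>n. ennreal (K\<^sup>2) * ?D n) \<longlonglongrightarrow> ennreal (K\<^sup>2) * 0"
    using f s unfolding translation_continuous_def by (intro ennreal_tendsto_cmult) auto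
  ultimately show "(\<lambda>n. sq_int (\<lambda>x. L (f (x + s n)) - L (f x))) \<longlonglongrightarrow> 0"
    by - (rule tendsto_0_le_ennreal[where g = "\<lambda>n. ennreal (K\<^sup>2) * ?D n"], simp_all)
qed

text \<open>The increment of f is the increment of g plus the error f - g at x + s minus the error
  at x. Lebesgue measure is translation invariant, so both errors have the same size, uniformly in
  s.\<close>

lemma translation_continuous_approx:
  fixes f :: "real \<Rightarrow> 'a::{banach, second_countable_topology}"
  assumes [measurable]: "f \<in> borel_measurable borel"
    and approx: "\<And>e. e > 0 \<Longrightarrow> \<exists>g. g \<in> borel_measurable borel \<and> translation_continuous g \<and>
           sq_int (\<lambda>x. f x - g x) \<le> ennreal e"
  shows "translation_continuous f"
  unfolding translation_continuous_def
proof (intro allI impI)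
  fix s :: "nat \<Rightarrow> real" assume s: "s \<longlonglongrightarrow> 0"
  let ?D = "\<lambda>f n. sq_int (\<lambda>x. f (x + s n) - f x)"
  show "?D f \<longlonglongrightarrow> 0"
  proof (rule order_tendstoI)
    fix a :: ennreal assume "0 < a"
    then obtain e where e: "e > 0" "ennreal (10 * e) < a" by (rule ennreal_scaled_lt)
    from approx[OF e(1)] obtain g where [measurable]: "g \<in> borel_measurable borel"
      and g: "translation_continuous g" and d: "sq_int (\<lambda>x. f x - g x) \<le> ennreal e"
      by blast
    let ?E = "sq_int (\<lambda>x. f x - g x)"
    have "?D f n \<le> 2 * ?D g n + 2 * (2 * ?E + 2 * ?E)" for n
    proof -
      have t: "sq_int (\<lambda>x. f (x + s n) - g (x + s n)) = ?E"
        by (rule nn_integral_lborel_translate[where f = "\<lambda>x. ennreal ((norm (f x - g x))\<^sup>2)"]) measurable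
      have "?D f n = sq_int (\<lambda>x. (g (x + s n) - g x) + ((f (x + s n) - g (x + s n)) + (g x - f x)))"
        by (simp add: algebra_simps)
      also have "\<dots> \<le> 2 * ?D g n + 2 * sq_int (\<lambda>x. (f (x + s n) - g (x + s n)) + (g x - f x))"
        by (rule nn_integral_norm_add_square_le) measurable
      also have "sq_int (\<lambda>x. (f (x + s n) - g (x + s n)) + (g x - f x))
          \<le> 2 * sq_int (\<lambda>x. f (x + s n) - g (x + s n))
            + 2 * sq_int (\<lambda>x. g x - f x)"
        by (rule nn_integral_norm_add_square_le) measurable
      finally show ?thesis unfolding t by (simp add: norm_minus_commute add_left_mono mult_left_mono)
    qed
    moreover have "2 * (2 * ?E + 2 * ?E) \<le> ennreal (8 * e)"
    proof -
      have "2 * (2 * ?E + 2 * ?E) \<le> 2 * (2 * ennreal e + 2 * ennreal e)"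
        by (intro mult_left_mono add_mono d) auto
      also have "\<dots> = ennreal (2 * (2 * e + 2 * e))"
        using e(1) by (simp add: ennreal_plus[symmetric] ennreal_mult[symmetric] numeral_mult_ennreal)
      finally show ?thesis by simp
    qed
    ultimately have le: "?D f n \<le> 2 * ?D g n + ennreal (8 * e)" for n
      by (meson add_left_mono order_trans)
    have "(\<lambda>n. 2 * ?D g n) \<longlonglongrightarrow> 2 * 0"
      using g s unfolding translation_continuous_def by (intro ennreal_tendsto_cmult) auto
    then have "eventually (\<lambda>n. 2 * ?D g n < ennreal e) sequentially"
      using e(1) by (intro order_tendstoD) auto
    then show "eventually (\<lambda>n. ?D f n < a) sequentially"
    proof eventually_elim
      case (elim n)
      have "?D f n \<le> ennreal e + ennreal (8 * e)"
        using le[of n] elim by (meson add_right_mono less_imp_le order_trans)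
      also have "\<dots> = ennreal (9 * e)" using e(1) by (simp flip: ennreal_plus)
      also have "\<dots> \<le> ennreal (10 * e)" using e(1) by (intro ennreal_leI) auto
      finally show ?case using e(2) by (rule order.strict_trans1)
    qed
  qed simp
qed

text \<open>For an open set U a point of U stays in U under small shifts, so the mass that leaves U
  tends to 0. Outer regularity encloses A in such a U with U - A small, and a point of A shifted out
  of A has either left U or landed in U - A.\<close>

lemma translation_continuous_indicator:
  assumes [measurable]: "A \<in> sets borel" and fin: "emeasure lborel A < \<infinity>"
  shows "translation_continuous (indicat_real A)"
  unfolding translation_continuous_def
proof (intro allI impI)
  fix s :: "nat \<Rightarrow> real" assume s: "s \<longlonglongrightarrow> 0"
  let ?D = "\<lambda>n. sq_int (\<lambda>x. indicat_real A (x + s n) - indicat_real A x)"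
  let ?H = "\<lambda>s (n::nat). \<integral>\<^sup>+x. indicator A x * indicator (- A) (x + s n) \<partial>lborel"
  have H: "?H s \<longlonglongrightarrow> 0" if s: "s \<longlonglongrightarrow> 0" for s :: "nat \<Rightarrow> real"
  proof (rule order_tendstoI)
    fix a :: ennreal assume "0 < a"
    then obtain e where e: "e > 0" "ennreal (10 * e) < a" by (rule ennreal_scaled_lt)
    obtain U where U: "open U" "A \<subseteq> U" "emeasure lborel (U - A) < ennreal e"
      using outer_regular_lborel[OF assms(1) e(1)] by blast
    then have [measurable]: "U \<in> sets borel" by simp
    have "emeasure lborel U \<le> emeasure lborel A + emeasure lborel (U - A)"
      by (rule order_trans[OF _ emeasure_subadditive]) (use U in \<open>auto intro!: emeasure_mono\<close>)
    also have "\<dots> < \<infinity>" using fin less_trans[OF U(3) ennreal_less_top] by simp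
    finally have finU: "emeasure lborel U < \<infinity>" .
    have "(\<lambda>n. \<integral>\<^sup>+x. indicator U x * indicator (- U) (x + s n) \<partial>lborel) \<longlonglongrightarrow> (\<integral>\<^sup>+(x::real). 0 \<partial>lborel)"
    proof (rule nn_integral_dominated_convergence[where w = "indicator U"])
      show "integral\<^sup>N lborel (indicator U) < \<infinity>" using finU by simp
      show "AE x in lborel. (\<lambda>n. indicator U x * indicator (- U) (x + s n)) \<longlonglongrightarrow> (0::ennreal)"
      proof (rule AE_I2)
        fix x :: real
        show "(\<lambda>n. indicator U x * indicator (- U) (x + s n)) \<longlonglongrightarrow> (0::ennreal)"
        proof (cases "x \<in> U")
          case True
          have "(\<lambda>n. x + s n) \<longlonglongrightarrow> x" using tendsto_add[OF tendsto_const[of x] s] by simp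
          then have "eventually (\<lambda>n. x + s n \<in> U) sequentially"
            using topological_tendstoD[OF _ U(1) True] by blast
          then have "eventually (\<lambda>n. indicator U x * indicator (- U) (x + s n) = (0::ennreal)) sequentially"
            by eventually_elim (auto simp: indicator_def)
          then show ?thesis by (rule tendsto_eventually)
        qed simp
      qed
    qed (auto simp: indicator_def)
    then have "eventually (\<lambda>n. (\<integral>\<^sup>+x. indicator U x * indicator (- U) (x + s n) \<partial>lborel) < ennreal e) sequentially"
      using e(1) by (intro order_tendstoD) auto
    then show "eventually (\<lambda>n. ?H s n < a) sequentially"
    proof eventually_elim
      case (elim n)
      have "?H s n \<le> (\<integral>\<^sup>+x. indicator U x * indicator (- U) (x + s n) + indicator (U - A) (x + s n) \<partial>lborel)"
        using U(2) by (intro nn_integral_mono) (auto simp: indicator_def)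
      also have "\<dots> = (\<integral>\<^sup>+x. indicator U x * indicator (- U) (x + s n) \<partial>lborel) + (\<integral>\<^sup>+x. indicator (U - A) (x + s n) \<partial>lborel)"
        by (rule nn_integral_add) measurable
      also have "(\<integral>\<^sup>+x. indicator (U - A) (x + s n) \<partial>lborel) = emeasure lborel (U - A)"
        using nn_integral_lborel_translate[of "indicator (U - A)" "s n"] by simp
      also have "(\<integral>\<^sup>+x. indicator U x * indicator (- U) (x + s n) \<partial>lborel) + emeasure lborel (U - A) \<le> ennreal e + ennreal e"
        using elim U(3) by (intro add_mono) auto
      also have "\<dots> \<le> ennreal (10 * e)" using e(1) by (simp flip: ennreal_plus)
      finally show ?case using e(2) by (rule order.strict_trans1)
    qed
  qed simp
  \<comment> \<open>Points entering A under the shift by s are, after a translation, points leaving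
    A under the shift by -s; so \<open>H\<close> covers both halves of the symmetric
    difference.\<close>
  have "?D n = ?H s n + (\<integral>\<^sup>+x. indicator A x * indicator (- A) (x + (- s n)) \<partial>lborel)" for n
  proof -
    have "(\<integral>\<^sup>+x. indicator A x * indicator (- A) (x + (- s n)) \<partial>lborel)
        = (\<integral>\<^sup>+x. indicator A (x + s n) * indicator (- A) x \<partial>lborel)"
      using nn_integral_lborel_translate[of "\<lambda>x. indicator A x * indicator (- A) (x + (- s n))" "s n", symmetric] by simp
    moreover have "?D n = (\<integral>\<^sup>+x. indicator A x * indicator (- A) (x + s n) + indicator A (x + s n) * indicator (- A) x \<partial>lborel)"
      by (intro nn_integral_cong) (auto simp: indicator_def)
    moreover have "\<dots> = ?H s n + (\<integral>\<^sup>+x. indicator A (x + s n) * indicator (- A) x \<partial>lborel)"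
      by (rule nn_integral_add) measurable
    ultimately show ?thesis by simp
  qed
  moreover have "(\<lambda>n. ?H s n + (\<integral>\<^sup>+x. indicator A x * indicator (- A) (x + (- s n)) \<partial>lborel)) \<longlonglongrightarrow> 0 + 0"
    using H[OF s] H[of "\<lambda>n. - s n"] tendsto_minus[OF s] by (intro tendsto_add) auto
  ultimately show "?D \<longlonglongrightarrow> 0" by simp
qed

text \<open>Square integrability is part of the property under induction, so each case first
  recovers it for the pieces; nonnegativity does this, since summands and approximants lie below the
  whole.\<close>

lemma translation_continuous_nonneg:
  fixes u :: "real \<Rightarrow> real"
  assumes "u \<in> borel_measurable borel" "\<And>x. 0 \<le> u x" "(\<integral>\<^sup>+x. ennreal ((u x)\<^sup>2) \<partial>lborel) < \<infinity>"
  shows "translation_continuous u"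
  using assms
proof (induction u rule: borel_measurable_induct_real)
  case (set A)
  have "emeasure lborel A = (\<integral>\<^sup>+x. ennreal ((indicat_real A x)\<^sup>2) \<partial>lborel)"
    using set(1) by (simp add: nn_integral_indicator[symmetric] del: nn_integral_indicator)
      (intro nn_integral_cong, auto split: split_indicator)
  then show ?case using set by (intro translation_continuous_indicator) auto
next
  case (mult u c)
  show ?case
  \<comment> \<open>For c = 0 the finite energy of c u says nothing about u, so the induction
    hypothesis cannot be invoked.\<close>
  proof (cases "c = 0")
    case True
    then show ?thesis by (simp add: translation_continuous_def)
  next
    case False
    have "(\<integral>\<^sup>+x. ennreal ((c * u x)\<^sup>2) \<partial>lborel) = ennreal (c\<^sup>2) * (\<integral>\<^sup>+x. ennreal ((u x)\<^sup>2) \<partial>lborel)"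
      using mult(2) by (subst nn_integral_cmult[symmetric]) (auto simp: power_mult_distrib ennreal_mult)
    with mult(5) False have "(\<integral>\<^sup>+x. ennreal ((u x)\<^sup>2) \<partial>lborel) < \<infinity>"
      by (auto simp: ennreal_mult_less_top)
    with mult have "translation_continuous u" by blast
    then show ?thesis
      using translation_continuous_bounded_linear[OF _ _ bounded_linear_mult_right, of u c] mult(2) by simp
  qed
next
  case (add u v)
  have "(\<integral>\<^sup>+x. ennreal ((u x)\<^sup>2) \<partial>lborel) \<le> (\<integral>\<^sup>+x. ennreal ((v x + u x)\<^sup>2) \<partial>lborel)"
    "(\<integral>\<^sup>+x. ennreal ((v x)\<^sup>2) \<partial>lborel) \<le> (\<integral>\<^sup>+x. ennreal ((v x + u x)\<^sup>2) \<partial>lborel)"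
    using add by (auto intro!: nn_integral_mono ennreal_leI power_mono)
  with add have "translation_continuous u" "translation_continuous v"
    by (auto simp: order.strict_trans1)
  then show ?case using add by (intro translation_continuous_add) auto
next
  case (seq U)
  have [measurable]: "\<And>i. U i \<in> borel_measurable borel" using seq(1) by simp
  have mu[measurable]: "u \<in> borel_measurable borel"
    by (rule borel_measurable_LIMSEQ_real[where u = U]) (use seq(4) in auto)
  have le: "U i x \<le> u x" for i x
    using seq(3,4) by (intro incseq_le[of "\<lambda>i. U i x"]) (auto simp: incseq_def le_fun_def)
  have tU: "translation_continuous (U i)" for i
  proof -
    have "(\<integral>\<^sup>+x. ennreal ((U i x)\<^sup>2) \<partial>lborel) \<le> (\<integral>\<^sup>+x. ennreal ((u x)\<^sup>2) \<partial>lborel)"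
      using seq(2) le by (auto intro!: nn_integral_mono ennreal_leI power_mono)
    then show ?thesis using seq(5,6) by (meson order.strict_trans1)
  qed
  have lim: "(\<lambda>i. sq_int (\<lambda>x. u x - U i x)) \<longlonglongrightarrow> (\<integral>\<^sup>+(x::real). 0 \<partial>lborel)"
  proof (rule nn_integral_dominated_convergence[where w = "\<lambda>x. ennreal ((u x)\<^sup>2)"])
    show "AE x in lborel. ennreal ((norm (u x - U i x))\<^sup>2) \<le> ennreal ((u x)\<^sup>2)" for i
      using le seq(2) by (intro AE_I2 ennreal_leI) (auto intro!: power_mono simp: abs_le_iff intro: order_trans)
    show "AE x in lborel. (\<lambda>i. ennreal ((norm (u x - U i x))\<^sup>2)) \<longlonglongrightarrow> 0"
    proof (rule AE_I2)
      fix x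
      have "(\<lambda>i. (norm (u x - U i x))\<^sup>2) \<longlonglongrightarrow> (norm (u x - u x))\<^sup>2"
        using seq(4) by (intro tendsto_intros) auto
      then show "(\<lambda>i. ennreal ((norm (u x - U i x))\<^sup>2)) \<longlonglongrightarrow> 0"
        by (intro tendsto_ennrealI[of _ 0, simplified]) simp
    qed
    show "(\<integral>\<^sup>+x. ennreal ((u x)\<^sup>2) \<partial>lborel) < \<infinity>" using seq(6) .
  qed auto
  show ?case
  proof (rule translation_continuous_approx[OF mu])
    fix e :: real assume "e > 0"
    then have "eventually (\<lambda>i. sq_int (\<lambda>x. u x - U i x) < ennreal e) sequentially"
      using lim by (intro order_tendstoD) auto
    then obtain i where "sq_int (\<lambda>x. u x - U i x) < ennreal e"
      by (auto simp: eventually_sequentially)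
    then show "\<exists>g. g \<in> borel_measurable borel \<and> translation_continuous g \<and>
           sq_int (\<lambda>x. u x - g x) \<le> ennreal e"
      using tU by (intro exI[of _ "U i"]) auto
  qed
qed

lemma translation_continuous_real:
  fixes u :: "real \<Rightarrow> real"
  assumes [measurable]: "u \<in> borel_measurable borel" and fin: "(\<integral>\<^sup>+x. ennreal ((u x)\<^sup>2) \<partial>lborel) < \<infinity>"
  shows "translation_continuous u"
proof -
  have "(\<integral>\<^sup>+x. ennreal ((max 0 (u x))\<^sup>2) \<partial>lborel) \<le> (\<integral>\<^sup>+x. ennreal ((u x)\<^sup>2) \<partial>lborel)"
    "(\<integral>\<^sup>+x. ennreal ((max 0 (- u x))\<^sup>2) \<partial>lborel) \<le> (\<integral>\<^sup>+x. ennreal ((u x)\<^sup>2) \<partial>lborel)"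
    by (auto intro!: nn_integral_mono ennreal_leI simp: max_def)
  then have "translation_continuous (\<lambda>x. max 0 (u x))" "translation_continuous (\<lambda>x. max 0 (- u x))"
    using fin by (auto intro!: translation_continuous_nonneg intro: order.strict_trans1)
  then have "translation_continuous (\<lambda>x. max 0 (u x) + - max 0 (- u x))"
    by (intro translation_continuous_add translation_continuous_bounded_linear[where L = uminus])
       (auto intro: bounded_linear_minus bounded_linear_ident)
  moreover have "(\<lambda>x. max 0 (u x) + - max 0 (- u x)) = u" by (auto simp: max_def)
  ultimately show ?thesis by simp
qed

lemma translation_continuous_L2:
  assumes "L2 f"
  shows "translation_continuous f"
proof -
  have [measurable]: "f \<in> borel_measurable borel" and fin: "sq_int f < \<infinity>"
    using assms by (auto simp: L2_def)
  have "(\<integral>\<^sup>+x. ennreal ((Re (f x))\<^sup>2) \<partial>lborel) \<le> sq_int f"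
    "(\<integral>\<^sup>+x. ennreal ((Im (f x))\<^sup>2) \<partial>lborel) \<le> sq_int f"
    by (auto intro!: nn_integral_mono ennreal_leI simp: cmod_power2)
  then have "translation_continuous (\<lambda>x. Re (f x))" "translation_continuous (\<lambda>x. Im (f x))"
    using fin by (auto intro!: translation_continuous_real intro: order.strict_trans1)
  then have "translation_continuous (\<lambda>x. of_real (Re (f x)) + \<i> * of_real (Im (f x)))"
    by (intro translation_continuous_add translation_continuous_bounded_linear[where L = of_real]
          translation_continuous_bounded_linear[where L = "\<lambda>x. \<i> * of_real x"])
       (auto intro!: bounded_linear_intros bounded_linear_of_real bounded_linear_const_mult)
  then show ?thesis by (simp flip: complex_eq)
qed

section \<open>Plancherel identity and Fourier inversion\<close>


definition fourier :: "(real \<Rightarrow> complex) \<Rightarrow> real \<Rightarrow> complex" where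
  "fourier f \<xi> = (LBINT x. cis (- (\<xi> * x)) * f x)"

definition inv_fourier :: "(real \<Rightarrow> complex) \<Rightarrow> real \<Rightarrow> complex" where
  "inv_fourier f x = (LBINT \<xi>. cis (x * \<xi>) * f \<xi>) / of_real (2 * pi)"

lemma inv_fourier_eq_fourier: "inv_fourier f x = fourier f (- x) / of_real (2 * pi)"
  by (simp add: inv_fourier_def fourier_def)

lemma borel_measurable_cis [measurable]: "cis \<in> borel_measurable borel"
  by (intro borel_measurable_continuous_onI continuous_intros)

lemma borel_measurable_cnj [measurable]: "cnj \<in> borel_measurable borel"
  by (intro borel_measurable_continuous_onI continuous_intros)

lemma integrable_cis_mult:
  assumes "integrable lborel f"
  shows "integrable lborel (\<lambda>x. cis (a * x) * f x)"
proof (rule Bochner_Integration.integrable_bound[OF assms])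
  have [measurable]: "f \<in> borel_measurable borel" using assms by auto
  show "(\<lambda>x. cis (a * x) * f x) \<in> borel_measurable lborel" by measurable
qed (simp add: norm_mult)

lemma integrable_cis_uminus_mult:
  "integrable lborel f \<Longrightarrow> integrable lborel (\<lambda>x. cis (- (a * x)) * f x)"
  using integrable_cis_mult[of f "- a"] by simp

lemma borel_measurable_fourier [measurable]:
  assumes [measurable]: "f \<in> borel_measurable borel"
  shows "fourier f \<in> borel_measurable borel"
  unfolding fourier_def by measurable

lemma borel_measurable_inv_fourier [measurable]:
  assumes [measurable]: "f \<in> borel_measurable borel"
  shows "inv_fourier f \<in> borel_measurable borel"
  unfolding inv_fourier_def by measurable

lemma norm_fourier_le: "cmod (fourier f \<xi>) \<le> (LBINT x. cmod (f x))"
  unfolding fourier_def using integral_norm_bound[of lborel "\<lambda>x. cis (- (\<xi> * x)) * f x"]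
  by (simp add: norm_mult)

lemma fourier_diff:
  assumes "integrable lborel f" "integrable lborel g"
  shows "fourier (\<lambda>x. f x - g x) \<xi> = fourier f \<xi> - fourier g \<xi>"
  using integrable_cis_mult[OF assms(1), of "- \<xi>"] integrable_cis_mult[OF assms(2), of "- \<xi>"]
  by (simp add: fourier_def algebra_simps)

lemma cnj_fourier: "cnj (fourier f \<xi>) = (LBINT x. cis (\<xi> * x) * cnj (f x))"
  unfolding fourier_def by (simp add: cis_cnj flip: Bochner_Integration.integral_cnj)

section \<open>Gaussian regularisation and the autocorrelation\<close>

lemma integrable_gaussian:
  assumes "b > 0"
  shows "integrable lborel (\<lambda>\<xi>. exp (- (b * \<xi>)\<^sup>2 / 2) :: real)"
proof -
  have "integrable lborel (\<lambda>\<xi>. std_normal_density (0 + b * \<xi>))"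
    using assms by (intro lborel_integrable_real_affine) auto
  then have "integrable lborel (\<lambda>\<xi>. sqrt (2 * pi) * std_normal_density (0 + b * \<xi>))"
    by (rule integrable_mult_right)
  then show ?thesis by (simp add: std_normal_density_def)
qed

text \<open>This is the characteristic function of the standard normal law at u / b, after rescaling
  the variable by b.\<close>

lemma fourier_gaussian:
  assumes "b > 0"
  shows "(LBINT \<xi>. cis (u * \<xi>) * of_real (exp (- (b * \<xi>)\<^sup>2 / 2)))
    = of_real (sqrt (2 * pi) / b * exp (- (u / b)\<^sup>2 / 2))"
proof -
  have "of_real (exp (- (u / b)\<^sup>2 / 2)) = char std_normal_distribution (u / b)"
    by (simp add: char_std_normal_distribution)
  also have "\<dots> = (LBINT x. std_normal_density x *\<^sub>R cis (u / b * x))"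
    unfolding char_def by (subst integral_density) (auto simp: cis_conv_exp)
  also have "\<dots> = \<bar>b\<bar> *\<^sub>R (LBINT \<xi>. std_normal_density (0 + b * \<xi>) *\<^sub>R cis (u / b * (0 + b * \<xi>)))"
    by (rule lborel_integral_real_affine) (use assms in auto)
  also have "\<dots> = of_real b * (LBINT \<xi>. of_real (1 / sqrt (2 * pi)) *
        (cis (u * \<xi>) * of_real (exp (- (b * \<xi>)\<^sup>2 / 2))))"
    using assms by (simp add: scaleR_conv_of_real std_normal_density_def mult_ac)
  also have "\<dots> = of_real b * (of_real (1 / sqrt (2 * pi)) *
        (LBINT \<xi>. (cis (u * \<xi>) * of_real (exp (- (b * \<xi>)\<^sup>2 / 2)))))"
    by (subst integral_mult_right_zero) simp
  finally show ?thesis using assms by (simp add: field_simps)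
qed

text \<open>The Gaussian factor makes the double integral absolutely convergent. After Fubini,
  inversion becomes an average of f around y against a normal law of width b, with no regularity of
  f required.\<close>

lemma fourier_gaussian_mean:
  assumes f: "integrable lborel f" and b: "b > 0"
  shows "(LBINT \<xi>. cis (y * \<xi>) * (of_real (exp (- (b * \<xi>)\<^sup>2 / 2)) * fourier f \<xi>))
    = of_real (2 * pi) * (LBINT t. std_normal_density t *\<^sub>R f (y + b * t))"
proof -
  let ?m = "\<lambda>\<xi>. exp (- (b * \<xi>)\<^sup>2 / 2) :: real"
  let ?k = "\<lambda>\<xi> x. cis (y * \<xi>) * (of_real (?m \<xi>) * (cis (- (\<xi> * x)) * f x))"
  have [measurable]: "f \<in> borel_measurable borel" using f by auto
  have int: "integrable (lborel \<Otimes>\<^sub>M lborel) (case_prod ?k)"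
  proof (rule lborel_pair.Fubini_integrable)
    show "integrable lborel (\<lambda>\<xi>. LBINT x. norm (case_prod ?k (\<xi>, x)))"
      using integrable_gaussian[OF b] by (simp add: norm_mult)
    show "AE \<xi> in lborel. integrable lborel (\<lambda>x. case_prod ?k (\<xi>, x))"
      using integrable_cis_uminus_mult[OF f] by (intro AE_I2) simp
  qed measurable
  have "(LBINT \<xi>. cis (y * \<xi>) * (of_real (?m \<xi>) * fourier f \<xi>)) = (LBINT \<xi>. LBINT x. ?k \<xi> x)"
    by (simp add: fourier_def)
  also have "\<dots> = (LBINT x. LBINT \<xi>. ?k \<xi> x)"
    using lborel_pair.Fubini_integral[OF int] by simp
  also have "\<dots> = (LBINT x. of_real (sqrt (2 * pi) / b * exp (- ((y - x) / b)\<^sup>2 / 2)) * f x)"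
  proof (rule Bochner_Integration.integral_cong[OF refl])
    fix x
    have split: "cis ((y - x) * \<xi>) = cis (y * \<xi>) * cis (- (\<xi> * x))" for \<xi>
      by (simp add: cis_mult algebra_simps)
    have "(LBINT \<xi>. ?k \<xi> x) = (LBINT \<xi>. (cis ((y - x) * \<xi>) * of_real (?m \<xi>)) * f x)"
      unfolding split by (simp add: mult_ac)
    also have "\<dots> = (LBINT \<xi>. cis ((y - x) * \<xi>) * of_real (?m \<xi>)) * f x"
      by (rule integral_mult_left_zero)
    finally show "(LBINT \<xi>. ?k \<xi> x) = of_real (sqrt (2 * pi) / b * exp (- ((y - x) / b)\<^sup>2 / 2)) * f x"
      by (simp only: fourier_gaussian[OF b])
  qed
  also have "\<dots> = \<bar>b\<bar> *\<^sub>R (LBINT t. of_real (sqrt (2 * pi) / b * exp (- ((y - (y + b * t)) / b)\<^sup>2 / 2)) * f (y + b * t))"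
    by (rule lborel_integral_real_affine) (use b in auto)
  also have "(\<lambda>t. of_real (sqrt (2 * pi) / b * exp (- ((y - (y + b * t)) / b)\<^sup>2 / 2)) * f (y + b * t))
      = (\<lambda>t. of_real (2 * pi / b) * (std_normal_density t *\<^sub>R f (y + b * t)))"
  proof
    fix t
    have sq: "2 * pi * (1 / sqrt (2 * pi)) = sqrt (2 * pi)"
      by (simp add: real_div_sqrt)
    have "2 * pi / b * std_normal_density t = (2 * pi * (1 / sqrt (2 * pi))) / b * exp (- t\<^sup>2 / 2)"
      by (simp add: std_normal_density_def)
    also have "\<dots> = sqrt (2 * pi) / b * exp (- ((y - (y + b * t)) / b)\<^sup>2 / 2)"
      unfolding sq using b by simp
    finally have "sqrt (2 * pi) / b * exp (- ((y - (y + b * t)) / b)\<^sup>2 / 2) = 2 * pi / b * std_normal_density t"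
      by (rule sym)
    then show "of_real (sqrt (2 * pi) / b * exp (- ((y - (y + b * t)) / b)\<^sup>2 / 2)) * f (y + b * t)
        = of_real (2 * pi / b) * (std_normal_density t *\<^sub>R f (y + b * t))"
      by (simp only: of_real_mult scaleR_conv_of_real mult.assoc)
  qed
  also have "\<bar>b\<bar> *\<^sub>R (LBINT t. of_real (2 * pi / b) * (std_normal_density t *\<^sub>R f (y + b * t)))
      = of_real (2 * pi) * (LBINT t. std_normal_density t *\<^sub>R f (y + b * t))"
    using b by (subst integral_mult_right_zero) (simp add: scaleR_conv_of_real)
  finally show ?thesis .
qed

lemma L2_iff_integrable:
  "L2 f \<longleftrightarrow> f \<in> borel_measurable borel \<and> integrable lborel (\<lambda>x. (cmod (f x))\<^sup>2)"
  by (auto simp: L2_def integrable_iff_bounded)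

lemma L2_nn_integral:
  assumes "L2 f"
  shows "sq_int f = ennreal (LBINT x. (cmod (f x))\<^sup>2)"
  using assms by (intro nn_integral_eq_integral) (auto simp: L2_iff_integrable)

lemma integrable_norm_square_translate:
  assumes "L2 f"
  shows "integrable lborel (\<lambda>x. (cmod (f (x + s)))\<^sup>2)"
    "(LBINT x. (cmod (f (x + s)))\<^sup>2) = (LBINT x. (cmod (f x))\<^sup>2)"
  using lborel_integrable_real_affine[of "\<lambda>x. (cmod (f x))\<^sup>2" 1 s] assms
    lborel_integral_real_affine[of 1 "\<lambda>x. (cmod (f x))\<^sup>2" s]
  by (auto simp: L2_iff_integrable add.commute)

lemma norm_mult_le_squares: "cmod a * cmod b \<le> (cmod a)\<^sup>2 + (cmod b)\<^sup>2"
proof -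
  have "2 * (cmod a * cmod b) \<le> (cmod a)\<^sup>2 + (cmod b)\<^sup>2"
    using zero_le_power2[of "cmod a - cmod b"] by (simp add: power2_eq_square algebra_simps)
  moreover have "0 \<le> cmod a * cmod b" by simp
  ultimately show ?thesis by linarith
qed

lemma integrable_autocorrelation:
  assumes "L2 f"
  shows "integrable lborel (\<lambda>y. cnj (f y) * f (y + s))"
proof -
  have [measurable]: "f \<in> borel_measurable borel" using assms by (simp add: L2_iff_integrable)
  have "integrable lborel (\<lambda>y. (cmod (f y))\<^sup>2 + (cmod (f (y + s)))\<^sup>2)"
    using integrable_norm_square_translate(1)[OF assms, of s] assms
    by (intro Bochner_Integration.integrable_add) (auto simp: L2_iff_integrable)
  then show ?thesis
    by (rule Bochner_Integration.integrable_bound)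
       (auto simp: norm_mult intro!: AE_I2 order_trans[OF norm_mult_le_squares] intro: abs_ge_self)
qed

text \<open>Expand |f(y + s) - f(y)|^2 and use translation invariance. This converts continuity in
  the mean into continuity of the autocorrelation at s = 0.\<close>

lemma Re_autocorrelation:
  assumes "L2 f"
  shows "Re (LBINT y. cnj (f y) * f (y + s))
    = (LBINT y. (cmod (f y))\<^sup>2) - (LBINT y. (cmod (f (y + s) - f y))\<^sup>2) / 2"
    and "integrable lborel (\<lambda>y. (cmod (f (y + s) - f y))\<^sup>2)"
proof -
  have *: "(cmod (f (y + s) - f y))\<^sup>2
      = (cmod (f (y + s)))\<^sup>2 + (cmod (f y))\<^sup>2 - 2 * Re (cnj (f y) * f (y + s))" for y
    unfolding cmod_power2 by (simp add: power2_eq_square algebra_simps)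
  note 1 = integrable_norm_square_translate(1)[OF assms, of s]
    integrable_norm_square_translate(1)[OF assms, of 0, simplified]
    integrable_Re[OF integrable_autocorrelation[OF assms, of s]]
  have gen: "(LBINT y. a y + b y - 2 * c y) = (LBINT y. a y) + (LBINT y. b y) - 2 * (LBINT y. c y)"
    if "integrable lborel a" "integrable lborel b" "integrable lborel c" for a b c :: "real \<Rightarrow> real"
    using that by simp
  show "integrable lborel (\<lambda>y. (cmod (f (y + s) - f y))\<^sup>2)"
    unfolding * using 1
    by (intro Bochner_Integration.integrable_diff Bochner_Integration.integrable_add integrable_mult_right)
  have "(LBINT y. (cmod (f (y + s) - f y))\<^sup>2)
     = (LBINT y. (cmod (f (y + s)))\<^sup>2) + (LBINT y. (cmod (f y))\<^sup>2)
       - 2 * (LBINT y. Re (cnj (f y) * f (y + s)))"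
    unfolding * using 1 by (intro gen)
  then show "Re (LBINT y. cnj (f y) * f (y + s))
    = (LBINT y. (cmod (f y))\<^sup>2) - (LBINT y. (cmod (f (y + s) - f y))\<^sup>2) / 2"
    using integrable_norm_square_translate(2)[OF assms, of s]
      integral_Re[OF integrable_autocorrelation[OF assms, of s]]
    by (simp add: field_simps)
qed

lemma norm_autocorrelation_le:
  assumes "L2 f"
  shows "(LBINT y. cmod (cnj (f y) * f (y + s))) \<le> 2 * (LBINT y. (cmod (f y))\<^sup>2)"
proof -
  have "(LBINT y. cmod (cnj (f y) * f (y + s))) \<le> (LBINT y. (cmod (f y))\<^sup>2 + (cmod (f (y + s)))\<^sup>2)"
    using integrable_norm_square_translate(1)[OF assms, of s] assms integrable_autocorrelation[OF assms, of s]
    by (intro integral_mono Bochner_Integration.integrable_add integrable_norm)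
       (auto simp: L2_iff_integrable norm_mult norm_mult_le_squares)
  also have "\<dots> = 2 * (LBINT y. (cmod (f y))\<^sup>2)"
    using integrable_norm_square_translate[OF assms, of s] integrable_norm_square_translate[OF assms, of 0] by simp
  finally show ?thesis .
qed

text \<open>One factor of |fourier f|^2 is written out as an integral over y. A first Fubini puts
  the xi-integral inside, where \<open>fourier_gaussian_mean\<close> evaluates it; a second one
  exchanges y with the normal variable t and leaves the autocorrelation at b t.\<close>

lemma fourier_gaussian_energy:
  assumes f: "integrable lborel f" and f2: "L2 f" and b: "b > 0"
  shows "(LBINT \<xi>. exp (- (b * \<xi>)\<^sup>2 / 2) * (cmod (fourier f \<xi>))\<^sup>2)
    = 2 * pi * (LBINT t. std_normal_density t * Re (LBINT y. cnj (f y) * f (y + b * t)))"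
proof -
  let ?m = "\<lambda>\<xi>. exp (- (b * \<xi>)\<^sup>2 / 2) :: real"
  let ?k = "\<lambda>\<xi> y. (of_real (?m \<xi>) * fourier f \<xi>) * (cis (\<xi> * y) * cnj (f y))"
  let ?h = "\<lambda>t y. std_normal_density t *\<^sub>R (cnj (f y) * f (y + b * t))"
  have [measurable]: "f \<in> borel_measurable borel" using f by auto
  have cf: "integrable lborel (\<lambda>y. cnj (f y))" using f by simp
  have int: "integrable (lborel \<Otimes>\<^sub>M lborel) (case_prod ?k)"
  proof (rule lborel_pair.Fubini_integrable)
    have "integrable lborel (\<lambda>\<xi>. ?m \<xi> * (LBINT y. cmod (f y)) * (LBINT y. cmod (f y)))"
      using integrable_gaussian[OF b] by simp
    then show "integrable lborel (\<lambda>\<xi>. LBINT y. norm (case_prod ?k (\<xi>, y)))"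
    proof (rule Bochner_Integration.integrable_bound)
      show "AE \<xi> in lborel. norm (LBINT y. norm (case_prod ?k (\<xi>, y)))
          \<le> norm (?m \<xi> * (LBINT y. cmod (f y)) * (LBINT y. cmod (f y)))"
        using norm_fourier_le[of f]
        by (intro AE_I2) (auto simp: norm_mult abs_mult intro!: mult_mono)
    qed measurable
    show "AE \<xi> in lborel. integrable lborel (\<lambda>x. case_prod ?k (\<xi>, x))"
      using integrable_cis_mult[OF cf] by (intro AE_I2) simp
  qed measurable
  have int2: "integrable (lborel \<Otimes>\<^sub>M lborel) (case_prod ?h)"
  proof (rule lborel_pair.Fubini_integrable)
    have "integrable lborel (\<lambda>t. std_normal_density t * (2 * (LBINT y. (cmod (f y))\<^sup>2)))"
      by (intro integrable_mult_left integrable_normal_density) simp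
    then show "integrable lborel (\<lambda>t. LBINT y. norm (case_prod ?h (t, y)))"
    proof (rule Bochner_Integration.integrable_bound)
      show "AE t in lborel. norm (LBINT y. norm (case_prod ?h (t, y)))
          \<le> norm (std_normal_density t * (2 * (LBINT y. (cmod (f y))\<^sup>2)))"
        using norm_autocorrelation_le[OF f2]
        by (intro AE_I2) (auto simp: norm_mult abs_mult intro!: mult_left_mono)
    qed measurable
    show "AE t in lborel. integrable lborel (\<lambda>y. case_prod ?h (t, y))"
      using integrable_autocorrelation[OF f2] by (intro AE_I2) simp
  qed measurable
  have "of_real (LBINT \<xi>. ?m \<xi> * (cmod (fourier f \<xi>))\<^sup>2)
      = (LBINT \<xi>. (of_real (?m \<xi>) * fourier f \<xi>) * cnj (fourier f \<xi>))"
    by (subst integral_complex_of_real[symmetric], rule Bochner_Integration.integral_cong[OF refl])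
       (simp only: of_real_mult complex_norm_square mult.assoc)
  also have "\<dots> = (LBINT \<xi>. LBINT y. ?k \<xi> y)"
    by (simp add: cnj_fourier)
  also have "\<dots> = (LBINT y. LBINT \<xi>. ?k \<xi> y)"
    using lborel_pair.Fubini_integral[OF int] by simp
  also have "\<dots> = (LBINT y. LBINT \<xi>. cnj (f y) * (cis (y * \<xi>) * (of_real (?m \<xi>) * fourier f \<xi>)))"
    by (simp add: mult_ac)
  also have "\<dots> = (LBINT y. of_real (2 * pi) * (LBINT t. ?h t y))"
  proof (rule Bochner_Integration.integral_cong[OF refl])
    fix y
    have "(LBINT t. ?h t y) = cnj (f y) * (LBINT t. std_normal_density t *\<^sub>R f (y + b * t))"
      by (simp flip: integral_mult_right_zero)
    then show "(LBINT \<xi>. cnj (f y) * (cis (y * \<xi>) * (of_real (?m \<xi>) * fourier f \<xi>)))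
        = of_real (2 * pi) * (LBINT t. ?h t y)"
      by (simp only: integral_mult_right_zero fourier_gaussian_mean[OF f b] mult.left_commute)
  qed
  also have "\<dots> = of_real (2 * pi) * (LBINT y. LBINT t. ?h t y)"
    by (simp only: integral_mult_right_zero)
  also have "(LBINT y. LBINT t. ?h t y) = (LBINT t. LBINT y. ?h t y)"
    using lborel_pair.Fubini_integral[OF int2] by simp
  finally have "(LBINT \<xi>. ?m \<xi> * (cmod (fourier f \<xi>))\<^sup>2)
      = Re (of_real (2 * pi) * (LBINT t. LBINT y. ?h t y))"
    by (metis Re_complex_of_real)
  also have "\<dots> = 2 * pi * (LBINT t. Re (LBINT y. ?h t y))"
    using lborel_pair.integrable_fst[OF int2] by (subst integral_Re) simp_all
  finally show ?thesis by simp
qed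

text \<open>As the Gaussian factor tends to 1, the regularised energy increases to the energy of the
  transform, while the right-hand side is an average of the real part of the autocorrelation, which is
  continuous at 0 because translations are continuous in the mean.\<close>

theorem plancherel:
  assumes f: "integrable lborel f" and f2: "L2 f"
  shows "sq_int (fourier f)
    = ennreal (2 * pi) * sq_int f"
proof -
  have [measurable]: "f \<in> borel_measurable borel" using f by auto
  define N where "N = (LBINT x. (cmod (f x))\<^sup>2)"
  define b :: "nat \<Rightarrow> real" where "b n = 1 / Suc n" for n
  have b: "b n > 0" for n by (simp add: b_def)
  have b0: "b \<longlonglongrightarrow> 0"
    using LIMSEQ_inverse_real_of_nat by (simp add: b_def[abs_def] inverse_eq_divide)
  let ?m = "\<lambda>n \<xi>. exp (- (b n * \<xi>)\<^sup>2 / 2) :: real"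
  let ?\<rho> = "\<lambda>s. Re (LBINT y. cnj (f y) * f (y + s))"
  have \<rho>: "(\<lambda>n. ?\<rho> (s n)) \<longlonglongrightarrow> N" if "s \<longlonglongrightarrow> 0" for s
  proof -
    have "(\<lambda>n. sq_int (\<lambda>x. f (x + s n) - f x)) \<longlonglongrightarrow> 0"
      using translation_continuous_L2[OF f2] that by (simp add: translation_continuous_def)
    then have "(\<lambda>n. ennreal (LBINT x. (cmod (f (x + s n) - f x))\<^sup>2)) \<longlonglongrightarrow> ennreal 0"
      using Re_autocorrelation(2)[OF f2] by (simp add: nn_integral_eq_integral)
    then have "(\<lambda>n. LBINT x. (cmod (f (x + s n) - f x))\<^sup>2) \<longlonglongrightarrow> 0"
      by (subst (asm) tendsto_ennreal_iff) auto
    then have "(\<lambda>n. N - (LBINT x. (cmod (f (x + s n) - f x))\<^sup>2) / 2) \<longlonglongrightarrow> N - 0 / 2"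
      by (intro tendsto_intros) auto
    then show ?thesis by (simp add: Re_autocorrelation(1)[OF f2] N_def)
  qed
  have \<rho>_le: "\<bar>?\<rho> s\<bar> \<le> 2 * N" for s
  proof -
    have "\<bar>?\<rho> s\<bar> \<le> (LBINT y. cmod (cnj (f y) * f (y + s)))"
      by (rule order_trans[OF abs_Re_le_cmod integral_norm_bound])
    then show ?thesis using norm_autocorrelation_le[OF f2, of s] by (simp add: N_def)
  qed
  have meas: "(\<lambda>t. ?\<rho> (b n * t)) \<in> borel_measurable borel" for n by measurable
  have "(\<lambda>n. LBINT t. std_normal_density t * ?\<rho> (b n * t)) \<longlonglongrightarrow> (LBINT t. std_normal_density t * N)"
  proof (rule integral_dominated_convergence[where w = "\<lambda>t. std_normal_density t * (2 * N)"])
    show "integrable lborel (\<lambda>t. std_normal_density t * (2 * N))"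
      by (intro integrable_mult_left integrable_normal_density) simp
    show "AE t in lborel. (\<lambda>n. std_normal_density t * ?\<rho> (b n * t)) \<longlonglongrightarrow> std_normal_density t * N"
      using tendsto_mult_left_zero[OF b0] by (intro AE_I2 tendsto_intros \<rho>)
    show "AE t in lborel. norm (std_normal_density t * ?\<rho> (b n * t)) \<le> std_normal_density t * (2 * N)" for n
      using \<rho>_le by (intro AE_I2) (auto simp: abs_mult intro!: mult_left_mono)
  qed (use meas in measurable)
  then have "(\<lambda>n. 2 * pi * (LBINT t. std_normal_density t * ?\<rho> (b n * t))) \<longlonglongrightarrow> 2 * pi * N"
    using integral_normal_density[of 1 0] by (intro tendsto_intros) simp
  then have lim1: "(\<lambda>n. ennreal (LBINT \<xi>. ?m n \<xi> * (cmod (fourier f \<xi>))\<^sup>2)) \<longlonglongrightarrow> ennreal (2 * pi * N)"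
    unfolding fourier_gaussian_energy[OF f f2 b] by (rule tendsto_ennrealI)
  have int: "integrable lborel (\<lambda>\<xi>. ?m n \<xi> * (cmod (fourier f \<xi>))\<^sup>2)" for n
  proof (rule Bochner_Integration.integrable_bound)
    show "integrable lborel (\<lambda>\<xi>. ?m n \<xi> * (LBINT y. cmod (f y))\<^sup>2)"
      using integrable_gaussian[OF b] by simp
    show "AE \<xi> in lborel. norm (?m n \<xi> * (cmod (fourier f \<xi>))\<^sup>2) \<le> norm (?m n \<xi> * (LBINT y. cmod (f y))\<^sup>2)"
      using norm_fourier_le[of f] by (intro AE_I2) (auto simp: abs_mult intro!: mult_left_mono power_mono)
  qed measurable
  \<comment> \<open>Monotone rather than dominated convergence: finiteness of the limiting energy is
    part of what is being proved.\<close>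
  have "(\<lambda>n. \<integral>\<^sup>+\<xi>. ennreal (?m n \<xi> * (cmod (fourier f \<xi>))\<^sup>2) \<partial>lborel)
      \<longlonglongrightarrow> sq_int (fourier f)"
  proof (rule nn_integral_LIMSEQ)
    show "incseq (\<lambda>n \<xi>. ennreal (?m n \<xi> * (cmod (fourier f \<xi>))\<^sup>2))"
    proof (intro incseq_SucI le_funI ennreal_leI mult_right_mono)
      fix n \<xi>
      have "(b (Suc n) * \<xi>)\<^sup>2 \<le> (b n * \<xi>)\<^sup>2"
        unfolding power_mult_distrib by (intro mult_right_mono power_mono) (auto simp: b_def field_simps)
      then show "?m n \<xi> \<le> ?m (Suc n) \<xi>" by simp
    qed simp
    fix \<xi>
    have "(\<lambda>n. ?m n \<xi> * (cmod (fourier f \<xi>))\<^sup>2) \<longlonglongrightarrow> exp (- (0 * \<xi>)\<^sup>2 / 2) * (cmod (fourier f \<xi>))\<^sup>2"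
      by (intro tendsto_intros b0) auto
    then show "(\<lambda>n. ennreal (?m n \<xi> * (cmod (fourier f \<xi>))\<^sup>2)) \<longlonglongrightarrow> ennreal ((cmod (fourier f \<xi>))\<^sup>2)"
      by (intro tendsto_ennrealI) simp
  qed measurable
  moreover have "(\<integral>\<^sup>+\<xi>. ennreal (?m n \<xi> * (cmod (fourier f \<xi>))\<^sup>2) \<partial>lborel)
      = ennreal (LBINT \<xi>. ?m n \<xi> * (cmod (fourier f \<xi>))\<^sup>2)" for n
    using int[of n] by (intro nn_integral_eq_integral) auto
  ultimately have "sq_int (fourier f) = ennreal (2 * pi * N)"
    using lim1 by (auto intro: LIMSEQ_unique)
  then show ?thesis
    unfolding L2_nn_integral[OF f2] by (simp add: N_def ennreal_mult)
qed


lemma plancherel_integral: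
  assumes f: "integrable lborel f" and f2: "L2 f"
  shows "integrable lborel (\<lambda>\<xi>. (cmod (fourier f \<xi>))\<^sup>2)"
    "(LBINT \<xi>. (cmod (fourier f \<xi>))\<^sup>2) = 2 * pi * (LBINT x. (cmod (f x))\<^sup>2)"
proof -
  have [measurable]: "f \<in> borel_measurable borel" using f by auto
  have eq: "sq_int (fourier f) = ennreal (2 * pi * (LBINT x. (cmod (f x))\<^sup>2))"
    unfolding plancherel[OF f f2] L2_nn_integral[OF f2] by (simp add: ennreal_mult)
  then have "has_bochner_integral lborel (\<lambda>\<xi>. (cmod (fourier f \<xi>))\<^sup>2) (2 * pi * (LBINT x. (cmod (f x))\<^sup>2))"
    by (intro has_bochner_integral_nn_integral) auto
  then show "integrable lborel (\<lambda>\<xi>. (cmod (fourier f \<xi>))\<^sup>2)"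
    "(LBINT \<xi>. (cmod (fourier f \<xi>))\<^sup>2) = 2 * pi * (LBINT x. (cmod (f x))\<^sup>2)"
    by (auto simp: has_bochner_integral_iff)
qed

lemma norm_inv_fourier_le: "cmod (inv_fourier g x) \<le> (LBINT \<xi>. cmod (g \<xi>)) / (2 * pi)"
  using norm_fourier_le[of g "- x"] by (simp add: inv_fourier_eq_fourier norm_divide divide_right_mono)

lemma plancherel_inv_fourier:
  assumes g: "integrable lborel g" and g2: "L2 g"
  shows "sq_int (inv_fourier g)
    = ennreal (1 / (2 * pi)) * sq_int g"
proof -
  have [measurable]: "g \<in> borel_measurable borel" using g by auto
  have "sq_int (inv_fourier g)
      = (\<integral>\<^sup>+x. ennreal (1 / (2 * pi)\<^sup>2) * ennreal ((cmod (fourier g (- x)))\<^sup>2) \<partial>lborel)"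
    by (simp add: inv_fourier_eq_fourier norm_divide power_divide ennreal_mult[symmetric])
  also have "\<dots> = ennreal (1 / (2 * pi)\<^sup>2) * sq_int (\<lambda>x. fourier g (- x))"
    by (rule nn_integral_cmult) measurable
  also have "sq_int (\<lambda>x. fourier g (- x)) = sq_int (fourier g)"
    using nn_integral_real_affine[of "\<lambda>x. ennreal ((cmod (fourier g x))\<^sup>2)" "-1" 0] by simp
  also have "\<dots> = ennreal (2 * pi) * sq_int g"
    by (rule plancherel[OF g g2])
  finally show ?thesis
    by (simp add: mult.assoc[symmetric] ennreal_mult[symmetric] power2_eq_square)
qed

lemma L2_inv_fourier:
  assumes g: "integrable lborel g" and g2: "L2 g"
  shows "L2 (inv_fourier g)"
proof -
  have [measurable]: "g \<in> borel_measurable borel" using g by auto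
  show ?thesis
    using g2 plancherel_inv_fourier[OF g g2] by (auto simp: L2_def ennreal_mult_less_top)
qed

section \<open>Truncated transforms and inversion in the mean\<close>

abbreviation cutoff :: "real \<Rightarrow> (real \<Rightarrow> complex) \<Rightarrow> real \<Rightarrow> complex" where
  "cutoff R f \<equiv> \<lambda>x. indicat_real {-R..R} x *\<^sub>R f x"

text \<open>Identifies the integral inside \<open>FT_L2\<close> with an L1 transform, to which
  \<open>plancherel\<close> applies.\<close>

lemma truncated_fourier:
  "(LINT x:{-R..R}|lborel. cis (- (\<xi> * x)) * f x) = fourier (cutoff R f) \<xi>"
  by (simp add: set_lebesgue_integral_def fourier_def)

lemma L2_truncate:
  assumes "L2 f"
  shows "L2 (cutoff R f)"
    and "integrable lborel (cutoff R f)"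
proof -
  have [measurable]: "f \<in> borel_measurable borel" and f: "integrable lborel (\<lambda>x. (cmod (f x))\<^sup>2)"
    using assms by (auto simp: L2_iff_integrable)
  have "integrable lborel (\<lambda>x. (cmod (cutoff R f x))\<^sup>2)"
    by (rule Bochner_Integration.integrable_bound[OF f]) (auto simp: indicator_def)
  then show "L2 (cutoff R f)"
    by (simp add: L2_iff_integrable)
  have "integrable lborel (\<lambda>x. indicat_real {-R..R} x + (cmod (f x))\<^sup>2)"
    by (intro Bochner_Integration.integrable_add f integrable_real_indicator) (auto simp: emeasure_lborel_Icc_eq)
  then show "integrable lborel (cutoff R f)"
  proof (rule Bochner_Integration.integrable_bound)
    have "t \<le> 1 + t\<^sup>2" for t :: real
      using zero_le_power2[of "t - 1 / 2"] by (simp add: power2_eq_square algebra_simps)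
    then show "AE x in lborel. norm (cutoff R f x) \<le> norm (indicat_real {-R..R} x + (cmod (f x))\<^sup>2)"
      by (intro AE_I2) (auto simp: indicator_def)
  qed measurable
qed

text \<open>By Fubini, the inner product of g with the transform of the truncated inverse equals 2 pi times
  the energy of the truncation, so that the squared error is the energy of g minus 2 pi times it.\<close>

theorem FT_L2_inv_fourier:
  assumes g: "integrable lborel g" and g2: "L2 g"
  shows "FT_L2 (inv_fourier g) g"
proof -
  let ?f = "inv_fourier g"
  let ?t = "\<lambda>R x. cutoff R ?f x"
  let ?N = "\<lambda>g. LBINT x. (cmod (g x))\<^sup>2"
  have [measurable]: "g \<in> borel_measurable borel" using g by auto
  have f2: "L2 ?f" by (rule L2_inv_fourier[OF g g2])
  note t2 = L2_truncate(1)[OF f2] and t1 = L2_truncate(2)[OF f2]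
  have N: "?N g = 2 * pi * ?N ?f"
  proof -
    have "ennreal (?N ?f) = ennreal (1 / (2 * pi) * ?N g)"
      using plancherel_inv_fourier[OF g g2] unfolding L2_nn_integral[OF g2] L2_nn_integral[OF f2]
      by (simp add: ennreal_mult[symmetric])
    then show ?thesis by (subst (asm) ennreal_inj) auto
  qed
  have cross: "(LBINT \<xi>. fourier (?t R) \<xi> * cnj (g \<xi>)) = of_real (2 * pi * ?N (?t R))"
    and cross_int: "integrable lborel (\<lambda>\<xi>. fourier (?t R) \<xi> * cnj (g \<xi>))" for R
  proof -
    let ?k = "\<lambda>\<xi> x. (cis (- (\<xi> * x)) * ?t R x) * cnj (g \<xi>)"
    have int: "integrable (lborel \<Otimes>\<^sub>M lborel) (case_prod ?k)"
    proof (rule lborel_pair.Fubini_integrable)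
      show "integrable lborel (\<lambda>\<xi>. LBINT x. norm (case_prod ?k (\<xi>, x)))"
        using g by (simp add: norm_mult flip: mult.assoc)
      show "AE \<xi> in lborel. integrable lborel (\<lambda>x. case_prod ?k (\<xi>, x))"
        by (intro AE_I2, simp only: prod.case)
           (intro integrable_mult_left integrable_cis_uminus_mult t1)
    qed measurable
    have eq: "fourier (?t R) \<xi> * cnj (g \<xi>) = (LBINT x. ?k \<xi> x)" for \<xi>
      by (simp only: fourier_def integral_mult_left_zero)
    show "integrable lborel (\<lambda>\<xi>. fourier (?t R) \<xi> * cnj (g \<xi>))"
      unfolding eq using lborel_pair.integrable_fst[OF int] by simp
    have "(LBINT \<xi>. fourier (?t R) \<xi> * cnj (g \<xi>)) = (LBINT x. LBINT \<xi>. ?k \<xi> x)"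
      unfolding eq using lborel_pair.Fubini_integral[OF int] by simp
    also have "\<dots> = (LBINT x. of_real (2 * pi * (cmod (?t R x))\<^sup>2))"
    proof (rule Bochner_Integration.integral_cong[OF refl])
      fix x
      have "(LBINT \<xi>. ?k \<xi> x) = (LBINT \<xi>. ?t R x * (cis (- (x * \<xi>)) * cnj (g \<xi>)))"
        by (intro Bochner_Integration.integral_cong refl) (simp only: mult_ac)
      also have "\<dots> = ?t R x * (LBINT \<xi>. cis (- (x * \<xi>)) * cnj (g \<xi>))"
        by (rule integral_mult_right_zero)
      also have "(LBINT \<xi>. cis (- (x * \<xi>)) * cnj (g \<xi>)) = cnj (LBINT \<xi>. cis (x * \<xi>) * g \<xi>)"
        by (simp add: cis_cnj flip: Bochner_Integration.integral_cnj)
      also have "\<dots> = of_real (2 * pi) * cnj (?f x)"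
        by (simp add: inv_fourier_def)
      also have "?t R x * (of_real (2 * pi) * cnj (?f x)) = of_real (2 * pi * (cmod (?t R x))\<^sup>2)"
        by (simp only: of_real_mult complex_norm_square) (simp add: indicator_def)
      finally show "(LBINT \<xi>. ?k \<xi> x) = of_real (2 * pi * (cmod (?t R x))\<^sup>2)" .
    qed
    finally show "(LBINT \<xi>. fourier (?t R) \<xi> * cnj (g \<xi>)) = of_real (2 * pi * ?N (?t R))"
      by (simp only: integral_complex_of_real integral_mult_right_zero)
  qed
  have err: "sq_int (\<lambda>\<xi>. g \<xi> - fourier (?t R) \<xi>) = ennreal (?N g - 2 * pi * ?N (?t R))" for R
  proof -
    have pw: "(cmod (g \<xi> - fourier (?t R) \<xi>))\<^sup>2
        = (cmod (g \<xi>))\<^sup>2 + (cmod (fourier (?t R) \<xi>))\<^sup>2 - 2 * Re (fourier (?t R) \<xi> * cnj (g \<xi>))" for \<xi>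
      unfolding cmod_power2 by (simp add: power2_eq_square algebra_simps)
    have gen: "integrable lborel (\<lambda>y. a y + b y - 2 * c y)"
      "(LBINT y. a y + b y - 2 * c y) = (LBINT y. a y) + (LBINT y. b y) - 2 * (LBINT y. c y)"
      if "integrable lborel a" "integrable lborel b" "integrable lborel c" for a b c :: "real \<Rightarrow> real"
      using that by simp_all
    note ints = L2_iff_integrable[THEN iffD1, OF g2, THEN conjunct2] plancherel_integral(1)[OF t1 t2]
      integrable_Re[OF cross_int]
    have "integrable lborel (\<lambda>\<xi>. (cmod (g \<xi> - fourier (?t R) \<xi>))\<^sup>2)"
      unfolding pw by (rule gen(1)[OF ints])
    then have "sq_int (\<lambda>\<xi>. g \<xi> - fourier (?t R) \<xi>)
        = ennreal (LBINT \<xi>. (cmod (g \<xi> - fourier (?t R) \<xi>))\<^sup>2)"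
      by (intro nn_integral_eq_integral) auto
    also have "(LBINT \<xi>. (cmod (g \<xi> - fourier (?t R) \<xi>))\<^sup>2) = ?N g - 2 * pi * ?N (?t R)"
      unfolding pw gen(2)[OF ints] plancherel_integral(2)[OF t1 t2] integral_Re[OF cross_int] cross
      by simp
    finally show ?thesis .
  qed
  have "((\<lambda>R. ?N (?t R)) \<longlongrightarrow> ?N ?f) at_top"
  proof (rule integral_dominated_convergence_at_top[where w = "\<lambda>x. (cmod (?f x))\<^sup>2"])
    show "integrable lborel (\<lambda>x. (cmod (?f x))\<^sup>2)" using f2 by (simp add: L2_iff_integrable)
    show "\<forall>\<^sub>F R in at_top. AE x in lborel. norm ((cmod (?t R x))\<^sup>2) \<le> (cmod (?f x))\<^sup>2"
      by (intro always_eventually allI AE_I2) (auto simp: indicator_def)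
    show "AE x in lborel. ((\<lambda>R. (cmod (?t R x))\<^sup>2) \<longlongrightarrow> (cmod (?f x))\<^sup>2) at_top"
    proof (rule AE_I2)
      fix x :: real
      have "eventually (\<lambda>R. (cmod (?t R x))\<^sup>2 = (cmod (?f x))\<^sup>2) at_top"
        using eventually_ge_at_top[of "\<bar>x\<bar>"] by eventually_elim (auto simp: indicator_def)
      then show "((\<lambda>R. (cmod (?t R x))\<^sup>2) \<longlongrightarrow> (cmod (?f x))\<^sup>2) at_top"
        by (rule tendsto_eventually)
    qed
  qed measurable
  then have "((\<lambda>R. ennreal (?N g - 2 * pi * ?N (?t R))) \<longlongrightarrow> ennreal (?N g - 2 * pi * ?N ?f)) at_top"
    by (intro tendsto_ennrealI tendsto_intros)
  then show ?thesis
    using f2 g2 by (simp add: FT_L2_def truncated_fourier err N)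
qed

text \<open>The truncations of f and of \<open>inv_fourier g\<close> have transforms with the same
  mean-square limit g. By Plancherel the energy of their difference on [-R, R] tends to 0 as R
  grows; but this energy is nondecreasing in R, hence 0 for every R.\<close>

theorem FT_L2_imp_inv_fourier:
  assumes "FT_L2 f g" and g: "integrable lborel g"
  shows "AE x in lborel. f x = inv_fourier g x"
proof -
  have f2: "L2 f" and g2: "L2 g"
    and lf: "((\<lambda>R. sq_int (\<lambda>\<xi>. g \<xi> - fourier (cutoff R f) \<xi>)) \<longlongrightarrow> 0) at_top"
    using assms by (auto simp: FT_L2_def truncated_fourier)
  let ?h = "inv_fourier g"
  have h2: "L2 ?h"
    and lh: "((\<lambda>R. sq_int (\<lambda>\<xi>. g \<xi> - fourier (cutoff R ?h) \<xi>)) \<longlongrightarrow> 0) at_top"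
    using FT_L2_inv_fourier[OF g g2] by (auto simp: FT_L2_def truncated_fourier)
  have [measurable]: "g \<in> borel_measurable borel" "f \<in> borel_measurable borel"
    using f2 g by (auto simp: L2_def)
  let ?d = "\<lambda>R x. cutoff R f x - cutoff R ?h x"
  let ?I = "\<lambda>R. sq_int (?d R)"
  let ?e = "\<lambda>f R. sq_int (\<lambda>\<xi>. g \<xi> - fourier (cutoff R f) \<xi>)"
  have le: "ennreal (2 * pi) * ?I R \<le> 2 * ?e ?h R + 2 * ?e f R" for R
  proof -
    note tr = L2_truncate[OF f2, of R] L2_truncate[OF h2, of R]
    have int: "integrable lborel (?d R)" using tr by simp
    have "L2 (?d R)"
    proof -
      have "?I R \<le> 2 * sq_int (\<lambda>x. cutoff R f x)
            + 2 * sq_int (\<lambda>x. - (cutoff R ?h x))"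
        unfolding diff_conv_add_uminus by (rule nn_integral_norm_add_square_le) measurable
      also have "\<dots> < \<infinity>" using tr by (simp add: L2_def ennreal_mult_less_top)
      finally show ?thesis by (simp add: L2_def)
    qed
    then have "ennreal (2 * pi) * ?I R = sq_int (fourier (?d R))"
      using plancherel[OF int] by simp
    also have "\<dots> = sq_int (\<lambda>\<xi>. (g \<xi> - fourier (cutoff R ?h) \<xi>)
        + - (g \<xi> - fourier (cutoff R f) \<xi>))"
      by (simp add: fourier_diff[OF tr(2) tr(4)])
    also have "\<dots> \<le> 2 * ?e ?h R + 2 * sq_int (\<lambda>\<xi>. - (g \<xi> - fourier (cutoff R f) \<xi>))"
      by (rule nn_integral_norm_add_square_le) measurable
    finally show ?thesis by (simp add: norm_minus_commute)
  qed
  have "((\<lambda>R. 2 * ?e ?h R + 2 * ?e f R) \<longlongrightarrow> 2 * 0 + 2 * 0) at_top"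
    by (intro tendsto_add ennreal_tendsto_cmult lf lh) auto
  then have lim: "((\<lambda>R. ennreal (2 * pi) * ?I R) \<longlongrightarrow> 0) at_top"
    by (intro tendsto_0_le_ennreal[OF _ le]) simp
  have zero: "?I S = 0" for S
  proof -
    have "ennreal (2 * pi) * ?I S \<le> 0"
    proof (rule tendsto_lowerbound[OF lim])
      show "\<forall>\<^sub>F R in at_top. ennreal (2 * pi) * ?I S \<le> ennreal (2 * pi) * ?I R"
        using eventually_ge_at_top[of S]
      proof eventually_elim
        case (elim R)
        then show ?case
          by (intro mult_left_mono nn_integral_mono ennreal_leI power_mono) (auto simp: indicator_def)
      qed
    qed simp
    then show ?thesis by simp
  qed
  have "AE x in lborel. \<forall>n::nat. ?d (real n) x = 0"
  proof (unfold AE_all_countable, intro allI)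
    fix n :: nat
    have "AE x in lborel. ennreal ((cmod (?d (real n) x))\<^sup>2) = 0"
      using zero[of "real n"] by (subst (asm) nn_integral_0_iff_AE) auto
    then show "AE x in lborel. ?d (real n) x = 0" by eventually_elim simp
  qed
  then show ?thesis
  proof eventually_elim
    case (elim x)
    obtain n :: nat where "\<bar>x\<bar> \<le> real n" using real_arch_simple by blast
    then show ?case using elim[rule_format, of n] by (auto simp: indicator_def split: if_splits)
  qed
qed

lemma integrable_lborel_uminus:
  fixes f :: "real \<Rightarrow> 'a::{banach, second_countable_topology}"
  shows "integrable lborel f \<Longrightarrow> integrable lborel (\<lambda>x. f (- x))"
  using lborel_integrable_real_affine[of f "-1" 0] by simp

lemma cnj_inv_fourier: "cnj (inv_fourier g x) = inv_fourier (\<lambda>\<xi>. cnj (g (- \<xi>))) x"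
proof -
  have "cnj (LBINT \<xi>. cis (x * \<xi>) * g \<xi>) = (LBINT \<xi>. cis (- (x * \<xi>)) * cnj (g \<xi>))"
    by (simp add: cis_cnj flip: Bochner_Integration.integral_cnj)
  also have "\<dots> = (LBINT \<xi>. cis (x * \<xi>) * cnj (g (- \<xi>)))"
    using lborel_integral_real_affine[of "-1" "\<lambda>\<xi>. cis (- (x * \<xi>)) * cnj (g \<xi>)" 0] by simp
  finally show ?thesis by (simp add: inv_fourier_def)
qed

lemma inv_fourier_real:
  assumes "\<And>\<xi>. g (- \<xi>) = cnj (g \<xi>)"
  shows "of_real (Re (inv_fourier g x)) = inv_fourier g x"
  using cnj_inv_fourier[of g x] assms by (simp add: complex_eq_iff)

text \<open>The inverse transform of g minus its reflected conjugate is F minus its conjugate almost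
  everywhere, that is 0; Plancherel then forces the difference itself to vanish.\<close>

lemma FT_L2_real_imp_hermitian:
  assumes FT: "FT_L2 (\<lambda>x. of_real (F x)) g" and g: "integrable lborel g"
  shows "AE \<xi> in lborel. g (- \<xi>) = cnj (g \<xi>)"
proof -
  have [measurable]: "g \<in> borel_measurable borel" and g2: "L2 g"
    using FT g by (auto simp: FT_L2_def)
  let ?g' = "\<lambda>\<xi>. cnj (g (- \<xi>))"
  let ?h = "\<lambda>\<xi>. g \<xi> - ?g' \<xi>"
  have g': "integrable lborel ?g'"
    using integrable_lborel_uminus[OF g] by simp
  have fin: "sq_int (\<lambda>\<xi>. ?g' \<xi>) < \<infinity>"
    using nn_integral_real_affine[of "\<lambda>x. ennreal ((cmod (g x))\<^sup>2)" "-1" 0] g2 by (simp add: L2_def)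
  have h: "integrable lborel ?h" using g g' by simp
  have h2: "L2 ?h"
  proof -
    have "sq_int ?h
        \<le> 2 * sq_int g + 2 * sq_int (\<lambda>\<xi>. - ?g' \<xi>)"
      unfolding diff_conv_add_uminus by (rule nn_integral_norm_add_square_le) measurable
    also have "\<dots> < \<infinity>" using fin g2 by (simp add: L2_def ennreal_mult_less_top)
    finally show ?thesis by (simp add: L2_def)
  qed
  have "AE x in lborel. inv_fourier ?h x = 0"
    using FT_L2_imp_inv_fourier[OF FT g]
  proof eventually_elim
    case (elim x)
    have "inv_fourier ?h x = inv_fourier g x - inv_fourier ?g' x"
      using fourier_diff[OF g g', of "- x"] by (simp add: inv_fourier_eq_fourier diff_divide_distrib)
    also have "\<dots> = inv_fourier g x - cnj (inv_fourier g x)" by (simp add: cnj_inv_fourier)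
    finally show ?case by (simp flip: elim)
  qed
  then have "sq_int (inv_fourier ?h) = 0"
    by (subst nn_integral_0_iff_AE) auto
  then have "sq_int ?h = 0"
    unfolding plancherel_inv_fourier[OF h h2] by simp
  then have "AE \<xi> in lborel. ennreal ((cmod (?h \<xi>))\<^sup>2) = 0"
    by (subst (asm) nn_integral_0_iff_AE) auto
  then show ?thesis by eventually_elim (auto simp: complex_eq_iff)
qed

section \<open>The Airy function\<close>


lemma norm_exp_minus_1_le: "cmod (exp w - 1) \<le> cmod w * exp (cmod w)"
proof -
  have "cmod (exp w - exp 0) \<le> exp (cmod w) * cmod (w - 0)"
  proof (rule field_differentiable_bound[where S = "cball 0 (cmod w)" and f' = exp])
    fix z :: complex assume "z \<in> cball 0 (cmod w)"
    then show "cmod (exp z) \<le> exp (cmod w)"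
      using norm_exp[of z] by (auto intro: order_trans)
  qed (auto intro!: derivative_eq_intros)
  then show ?thesis by (simp add: mult.commute)
qed

section \<open>Differentiation under the integral and integrals over lines\<close>

lemma integrable_laplace:
  fixes k p :: "real \<Rightarrow> complex"
  assumes [measurable]: "k \<in> borel_measurable borel" "p \<in> borel_measurable borel"
    and int: "\<And>R. integrable lborel (\<lambda>s. cmod (k s) * exp (R * cmod (p s)))"
  shows "integrable lborel (\<lambda>s. k s * exp (- (z * p s)))"
proof (rule Bochner_Integration.integrable_bound[OF int[of "cmod z"]])
  show "AE s in lborel. norm (k s * exp (- (z * p s))) \<le> norm (cmod (k s) * exp (cmod z * cmod (p s)))"
  proof (rule AE_I2)
    fix s
    have "cmod (exp (- (z * p s))) \<le> exp (cmod z * cmod (p s))"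
      using norm_exp[of "- (z * p s)"] by (simp add: norm_mult)
    then show "norm (k s * exp (- (z * p s))) \<le> norm (cmod (k s) * exp (cmod z * cmod (p s)))"
      by (auto simp: norm_mult intro!: mult_left_mono)
  qed
qed measurable

lemma has_field_derivative_laplace:
  fixes k p :: "real \<Rightarrow> complex"
  assumes [measurable]: "k \<in> borel_measurable borel" "p \<in> borel_measurable borel"
    and int: "\<And>R. integrable lborel (\<lambda>s. cmod (k s) * exp (R * cmod (p s)))"
  shows "((\<lambda>z. LBINT s. k s * exp (- (z * p s))) has_field_derivative
    (LBINT s. - p s * k s * exp (- (z * p s)))) (at z)"
  unfolding has_field_derivative_iff tendsto_at_iff_sequentially
proof (intro allI impI)
  fix X :: "nat \<Rightarrow> complex" assume X: "\<forall>i. X i \<in> UNIV - {z}" "X \<longlonglongrightarrow> z"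
  let ?f = "\<lambda>z. LBINT s. k s * exp (- (z * p s))"
  define h where "h i = X i - z" for i
  have h0: "h i \<noteq> 0" for i using X(1) by (auto simp: h_def)
  have hl: "h \<longlonglongrightarrow> 0" using X(2) unfolding h_def by (simp add: LIM_zero_iff)
  then have "filterlim h (at 0) sequentially" using h0 by (intro filterlim_atI) auto
  obtain B where B: "\<And>i. cmod (h i) \<le> B"
    using convergent_imp_Bseq[OF convergentI[OF hl]] unfolding Bseq_def by blast
  let ?q = "\<lambda>i s. k s * exp (- (z * p s)) * ((exp (- (h i * p s)) - 1) / h i)"
  have eq: "(?f (X i) - ?f z) / (X i - z) = (LBINT s. ?q i s)" for i
  proof -
    have "?q i s = (k s * exp (- (X i * p s)) - k s * exp (- (z * p s))) / h i" for s
      by (simp add: h_def exp_add[symmetric] algebra_simps diff_divide_distrib)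
    then have "(LBINT s. ?q i s) = (LBINT s. k s * exp (- (X i * p s)) - k s * exp (- (z * p s))) / h i"
      by (simp only: integral_divide_zero)
    also have "\<dots> = (?f (X i) - ?f z) / h i"
      using integrable_laplace[OF assms, of "X i"] integrable_laplace[OF assms, of z] by simp
    finally show ?thesis unfolding h_def by (rule sym)
  qed
  have "(\<lambda>i. LBINT s. ?q i s) \<longlonglongrightarrow> (LBINT s. - p s * k s * exp (- (z * p s)))"
  \<comment> \<open>In the exponent, \<open>cmod z\<close> comes from the kernel, \<open>B\<close>
    from the mean value bound for the difference quotient, and 1 from |p| \<le> exp |p|. Hypothesis
    \<open>int\<close> holds for every exponent, so any such constant is admissible.\<close>
  proof (rule integral_dominated_convergence[where w = "\<lambda>s. cmod (k s) * exp ((cmod z + B + 1) * cmod (p s))"])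
    show "AE s in lborel. (\<lambda>i. ?q i s) \<longlonglongrightarrow> - p s * k s * exp (- (z * p s))"
    proof (rule AE_I2)
      fix s
      have "((\<lambda>h. exp (- (h * p s))) has_field_derivative - p s) (at 0)"
        by (auto intro!: derivative_eq_intros)
      then have "((\<lambda>h. (exp (- (h * p s)) - 1) / h) \<longlongrightarrow> - p s) (at 0)"
        by (simp add: has_field_derivative_iff)
      then have "(\<lambda>i. (exp (- (h i * p s)) - 1) / h i) \<longlonglongrightarrow> - p s"
        by (rule filterlim_compose) fact
      then have "(\<lambda>i. ?q i s) \<longlonglongrightarrow> k s * exp (- (z * p s)) * - p s"
        by (rule tendsto_mult_left)
      then show "(\<lambda>i. ?q i s) \<longlonglongrightarrow> - p s * k s * exp (- (z * p s))"
        by (simp add: mult_ac)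
    qed
    show "AE s in lborel. norm (?q i s) \<le> cmod (k s) * exp ((cmod z + B + 1) * cmod (p s))" for i
    proof (rule AE_I2)
      fix s
      let ?P = "cmod (p s)"
      have "cmod ((exp (- (h i * p s)) - 1) / h i) \<le> ?P * exp (cmod (h i) * ?P)"
        using norm_exp_minus_1_le[of "- (h i * p s)"] h0[of i]
        by (simp add: norm_divide norm_mult field_simps)
      also have "\<dots> \<le> exp ?P * exp (B * ?P)"
      proof (intro mult_mono)
        show "?P \<le> exp ?P" using exp_ge_add_one_self[of ?P] by linarith
      qed (auto intro!: mult_right_mono B)
      finally have 1: "cmod ((exp (- (h i * p s)) - 1) / h i) \<le> exp ?P * exp (B * ?P)" .
      have 2: "cmod (exp (- (z * p s))) \<le> exp (cmod z * ?P)"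
        using norm_exp[of "- (z * p s)"] by (simp add: norm_mult)
      have "cmod (exp (- (z * p s))) * cmod ((exp (- (h i * p s)) - 1) / h i)
          \<le> exp (cmod z * ?P) * (exp ?P * exp (B * ?P))"
        using 1 2 by (intro mult_mono) auto
      also have "\<dots> = exp ((cmod z + B + 1) * ?P)"
        by (simp add: exp_add[symmetric] algebra_simps)
      finally have "cmod (k s) * (cmod (exp (- (z * p s))) * cmod ((exp (- (h i * p s)) - 1) / h i))
          \<le> cmod (k s) * exp ((cmod z + B + 1) * ?P)"
        by (rule mult_left_mono) simp
      then show "norm (?q i s) \<le> cmod (k s) * exp ((cmod z + B + 1) * ?P)"
        by (simp only: norm_mult mult.assoc)
    qed
  qed (use int in measurable)
  then show "((\<lambda>y. (?f y - ?f z) / (y - z)) \<circ> X) \<longlonglongrightarrow> (LBINT s. - p s * k s * exp (- (z * p s)))"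
    unfolding comp_def eq .
qed

text \<open>Applied twice: to a primitive of the Airy kernel, which allows contours to be shifted,
  and to the kernel itself, whose vanishing boundary values yield the Airy equation.\<close>

lemma integral_real_line_FTC:
  fixes g G :: "real \<Rightarrow> complex"
  assumes G: "\<And>s. (G has_vector_derivative g s) (at s)" and g: "continuous_on UNIV g"
    and int: "integrable lborel g"
  shows "(\<lambda>n::nat. G (real n) - G (- real n)) \<longlonglongrightarrow> (LBINT s. g s)"
proof -
  have [measurable]: "g \<in> borel_measurable borel" using int by auto
  have "(\<lambda>n::nat. LBINT s. indicat_real {- real n..real n} s *\<^sub>R g s) \<longlonglongrightarrow> (LBINT s. g s)"
  proof (rule integral_dominated_convergence[where w = "\<lambda>s. cmod (g s)"])
    show "AE s in lborel. (\<lambda>n::nat. indicat_real {- real n..real n} s *\<^sub>R g s) \<longlonglongrightarrow> g s"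
    proof (intro AE_I2 tendsto_eventually)
      fix s :: real
      obtain N :: nat where "\<bar>s\<bar> \<le> real N" using real_arch_simple by blast
      then show "\<forall>\<^sub>F n::nat in sequentially. indicat_real {- real n..real n} s *\<^sub>R g s = g s"
        unfolding eventually_sequentially by (intro exI[of _ N]) (auto simp: indicator_def)
    qed
  qed (use int in \<open>auto simp: indicator_def\<close>)
  moreover have "(LBINT s. indicat_real {- real n..real n} s *\<^sub>R g s) = G (real n) - G (- real n)" for n :: nat
    by (rule integral_FTC_Icc)
       (auto intro: has_vector_derivative_at_within[OF G] continuous_on_subset[OF g])
  ultimately show ?thesis by simp
qed

section \<open>The contour integral for the Airy function\<close>

text \<open>The contour Re p = a, parametrised by height. The factor \<i> in dp = \<i> ds is omitted
  in all integrals below, which only rescales the Airy function.\<close>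

definition vline :: "real \<Rightarrow> real \<Rightarrow> complex" where
  "vline a s = Complex a s"

definition airy_exp :: "complex \<Rightarrow> complex \<Rightarrow> complex" where
  "airy_exp z p = exp (p ^ 3 / 3 - z * p)"

text \<open>Re (p^3) = a^3 - 3 a s^2 on the line, so any a > 0 gives Gaussian decay in s, against
  which Im z contributes only linear growth of the exponent.\<close>

lemma norm_airy_exp_vline:
  "cmod (airy_exp z (vline a s)) = exp (a ^ 3 / 3 - a * s\<^sup>2 - a * Re z + Im z * s)"
  by (simp add: airy_exp_def vline_def power3_eq_cube power2_eq_square field_simps)

lemma vline_measurable [measurable]: "vline a \<in> borel_measurable borel"
proof -
  have "vline a = (\<lambda>s. of_real a + \<i> * of_real s)" by (auto simp: vline_def complex_eq_iff)
  then show ?thesis by simp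
qed

lemma vline_has_vector_derivative: "(vline a has_vector_derivative \<i>) (at s)"
proof -
  have "vline a = (\<lambda>s. of_real a + \<i> * of_real s)" by (auto simp: vline_def complex_eq_iff)
  then show ?thesis by (auto intro!: derivative_eq_intros)
qed

lemma continuous_on_vline [continuous_intros]: "continuous_on A (vline a)"
  by (meson continuous_at_imp_continuous_on has_vector_derivative_continuous vline_has_vector_derivative)

lemma norm_vline_le: "cmod (vline a s) \<le> \<bar>a\<bar> + \<bar>s\<bar>"
  unfolding vline_def using cmod_le[of "Complex a s"] by simp

lemma integrable_gaussian_exp_abs:
  assumes "a > 0"
  shows "integrable lborel (\<lambda>s. exp (c - a * s\<^sup>2 + R * \<bar>s\<bar>) :: real)"
proof -
  have "integrable lborel (\<lambda>s. exp (c + R\<^sup>2 / (2 * a)) * exp (- (sqrt a * s)\<^sup>2 / 2))"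
    using integrable_gaussian[of "sqrt a"] assms by simp
  then show ?thesis
  proof (rule Bochner_Integration.integrable_bound)
    show "AE s in lborel. norm (exp (c - a * s\<^sup>2 + R * \<bar>s\<bar>)) \<le> norm (exp (c + R\<^sup>2 / (2 * a)) * exp (- (sqrt a * s)\<^sup>2 / 2))"
    proof (rule AE_I2)
      fix s
      \<comment> \<open>Half of the quadratic term absorbs the linear one by completing the square;
        the other half remains as the integrable Gaussian.\<close>
      have "0 \<le> (a * \<bar>s\<bar> - R)\<^sup>2 / (2 * a)" using assms by simp
      also have "\<dots> = a * s\<^sup>2 / 2 - R * \<bar>s\<bar> + R\<^sup>2 / (2 * a)"
        using assms by (simp add: power2_eq_square field_simps abs_mult_self_eq)
      finally show "norm (exp (c - a * s\<^sup>2 + R * \<bar>s\<bar>)) \<le> norm (exp (c + R\<^sup>2 / (2 * a)) * exp (- (sqrt a * s)\<^sup>2 / 2))"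
        using assms by (simp add: exp_add[symmetric] power_mult_distrib)
    qed
  qed measurable
qed

lemma integrable_airy_exp:
  assumes "a > 0"
  shows "integrable lborel (\<lambda>s. airy_exp z (vline a s))"
proof (rule Bochner_Integration.integrable_bound)
  show "integrable lborel (\<lambda>s. exp ((a ^ 3 / 3 - a * Re z) - a * s\<^sup>2 + \<bar>Im z\<bar> * \<bar>s\<bar>) :: real)"
    by (rule integrable_gaussian_exp_abs[OF assms])
  show "(\<lambda>s. airy_exp z (vline a s)) \<in> borel_measurable lborel"
    unfolding airy_exp_def by measurable
  show "AE s in lborel. norm (airy_exp z (vline a s)) \<le> norm (exp ((a ^ 3 / 3 - a * Re z) - a * s\<^sup>2 + \<bar>Im z\<bar> * \<bar>s\<bar>))"
  proof (rule AE_I2)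
    fix s
    have "Im z * s \<le> \<bar>Im z\<bar> * \<bar>s\<bar>" using abs_ge_self[of "Im z * s"] by (simp add: abs_mult)
    then show "norm (airy_exp z (vline a s)) \<le> norm (exp ((a ^ 3 / 3 - a * Re z) - a * s\<^sup>2 + \<bar>Im z\<bar> * \<bar>s\<bar>))"
      by (simp add: norm_airy_exp_vline)
  qed
qed

lemma airy_exp_primitive:
  obtains Q where "\<And>p. (Q has_field_derivative airy_exp z p) (at p)"
proof -
  have "(\<lambda>p. airy_exp z p) holomorphic_on UNIV"
    unfolding airy_exp_def by (intro holomorphic_intros) auto
  then obtain Q where "\<And>p. p \<in> UNIV \<Longrightarrow> (Q has_field_derivative airy_exp z p) (at p within UNIV)"
    using holomorphic_convex_primitive'[of UNIV "\<lambda>p. airy_exp z p"] by auto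
  then show ?thesis using that by auto
qed

text \<open>Cauchy's theorem by means of a global primitive Q of the entire integrand: both
  integrals are limits of increments of Q / \<i>, and at height n or -n the values of Q on the two
  lines differ by at most the size of the kernel on a horizontal segment, which decays like a
  Gaussian in n.\<close>

lemma airy_line_shift:
  assumes "0 < a" "a \<le> a'"
  shows "(LBINT s. airy_exp z (vline a s)) = (LBINT s. airy_exp z (vline a' s))"
proof -
  obtain Q where Q: "\<And>p. (Q has_field_derivative airy_exp z p) (at p)"
    using airy_exp_primitive by blast
  have lim: "(\<lambda>n::nat. Q (vline a (real n)) / \<i> - Q (vline a (- real n)) / \<i>) \<longlonglongrightarrow> (LBINT s. airy_exp z (vline a s))"
    if "a > 0" for a
  proof (rule integral_real_line_FTC[where G = "\<lambda>s. Q (vline a s) / \<i>"])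
    fix s
    have "((Q \<circ> vline a) has_vector_derivative \<i> * airy_exp z (vline a s)) (at s)"
      by (rule field_vector_diff_chain_at[OF vline_has_vector_derivative Q])
    then have "((\<lambda>s. Q (vline a s) / \<i>) has_vector_derivative (\<i> * airy_exp z (vline a s)) / \<i>) (at s)"
      unfolding comp_def by (rule has_vector_derivative_divide)
    then show "((\<lambda>s. Q (vline a s) / \<i>) has_vector_derivative airy_exp z (vline a s)) (at s)"
      by simp
  next
    show "continuous_on UNIV (\<lambda>s. airy_exp z (vline a s))"
      unfolding airy_exp_def by (intro continuous_intros) auto
  qed (rule integrable_airy_exp[OF that])
  have diff: "cmod (Q (vline a s) - Q (vline a' s)) \<le> exp (a' ^ 3 / 3 + a' * \<bar>Re z\<bar> - a * s\<^sup>2 + \<bar>Im z\<bar> * \<bar>s\<bar>) * (a' - a)" for s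
  proof -
    have "cmod (Q (vline a s) - Q (vline a' s)) \<le> exp (a' ^ 3 / 3 + a' * \<bar>Re z\<bar> - a * s\<^sup>2 + \<bar>Im z\<bar> * \<bar>s\<bar>) * cmod (vline a s - vline a' s)"
    proof (rule field_differentiable_bound[where S = "closed_segment (vline a s) (vline a' s)" and f' = "airy_exp z"])
      fix p assume "p \<in> closed_segment (vline a s) (vline a' s)"
      then obtain u where u: "0 \<le> u" "u \<le> 1" "p = (1 - u) *\<^sub>R vline a s + u *\<^sub>R vline a' s"
        by (auto simp: in_segment)
      define t where "t = (1 - u) * a + u * a'"
      have p: "p = vline t s"
        using u(3) by (simp add: complex_eq_iff vline_def t_def algebra_simps)
      have "t = a + u * (a' - a)" "t = a' - (1 - u) * (a' - a)" by (simp_all add: t_def algebra_simps)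
      moreover have "0 \<le> u * (a' - a)" "0 \<le> (1 - u) * (a' - a)" using u assms by auto
      ultimately have t: "a \<le> t" "t \<le> a'" by linarith+
      have "t ^ 3 \<le> a' ^ 3" using t assms by (intro power_mono) auto
      moreover have "a * s\<^sup>2 \<le> t * s\<^sup>2" using t by (intro mult_right_mono) auto
      moreover have "- (t * Re z) \<le> a' * \<bar>Re z\<bar>"
      proof -
        have "- (t * Re z) \<le> t * \<bar>Re z\<bar>" using t assms abs_ge_minus_self[of "t * Re z"] by (simp add: abs_mult)
        also have "\<dots> \<le> a' * \<bar>Re z\<bar>" using t by (intro mult_right_mono) auto
        finally show ?thesis .
      qed
      moreover have "Im z * s \<le> \<bar>Im z\<bar> * \<bar>s\<bar>" using abs_ge_self[of "Im z * s"] by (simp add: abs_mult)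
      ultimately show "cmod (airy_exp z p) \<le> exp (a' ^ 3 / 3 + a' * \<bar>Re z\<bar> - a * s\<^sup>2 + \<bar>Im z\<bar> * \<bar>s\<bar>)"
        unfolding p norm_airy_exp_vline by simp
    qed (auto intro: has_field_derivative_at_within[OF Q])
    also have "cmod (vline a s - vline a' s) = a' - a"
      using assms by (simp add: vline_def cmod_def)
    finally show ?thesis .
  qed
  have e0: "(\<lambda>n::nat. exp (a' ^ 3 / 3 + a' * \<bar>Re z\<bar> - a * (real n)\<^sup>2 + \<bar>Im z\<bar> * \<bar>real n\<bar>) * (a' - a)) \<longlonglongrightarrow> 0"
    using assms(1) by real_asymp
  have z1: "(\<lambda>n::nat. Q (vline a (real n)) - Q (vline a' (real n))) \<longlonglongrightarrow> 0"
    by (rule Lim_null_comparison[OF always_eventually e0]) (rule allI, rule order_trans[OF diff], simp)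
  have z2: "(\<lambda>n::nat. Q (vline a (- real n)) - Q (vline a' (- real n))) \<longlonglongrightarrow> 0"
    by (rule Lim_null_comparison[OF always_eventually e0]) (rule allI, rule order_trans[OF diff], simp)
  have "(\<lambda>n::nat. (Q (vline a (real n)) - Q (vline a' (real n))) / \<i> - (Q (vline a (- real n)) - Q (vline a' (- real n))) / \<i>) \<longlonglongrightarrow> 0 / \<i> - 0 / \<i>"
    by (intro tendsto_intros z1 z2) auto
  moreover have "(\<lambda>n::nat. (Q (vline a (real n)) / \<i> - Q (vline a (- real n)) / \<i>) - (Q (vline a' (real n)) / \<i> - Q (vline a' (- real n)) / \<i>))
      \<longlonglongrightarrow> (LBINT s. airy_exp z (vline a s)) - (LBINT s. airy_exp z (vline a' s))"
    using assms by (intro tendsto_diff lim) auto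
  ultimately have "(LBINT s. airy_exp z (vline a s)) - (LBINT s. airy_exp z (vline a' s)) = 0"
    by (intro LIMSEQ_unique) (auto simp: diff_divide_distrib algebra_simps)
  then show ?thesis by simp
qed


lemma norm_airy_integral_le:
  assumes x: "1 \<le> Re z" and cone: "3 * (Im z)\<^sup>2 \<le> (Re z)\<^sup>2"
  shows "cmod (LBINT s. airy_exp z (vline (1/2) s)) \<le> 8 * sqrt (2 * pi) / (Re z) ^ 3"
proof -
  \<comment> \<open>This a minimises a^3/3 - a Re z, with value -(2/3) a^3. Completing the square in
    s costs (Im z)^2 / (2 a), at most a^3/6 in the sector, which leaves -a^3/2. Since Re z \<ge> 1
    gives a \<ge> 1, the remaining Gaussian is bounded by exp(-s^2/2) independently of z.\<close>
  define a where "a = sqrt (Re z)"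
  have a: "1 \<le> a" "a\<^sup>2 = Re z" using x by (auto simp: a_def)
  have g: "integrable lborel (\<lambda>s. exp (- s\<^sup>2 / 2) :: real)"
    using integrable_gaussian[of 1] by simp
  have gi: "(LBINT s. exp (- s\<^sup>2 / 2)) = sqrt (2 * pi)"
  proof -
    have "(LBINT s. sqrt (2 * pi) * std_normal_density s) = sqrt (2 * pi)"
      using integral_normal_density[of 1 0] by simp
    then show ?thesis by (simp add: std_normal_density_def)
  qed
  have pw: "cmod (airy_exp z (vline a s)) \<le> exp (- (a ^ 3 / 2)) * exp (- s\<^sup>2 / 2)" for s
  proof -
    have "0 \<le> (a * s - Im z)\<^sup>2 / (2 * a)" using a by simp
    also have "\<dots> = a * s\<^sup>2 / 2 - Im z * s + (Im z)\<^sup>2 / (2 * a)"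
      using a(1) by (simp add: power2_eq_square field_simps)
    also have "(Im z)\<^sup>2 / (2 * a) \<le> (a\<^sup>2)\<^sup>2 / 3 / (2 * a)"
      using cone a by (intro divide_right_mono) auto
    also have "(a\<^sup>2)\<^sup>2 / 3 / (2 * a) = a ^ 3 / 6"
      using a(1) by (simp add: power2_eq_square power3_eq_cube field_simps)
    finally have "Im z * s \<le> a * s\<^sup>2 / 2 + a ^ 3 / 6" by simp
    moreover have "a * Re z = a ^ 3" by (simp add: a(2)[symmetric] power2_eq_square power3_eq_cube)
    moreover have "s\<^sup>2 / 2 \<le> a * s\<^sup>2 / 2" using a(1) mult_right_mono[of 1 a "s\<^sup>2"] by simp
    ultimately have "a ^ 3 / 3 - a * s\<^sup>2 - a * Re z + Im z * s \<le> - (a ^ 3 / 2) + - (s\<^sup>2 / 2)" by simp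
    then show ?thesis unfolding norm_airy_exp_vline exp_add[symmetric] by simp
  qed
  have "cmod (LBINT s. airy_exp z (vline (1/2) s)) = cmod (LBINT s. airy_exp z (vline a s))"
    using airy_line_shift[of "1/2" a z] a(1) by simp
  also have "\<dots> \<le> (LBINT s. cmod (airy_exp z (vline a s)))" by (rule integral_norm_bound)
  also have "\<dots> \<le> (LBINT s. exp (- (a ^ 3 / 2)) * exp (- s\<^sup>2 / 2))"
    using integrable_airy_exp[of a z] a(1) g pw by (intro integral_mono) auto
  also have "\<dots> = exp (- (a ^ 3 / 2)) * sqrt (2 * pi)" by (simp only: integral_mult_right_zero gi)
  \<comment> \<open>Cubic decay is all that is needed later; it follows from exp x \<ge> x^2/2 at x
    = a^3/2, since a^6 = (Re z)^3.\<close>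
  also have "exp (- (a ^ 3 / 2)) \<le> 8 / (Re z) ^ 3"
  proof -
    have u: "0 < a ^ 3 / 2" using a(1) by simp
    have "(a ^ 3 / 2)\<^sup>2 / 2 \<le> exp (a ^ 3 / 2)"
      using exp_lower_Taylor_quadratic[OF less_imp_le[OF u]] u by linarith
    moreover have "(a ^ 3 / 2)\<^sup>2 / 2 = (Re z) ^ 3 / 8"
      by (simp add: a(2)[symmetric] power_divide power_mult[symmetric])
    ultimately have "(Re z) ^ 3 / 8 \<le> exp (a ^ 3 / 2)" by simp
    then have "inverse (exp (a ^ 3 / 2)) \<le> inverse ((Re z) ^ 3 / 8)"
      using x by (intro le_imp_inverse_le) auto
    then show ?thesis by (simp add: exp_minus)
  qed
  finally show ?thesis by (simp add: mult_right_mono)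
qed

text \<open>By \<open>airy_line_shift\<close> the choice of line is free. The abscissa 1/2 keeps 1/p
  bounded, which the primitive of the Airy function requires, and equals the saddle sqrt z for z =
  1/4.\<close>

abbreviation hline :: "real \<Rightarrow> complex" where
  "hline \<equiv> vline (1/2)"

text \<open>Differentiation in z multiplies the weight k by -p. Thus k = 1 is the Airy function, k =
  -p its derivative and k = -1/p a primitive of it, all treated by one lemma.\<close>

definition airy_weight :: "(complex \<Rightarrow> complex) \<Rightarrow> complex \<Rightarrow> complex" where
  "airy_weight k z = (LBINT s. k (hline s) * airy_exp z (hline s))"

text \<open>A growth class that the Gaussian decay of the kernel always beats, and that is stable
  under k \<mapsto> -p k.\<close>

definition subexponential :: "(complex \<Rightarrow> complex) \<Rightarrow> bool" where
  "subexponential k \<longleftrightarrow> (\<lambda>s. k (hline s)) \<in> borel_measurable borel \<and>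
     (\<exists>c. \<forall>s. cmod (k (hline s)) \<le> exp (c + c * cmod (hline s)))"

lemma subexponential_times:
  assumes "subexponential k"
  shows "subexponential (\<lambda>p. - p * k p)"
proof -
  obtain c where c: "\<And>s. cmod (k (hline s)) \<le> exp (c + c * cmod (hline s))"
    using assms by (auto simp: subexponential_def)
  have [measurable]: "(\<lambda>s. k (hline s)) \<in> borel_measurable borel"
    using assms by (simp add: subexponential_def)
  have "cmod (- hline s * k (hline s)) \<le> exp ((\<bar>c\<bar> + 1) + (\<bar>c\<bar> + 1) * cmod (hline s))" for s
  proof -
    let ?P = "cmod (hline s)"
    have "?P * cmod (k (hline s)) \<le> exp ?P * exp (c + c * ?P)"
    proof (intro mult_mono c)
      show "?P \<le> exp ?P" using exp_ge_add_one_self[of ?P] by linarith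
    qed auto
    also have "\<dots> \<le> exp ((\<bar>c\<bar> + 1) + (\<bar>c\<bar> + 1) * ?P)"
      using mult_right_mono[OF abs_ge_self[of c], of ?P] by (simp add: exp_add[symmetric] algebra_simps)
    finally show ?thesis by (simp add: norm_mult)
  qed
  then show ?thesis unfolding subexponential_def by (intro conjI exI[of _ "\<bar>c\<bar> + 1"]) (auto, measurable)
qed

lemma airy_weight_integrable:
  assumes "subexponential k"
  shows "integrable lborel (\<lambda>s. cmod (k (hline s) * exp (hline s ^ 3 / 3)) * exp (R * cmod (hline s)))"
proof -
  obtain c where c: "\<And>s. cmod (k (hline s)) \<le> exp (c + c * cmod (hline s))"
    using assms by (auto simp: subexponential_def)
  have [measurable]: "(\<lambda>s. k (hline s)) \<in> borel_measurable borel"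
    using assms by (simp add: subexponential_def)
  let ?A = "\<bar>c\<bar> + \<bar>R\<bar>"
  have "integrable lborel (\<lambda>s. exp ((c + ?A / 2 + (1/2) ^ 3 / 3) - 1/2 * s\<^sup>2 + ?A * \<bar>s\<bar>) :: real)"
    by (rule integrable_gaussian_exp_abs) simp
  then show ?thesis
  proof (rule Bochner_Integration.integrable_bound)
    show "AE s in lborel. norm (cmod (k (hline s) * exp (hline s ^ 3 / 3)) * exp (R * cmod (hline s)))
        \<le> norm (exp ((c + ?A / 2 + (1/2) ^ 3 / 3) - 1/2 * s\<^sup>2 + ?A * \<bar>s\<bar>))"
    proof (rule AE_I2)
      fix s
      let ?P = "cmod (hline s)"
      have e: "cmod (exp (hline s ^ 3 / 3)) = exp ((1/2) ^ 3 / 3 - 1/2 * s\<^sup>2)"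
        using norm_airy_exp_vline[of 0 "1/2" s] by (simp add: airy_exp_def)
      have "c * ?P + R * ?P \<le> ?A * ?P"
        using mult_right_mono[of "c + R" ?A ?P] by (simp add: algebra_simps)
      also have "\<dots> \<le> ?A * (1/2 + \<bar>s\<bar>)"
        using norm_vline_le[of "1/2" s] by (intro mult_left_mono) auto
      finally have le: "c * ?P + R * ?P \<le> ?A / 2 + ?A * \<bar>s\<bar>" by (simp add: algebra_simps)
      have "cmod (k (hline s)) * cmod (exp (hline s ^ 3 / 3)) * exp (R * ?P)
          \<le> exp (c + c * ?P) * exp ((1/2) ^ 3 / 3 - 1/2 * s\<^sup>2) * exp (R * ?P)"
        unfolding e by (intro mult_right_mono c) auto
      also have "\<dots> \<le> exp ((c + ?A / 2 + (1/2) ^ 3 / 3) - 1/2 * s\<^sup>2 + ?A * \<bar>s\<bar>)"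
        using le by (simp add: exp_add[symmetric])
      finally show "norm (cmod (k (hline s) * exp (hline s ^ 3 / 3)) * exp (R * ?P))
        \<le> norm (exp ((c + ?A / 2 + (1/2) ^ 3 / 3) - 1/2 * s\<^sup>2 + ?A * \<bar>s\<bar>))"
        by (simp add: norm_mult)
    qed
  qed measurable
qed

lemma has_field_derivative_airy_weight:
  assumes "subexponential k"
  shows "(airy_weight k has_field_derivative airy_weight (\<lambda>p. - p * k p) z) (at z)"
proof -
  have [measurable]: "(\<lambda>s. k (hline s)) \<in> borel_measurable borel"
    using assms by (simp add: subexponential_def)
  have "((\<lambda>z. LBINT s. (k (hline s) * exp (hline s ^ 3 / 3)) * exp (- (z * hline s))) has_field_derivative
    (LBINT s. - hline s * (k (hline s) * exp (hline s ^ 3 / 3)) * exp (- (z * hline s)))) (at z)"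
    by (rule has_field_derivative_laplace[OF _ _ airy_weight_integrable[OF assms]]) measurable
  moreover have e: "airy_exp z p = exp (p ^ 3 / 3) * exp (- (z * p))" for z p
    unfolding airy_exp_def exp_add[symmetric] by simp
  ultimately show ?thesis
    by (simp add: airy_weight_def[abs_def] e mult.assoc)
qed

lemma integrable_airy_weight:
  assumes "subexponential k"
  shows "integrable lborel (\<lambda>s. k (hline s) * airy_exp z (hline s))"
proof -
  have [measurable]: "(\<lambda>s. k (hline s)) \<in> borel_measurable borel"
    using assms by (simp add: subexponential_def)
  have e: "airy_exp z p = exp (p ^ 3 / 3) * exp (- (z * p))" for z p
    unfolding airy_exp_def exp_add[symmetric] by simp
  have "integrable lborel (\<lambda>s. (k (hline s) * exp (hline s ^ 3 / 3)) * exp (- (z * hline s)))"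
    by (rule integrable_laplace[OF _ _ airy_weight_integrable[OF assms]]) measurable
  then show ?thesis by (simp add: e mult.assoc)
qed

lemma cnj_airy_weight:
  assumes "\<And>p. k (cnj p) = cnj (k p)"
  shows "cnj (airy_weight k z) = airy_weight k (cnj z)"
proof -
  have v: "hline (- s) = cnj (hline s)" for s by (simp add: vline_def complex_eq_iff)
  have "cnj (airy_weight k z) = (LBINT s. k (hline (- s)) * airy_exp (cnj z) (hline (- s)))"
    unfolding airy_weight_def v
    by (simp add: assms airy_exp_def exp_cnj flip: Bochner_Integration.integral_cnj)
  also have "\<dots> = airy_weight k (cnj z)"
    using lborel_integral_real_affine[of "-1" "\<lambda>s. k (hline s) * airy_exp (cnj z) (hline s)" 0]
    by (simp add: airy_weight_def)
  finally show ?thesis .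
qed

lemma subexponential_1: "subexponential (\<lambda>p. 1)"
  unfolding subexponential_def by (auto intro!: exI[of _ 0])

lemma subexponential_inverse: "subexponential (\<lambda>p. - inverse p)"
  unfolding subexponential_def
proof (intro conjI exI[of _ 1] allI)
  show "(\<lambda>s. - inverse (hline s)) \<in> borel_measurable borel" by measurable
  fix s
  have n: "1/2 \<le> cmod (hline s)" using complex_Re_le_cmod[of "hline s"] by (simp add: vline_def)
  then have "inverse (cmod (hline s)) \<le> inverse (1/2)" by (intro le_imp_inverse_le) auto
  also have "\<dots> \<le> 1 + (1 + 1 * cmod (hline s))" by simp
  also have "\<dots> \<le> exp (1 + 1 * cmod (hline s))" by (rule exp_ge_add_one_self)
  finally show "cmod (- inverse (hline s)) \<le> exp (1 + 1 * cmod (hline s))"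
    by (simp add: norm_inverse)
qed

text \<open>(p^2 - z) times the kernel is the p-derivative of the kernel, which vanishes at both
  ends of the line, so its integral is 0.\<close>

lemma airy_weight_ode: "airy_weight (\<lambda>p. p\<^sup>2) z = z * airy_weight (\<lambda>p. 1) z"
proof -
  let ?v = "hline"
  have s2: "subexponential (\<lambda>p. p\<^sup>2)"
    using subexponential_times[OF subexponential_times[OF subexponential_1]] by (simp add: power2_eq_square)
  have int: "integrable lborel (\<lambda>s. \<i> * (?v s)\<^sup>2 * airy_exp z (?v s) - \<i> * z * airy_exp z (?v s))"
    using integrable_airy_weight[OF s2, of z] integrable_airy_weight[OF subexponential_1, of z]
    by (auto simp: mult.assoc)
  have lim: "(\<lambda>n::nat. airy_exp z (?v (real n)) - airy_exp z (?v (- real n)))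
      \<longlonglongrightarrow> (LBINT s. \<i> * (?v s)\<^sup>2 * airy_exp z (?v s) - \<i> * z * airy_exp z (?v s))"
  proof (rule integral_real_line_FTC[OF _ _ int])
    fix s
    have "(airy_exp z has_field_derivative ((?v s)\<^sup>2 - z) * airy_exp z (?v s)) (at (?v s))"
      unfolding airy_exp_def by (auto intro!: derivative_eq_intros simp: field_simps)
    from field_vector_diff_chain_at[OF vline_has_vector_derivative this]
    show "((\<lambda>s. airy_exp z (?v s)) has_vector_derivative (\<i> * (?v s)\<^sup>2 * airy_exp z (?v s) - \<i> * z * airy_exp z (?v s))) (at s)"
      by (simp add: comp_def algebra_simps)
  next
    show "continuous_on UNIV (\<lambda>s. \<i> * (?v s)\<^sup>2 * airy_exp z (?v s) - \<i> * z * airy_exp z (?v s))"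
      unfolding airy_exp_def by (intro continuous_intros) auto
  qed
  have z1: "(\<lambda>n::nat. airy_exp z (?v (real n))) \<longlonglongrightarrow> 0"
    by (rule tendsto_norm_zero_cancel, unfold norm_airy_exp_vline) real_asymp
  have z2: "(\<lambda>n::nat. airy_exp z (?v (- real n))) \<longlonglongrightarrow> 0"
    by (rule tendsto_norm_zero_cancel, unfold norm_airy_exp_vline) real_asymp
  have "(LBINT s. \<i> * (?v s)\<^sup>2 * airy_exp z (?v s) - \<i> * z * airy_exp z (?v s)) = 0"
    using LIMSEQ_unique[OF lim tendsto_diff[OF z1 z2]] by simp
  moreover have "(LBINT s. \<i> * (?v s)\<^sup>2 * airy_exp z (?v s) - \<i> * z * airy_exp z (?v s))
      = \<i> * airy_weight (\<lambda>p. p\<^sup>2) z - \<i> * z * airy_weight (\<lambda>p. 1) z"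
    using integrable_airy_weight[OF s2, of z] integrable_airy_weight[OF subexponential_1, of z]
    by (simp add: airy_weight_def mult.assoc)
  ultimately show ?thesis by (simp add: mult.assoc)
qed

text \<open>z = 1/4 has its saddle point sqrt z on the line Re p = 1/2, so the exponent has no linear term
  and the integrand is exp (- s^2/2) times a phase.\<close>

lemma airy_weight_1_nonzero: "airy_weight (\<lambda>p. 1) (1/4) \<noteq> 0"
proof -
  \<comment> \<open>A minorant of the real part: cos x \<ge> 1 - x^2/2 at x = s^3/3 produces s^6/18.
    The sixth moment of the normal law is 15 < 18, so the integral of the minorant is positive. The
    factor exp(1/24 - 1/8) is exp(a^3/3 - a Re z) for a = 1/2, z = 1/4.\<close>
  let ?E = "\<lambda>s. exp (1/24 - 1/8) * (sqrt (2 * pi) * (std_normal_density s - std_normal_density s * s ^ (2 * 3) / 18))"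
  have Re: "Re (airy_exp (1/4) (hline s)) = exp (1/24 - 1/8 - s\<^sup>2 / 2) * cos (s ^ 3 / 3)" for s
    unfolding airy_exp_def vline_def
    by (simp add: Re_exp power3_eq_cube power2_eq_square) (simp add: field_simps)
  have cos: "1 - x\<^sup>2 / 2 \<le> cos x" for x :: real
  proof -
    have "cos x = 1 - 2 * (sin (x / 2))\<^sup>2" using cos_double_sin[of "x / 2"] by simp
    moreover have "(sin (x / 2))\<^sup>2 \<le> (x / 2)\<^sup>2"
      by (rule abs_le_square_iff[THEN iffD1, OF abs_sin_x_le_abs_x])
    ultimately show ?thesis by (simp add: power_divide)
  qed
  have le: "?E s \<le> Re (airy_exp (1/4) (hline s))" for s
  proof -
    have "?E s = exp (1/24 - 1/8) * (sqrt (2 * pi) * std_normal_density s) * (1 - (s ^ 3 / 3)\<^sup>2 / 2)"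
      by (simp add: power_divide power_mult[symmetric] algebra_simps)
    also have "sqrt (2 * pi) * std_normal_density s = exp (- (s\<^sup>2 / 2))"
      by (simp add: std_normal_density_def)
    also have "exp (1/24 - 1/8) * exp (- (s\<^sup>2 / 2)) = exp (1/24 - 1/8 - s\<^sup>2 / 2)"
      unfolding exp_add[symmetric] by simp
    also have "exp (1/24 - 1/8 - s\<^sup>2 / 2) * (1 - (s ^ 3 / 3)\<^sup>2 / 2) \<le> exp (1/24 - 1/8 - s\<^sup>2 / 2) * cos (s ^ 3 / 3)"
      by (intro mult_left_mono cos) auto
    finally show ?thesis by (simp only: Re)
  qed
  have m: "has_bochner_integral lborel (\<lambda>s. std_normal_density s - std_normal_density s * s ^ (2 * 3) / 18) (1 - 15 / 18)"
  proof (intro has_bochner_integral_diff)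
    show "has_bochner_integral lborel std_normal_density 1"
      using integral_normal_density[of 1 0] integrable_normal_density[of 1 0] by (simp add: has_bochner_integral_iff)
    have "has_bochner_integral lborel (\<lambda>s. std_normal_density s * s ^ (2 * 3) / 18) ((fact (2 * 3) / (2 ^ 3 * fact 3)) / 18)"
      by (intro has_bochner_integral_divide_zero std_normal_moment_even)
    then show "has_bochner_integral lborel (\<lambda>s. std_normal_density s * s ^ (2 * 3) / 18) (15 / 18)"
      by (simp add: fact_numeral)
  qed
  have int: "integrable lborel (\<lambda>s. airy_exp (1/4) (hline s))"
    by (rule integrable_airy_exp) simp
  have "0 < exp (1/24 - 1/8) * (sqrt (2 * pi) * (1 - 15 / 18))" by simp
  also have "\<dots> = (LBINT s. ?E s)"
    using m by (simp only: integral_mult_right_zero has_bochner_integral_iff)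
  also have "\<dots> \<le> (LBINT s. Re (airy_exp (1/4) (hline s)))"
    using m int le by (intro integral_mono integrable_mult_right) (auto simp: has_bochner_integral_iff)
  also have "\<dots> = Re (airy_weight (\<lambda>p. 1) (1/4))"
    using int by (simp add: airy_weight_def)
  finally show ?thesis by auto
qed


section \<open>Decay in the sector, uniqueness and the normalised profile\<close>

text \<open>Polynomial form of |arg z| \<le> pi/6. For real xi the rays of (\<i> xi)^(1/3) y, y
  \<ge> 0, are exactly the two edges of the sector; the positive axis in between is where the limit
  of G is found.\<close>

definition airy_sector :: "complex set" where
  "airy_sector = {z. 0 \<le> Re z \<and> 3 * (Im z)\<^sup>2 \<le> (Re z)\<^sup>2}"

lemma airy_sector_norm_le:
  assumes "z \<in> airy_sector"
  shows "cmod z \<le> 2 * Re z"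
proof -
  have "0 \<le> Re z" "3 * (Im z)\<^sup>2 \<le> (Re z)\<^sup>2" "0 \<le> (Im z)\<^sup>2" "(2 * Re z)\<^sup>2 = 4 * (Re z)\<^sup>2"
    using assms by (auto simp: airy_sector_def power_mult_distrib)
  then have "(Re z)\<^sup>2 + (Im z)\<^sup>2 \<le> (2 * Re z)\<^sup>2" by linarith
  with \<open>0 \<le> Re z\<close> show ?thesis unfolding cmod_def by (intro real_le_lsqrt) auto
qed

lemma airy_sector_of_real [simp]: "of_real x \<in> airy_sector \<longleftrightarrow> 0 \<le> x"
  by (auto simp: airy_sector_def)

lemma airy_sector_bound:
  obtains K where "K > 0" "\<And>z. z \<in> airy_sector \<Longrightarrow> cmod (airy_weight (\<lambda>p. 1) z) \<le> K / (1 + cmod z) ^ 3"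
proof -
  let ?f = "airy_weight (\<lambda>p. 1)"
  have "continuous_on UNIV ?f"
    by (intro continuous_at_imp_continuous_on ballI DERIV_isCont[OF has_field_derivative_airy_weight[OF subexponential_1]])
  then have "compact (?f ` cball 0 2)"
    by (intro compact_continuous_image) (auto intro: continuous_on_subset)
  then obtain B where "\<forall>w\<in>?f ` cball 0 2. cmod w \<le> B"
    using compact_imp_bounded bounded_iff by blast
  then have B: "\<And>z. cmod z \<le> 2 \<Longrightarrow> cmod (?f z) \<le> B" by simp
  have B0: "0 \<le> B" using B[of 0] by (auto intro: order_trans[OF norm_ge_zero])
  \<comment> \<open>27 = 3^3: for Re z \<ge> 1 in the sector 1 + |z| \<le> 3 Re z, and for Re z < 1
    the point lies in the disc of radius 2, where 1 + |z| \<le> 3 and compactness gives the bound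
    B.\<close>
  define K where "K = 27 * (8 * sqrt (2 * pi)) + 27 * B"
  show ?thesis
  proof (rule that)
    show "K > 0" using B0 by (simp add: K_def add_pos_nonneg)
    fix z assume z: "z \<in> airy_sector"
    then have x: "0 \<le> Re z" and c: "3 * (Im z)\<^sup>2 \<le> (Re z)\<^sup>2" by (auto simp: airy_sector_def)
    have n: "cmod z \<le> 2 * Re z" by (rule airy_sector_norm_le[OF z])
    show "cmod (?f z) \<le> K / (1 + cmod z) ^ 3"
    proof (cases "1 \<le> Re z")
      case True
      have "cmod (?f z) \<le> 8 * sqrt (2 * pi) / (Re z) ^ 3"
        using norm_airy_integral_le[OF True c] by (simp add: airy_weight_def)
      also have "\<dots> = 27 * (8 * sqrt (2 * pi)) / (3 * Re z) ^ 3"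
        using True by (simp add: power_mult_distrib)
      also have "\<dots> \<le> K / (1 + cmod z) ^ 3"
        using n True B0 by (intro frac_le power_mono) (auto simp: K_def intro: add_pos_nonneg)
      finally show ?thesis .
    next
      case False
      then have n2: "cmod z \<le> 2" using n by simp
      have "cmod (?f z) * (1 + cmod z) ^ 3 \<le> B * 3 ^ 3"
        using B[OF n2] n2 by (intro mult_mono power_mono) (auto intro: order_trans[OF norm_ge_zero])
      also have "\<dots> \<le> K" by (simp add: K_def)
      finally show ?thesis by (simp add: pos_le_divide_eq add_pos_nonneg)
    qed
  qed
qed

text \<open>Applied with \<open>\<phi> = |h|\<^sup>2\<close> and \<open>2 \<psi> = \<phi>'\<close> for a decaying solution h of the Airy equation.\<close>

lemma convex_decay:
  fixes \<phi> \<psi> \<delta> :: "real \<Rightarrow> real"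
  assumes \<phi>: "\<And>x. (\<phi> has_real_derivative 2 * \<psi> x) (at x)"
    and \<psi>: "\<And>x. (\<psi> has_real_derivative \<delta> x) (at x)"
    and \<delta>: "\<And>x. 0 \<le> x \<Longrightarrow> 0 \<le> \<delta> x" and lim: "(\<phi> \<longlongrightarrow> 0) at_top"
  shows "\<And>x y. 0 \<le> x \<Longrightarrow> x \<le> y \<Longrightarrow> \<psi> x \<le> \<psi> y"
    and "\<And>x. 0 \<le> x \<Longrightarrow> \<psi> x \<le> 0"
    and "\<And>x y. 0 \<le> x \<Longrightarrow> x \<le> y \<Longrightarrow> \<phi> y \<le> \<phi> x"
proof -
  show mono: "\<psi> x \<le> \<psi> y" if "0 \<le> x" "x \<le> y" for x y
    by (rule DERIV_nonneg_imp_nondecreasing[OF that(2)]) (use \<psi> \<delta> that in \<open>meson order_trans\<close>)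
  show neg: "\<psi> x \<le> 0" if x: "0 \<le> x" for x
  proof (rule ccontr)
    assume "\<not> \<psi> x \<le> 0"
    then have p: "\<psi> x > 0" by simp
    \<comment> \<open>Convexity keeps \<open>\<phi>\<close> above its tangent at x, whose slope is
      positive here; this linear growth contradicts the limit 0.\<close>
    have grow: "\<phi> x + 2 * \<psi> x * (y - x) \<le> \<phi> y" if "x \<le> y" for y
    proof -
      have "\<phi> x - 2 * \<psi> x * x \<le> \<phi> y - 2 * \<psi> x * y"
      proof (rule DERIV_nonneg_imp_nondecreasing[OF that])
        fix t assume "x \<le> t" "t \<le> y"
        then have "0 \<le> 2 * \<psi> t - 2 * \<psi> x" using mono[of x t] x by simp
        moreover have "((\<lambda>t. \<phi> t - 2 * \<psi> x * t) has_real_derivative 2 * \<psi> t - 2 * \<psi> x) (at t)"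
          by (auto intro!: derivative_eq_intros \<phi>)
        ultimately show "\<exists>d. ((\<lambda>t. \<phi> t - 2 * \<psi> x * t) has_real_derivative d) (at t) \<and> 0 \<le> d" by blast
      qed
      then show ?thesis by (simp add: algebra_simps)
    qed
    have "\<forall>\<^sub>F y in at_top. \<phi> y < 1" using lim by (rule order_tendstoD) simp
    moreover have "\<forall>\<^sub>F y in at_top. y \<ge> max x (x + (1 + \<bar>\<phi> x\<bar>) / (2 * \<psi> x))" by (rule eventually_ge_at_top)
    ultimately have "\<forall>\<^sub>F y in at_top. \<phi> y < 1 \<and> max x (x + (1 + \<bar>\<phi> x\<bar>) / (2 * \<psi> x)) \<le> y"
      by (rule eventually_conj)
    then obtain y where y: "\<phi> y < 1" "max x (x + (1 + \<bar>\<phi> x\<bar>) / (2 * \<psi> x)) \<le> y"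
      by (auto dest!: eventually_happens)
    then have "(1 + \<bar>\<phi> x\<bar>) / (2 * \<psi> x) \<le> y - x" by simp
    then have "1 + \<bar>\<phi> x\<bar> \<le> 2 * \<psi> x * (y - x)" using p by (simp add: divide_le_eq mult.commute)
    then show False using grow[of y] y by (simp add: max_def split: if_splits)
  qed
  show "\<phi> y \<le> \<phi> x" if "0 \<le> x" "x \<le> y" for x y
    by (rule DERIV_nonpos_imp_nonincreasing[OF that(2)])
       (use \<phi> neg that in \<open>meson order_trans mult_nonneg_nonpos zero_le_numeral\<close>)
qed

text \<open>With \<open>h1 0 = 0\<close> the function \<open>\<psi>\<close> starts at 0, is
  nondecreasing and is never positive, so it vanishes on the half line. Then |h|^2 is constant there
  with limit 0, and analytic continuation finishes. Read backwards, a nonzero decaying solution has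
  nonzero derivative at 0, which permits dividing by it.\<close>

lemma airy_solution_unique:
  fixes h h1 :: "complex \<Rightarrow> complex"
  assumes h: "\<And>z. (h has_field_derivative h1 z) (at z)"
    and h1: "\<And>z. (h1 has_field_derivative z * h z) (at z)"
    and lim: "((\<lambda>x::real. h (of_real x)) \<longlongrightarrow> 0) at_top" and zero: "h1 0 = 0"
  shows "h z = 0"
proof -
  have vh: "((\<lambda>x. h (of_real x)) has_vector_derivative h1 (of_real x)) (at x)" for x :: real
    using field_vector_diff_chain_at[of of_real 1 x h, OF _ h] has_vector_derivative_of_real[OF DERIV_ident]
    by (auto simp: comp_def)
  have vh1: "((\<lambda>x. h1 (of_real x)) has_vector_derivative of_real x * h (of_real x)) (at x)" for x :: real
    using field_vector_diff_chain_at[of of_real 1 x h1, OF _ h1] has_vector_derivative_of_real[OF DERIV_ident]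
    by (auto simp: comp_def)
  define \<phi> where "\<phi> x = Re (cnj (h (of_real x)) * h (of_real x))" for x
  define \<psi> where "\<psi> x = Re (cnj (h (of_real x)) * h1 (of_real x))" for x
  have \<phi>_eq: "\<phi> x = (cmod (h (of_real x)))\<^sup>2" for x
    unfolding \<phi>_def cmod_power2 by (simp add: power2_eq_square)
  have d\<phi>: "(\<phi> has_real_derivative 2 * \<psi> x) (at x)" for x
    unfolding \<phi>_def using has_field_derivative_Re[OF has_vector_derivative_mult[OF has_vector_derivative_cnj[OF vh[of x]] vh[of x]]]
    by (rule DERIV_cong) (simp add: \<psi>_def)
  have d\<psi>: "(\<psi> has_real_derivative ((cmod (h1 (of_real x)))\<^sup>2 + x * (cmod (h (of_real x)))\<^sup>2)) (at x)" for x
    unfolding \<psi>_def using has_field_derivative_Re[OF has_vector_derivative_mult[OF has_vector_derivative_cnj[OF vh[of x]] vh1[of x]]]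
    by (rule DERIV_cong) (unfold cmod_power2, simp add: power2_eq_square algebra_simps)
  have lim\<phi>: "(\<phi> \<longlongrightarrow> 0) at_top"
    using tendsto_power[OF tendsto_norm_zero[OF lim], of 2] unfolding \<phi>_eq by simp
  note cd = convex_decay[OF d\<phi> d\<psi> _ lim\<phi>]
  have \<psi>0: "\<psi> x = 0" if "0 \<le> x" for x
  proof -
    have "\<psi> 0 \<le> \<psi> x" using that by (intro cd(1)) auto
    moreover have "\<psi> x \<le> 0" using that by (intro cd(2)) auto
    ultimately show ?thesis by (simp add: \<psi>_def zero)
  qed
  have const: "\<phi> x \<le> \<phi> y" if "0 \<le> x" "x \<le> y" for x y
    by (rule DERIV_nonneg_imp_nondecreasing[OF that(2)]) (use d\<phi> \<psi>0 that in force)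
  have h0: "h (of_real x) = 0" if "0 \<le> x" for x :: real
  proof -
    have "\<phi> x \<le> 0"
    proof (rule tendsto_lowerbound[OF lim\<phi>])
      show "\<forall>\<^sub>F y in at_top. \<phi> x \<le> \<phi> y"
        using eventually_ge_at_top[of x] by eventually_elim (use const that in auto)
    qed simp
    then show ?thesis by (simp add: \<phi>_eq)
  qed
  show ?thesis
  proof (rule analytic_continuation[of h UNIV "of_real ` {0..}" 0])
    show "h holomorphic_on UNIV" using h by (auto simp: holomorphic_on_open)
    show "(0::complex) islimpt of_real ` {0..}"
      unfolding islimpt_approachable
    proof (intro allI impI)
      fix e :: real assume "e > 0"
      then show "\<exists>x'\<in>of_real ` {0..}. x' \<noteq> (0::complex) \<and> dist x' 0 < e"
        by (intro bexI[where x = "of_real (e / 2)"] imageI conjI) (auto simp: dist_norm norm_divide)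
    qed
  qed (use h0 in auto)
qed

text \<open>Everything the linear problem needs to know about the Airy function: \<open>r\<close> is
  Ai/Ai'(0), \<open>r1\<close> its derivative and \<open>G\<close> its primitive from 0. The contour
  integral does not appear beyond this interface.\<close>

locale airy_profile =
  fixes r r1 G :: "complex \<Rightarrow> complex" and K L :: real
  assumes Ai_quotient: "\<And>z. Ai z / deriv Ai 0 = r z"
    and r_deriv: "\<And>z. (r has_field_derivative r1 z) (at z)"
    and r1_deriv: "\<And>z. (r1 has_field_derivative z * r z) (at z)"
    and r1_0: "r1 0 = 1"
    and G_deriv: "\<And>z. (G has_field_derivative r z) (at z)" and G_0: "G 0 = 0"
    and r_cnj: "\<And>z. r (cnj z) = cnj (r z)" and G_cnj: "\<And>z. G (cnj z) = cnj (G z)"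
    and K: "K > 0" and L: "L < 0"
    and r_bound: "\<And>z. z \<in> airy_sector \<Longrightarrow> cmod (r z) \<le> K / (1 + cmod z) ^ 3"
    and r1_bound: "\<And>z. z \<in> airy_sector \<Longrightarrow> cmod (r1 z) \<le> K / (1 + cmod z)\<^sup>2"
    and G_bound: "\<And>z. z \<in> airy_sector \<Longrightarrow> cmod (G z) \<le> K"
    and G_limit: "\<And>e. e > 0 \<Longrightarrow> \<exists>S>0. \<forall>z\<in>airy_sector. S \<le> cmod z \<longrightarrow> cmod (G z - of_real L) < e"

text \<open>All analysis is done on the contour integral divided by its derivative at 0; uniqueness
  then identifies this quotient with that of the chosen \<open>Ai\<close>.\<close>

theorem airy_profile_exists:
  obtains r r1 G K L where "airy_profile r r1 G K L"
proof -
  let ?f = "airy_weight (\<lambda>p. 1)" and ?f1 = "airy_weight (\<lambda>p. - p)"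
  obtain K0 where K0: "K0 > 0" "\<And>z. z \<in> airy_sector \<Longrightarrow> cmod (?f z) \<le> K0 / (1 + cmod z) ^ 3"
    using airy_sector_bound by blast
  have s1: "subexponential (\<lambda>p. - p)" using subexponential_times[OF subexponential_1] by simp
  have df: "(?f has_field_derivative ?f1 z) (at z)" for z
    using has_field_derivative_airy_weight[OF subexponential_1] by simp
  have df1: "(?f1 has_field_derivative z * ?f z) (at z)" for z
    using has_field_derivative_airy_weight[OF s1, of z] by (simp add: airy_weight_ode[symmetric] power2_eq_square)
  have tend0: "((\<lambda>x::real. g (of_real x)) \<longlongrightarrow> 0) at_top"
    if g: "\<And>z. z \<in> airy_sector \<Longrightarrow> cmod (g z) \<le> C / (1 + cmod z) ^ 3" for g :: "complex \<Rightarrow> complex" and C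
  proof (rule Lim_null_comparison)
    show "\<forall>\<^sub>F x::real in at_top. cmod (g (of_real x)) \<le> C / (1 + \<bar>x\<bar>) ^ 3"
      using eventually_ge_at_top[of 0]
    proof eventually_elim
      case (elim x)
      then show ?case using g[of "of_real x"] by simp
    qed
    show "((\<lambda>x::real. C / (1 + \<bar>x\<bar>) ^ 3) \<longlongrightarrow> 0) at_top" by real_asymp
  qed
  \<comment> \<open>Were the derivative at 0 zero, uniqueness would make the contour integral vanish
    everywhere, contrary to its value at 1/4.\<close>
  have f10: "?f1 0 \<noteq> 0"
    using airy_solution_unique[OF df df1 tend0[OF K0(2)], of "1/4"] airy_weight_1_nonzero by blast
  define c where "c = ?f1 0"
  have c: "c \<noteq> 0" using f10 by (simp add: c_def)
  have cc: "cnj c = c"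
    unfolding c_def by (subst cnj_airy_weight) auto
  define r where "r z = ?f z / c" for z
  define r1 where "r1 z = ?f1 z / c" for z
  let ?W = "airy_weight (\<lambda>p. - inverse p)"
  \<comment> \<open>The weight -1/p turns into 1 under differentiation, so \<open>?W\<close> is a
    primitive of the contour integral; subtracting \<open>?W 0\<close> normalises it to vanish at
    0.\<close>
  define G where "G z = (?W z - ?W 0) / c" for z
  have dr: "(r has_field_derivative r1 z) (at z)" for z
    unfolding r_def r1_def by (intro DERIV_cdivide df)
  have dr1: "(r1 has_field_derivative z * r z) (at z)" for z
    unfolding r_def r1_def using DERIV_cdivide[OF df1[of z], of c] by simp
  have dG: "(G has_field_derivative r z) (at z)" for z
  proof -
    have "airy_weight (\<lambda>p. - p * - inverse p) z = ?f z"
      unfolding airy_weight_def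
    proof (rule Bochner_Integration.integral_cong[OF refl])
      fix s
      have "hline s \<noteq> 0" by (simp add: vline_def complex_eq_iff)
      then show "- hline s * - inverse (hline s) * airy_exp z (hline s) = 1 * airy_exp z (hline s)"
        by simp
    qed
    then have "(?W has_field_derivative ?f z) (at z)"
      using has_field_derivative_airy_weight[OF subexponential_inverse, of z] by simp
    then show ?thesis
      unfolding G_def r_def using c by (auto intro!: derivative_eq_intros)
  qed
  have G0: "G 0 = 0" by (simp add: G_def)
  have r10: "r1 0 = 1" using c by (simp add: r1_def c_def)
  have cnjs: "r (cnj z) = cnj (r z)" "G (cnj z) = cnj (G z)" for z
    using cnj_airy_weight[of "\<lambda>p. - inverse p" 0]
    by (simp_all add: r_def G_def cc cnj_airy_weight)
  define k where "k = K0 / cmod c"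
  have pm: "0 < 1 + cmod z" for z by (simp add: add_pos_nonneg)
  have k: "k > 0" using K0(1) c by (simp add: k_def)
  have rb: "cmod (r z) \<le> k / (1 + cmod z) ^ 3" if "z \<in> airy_sector" for z
    using divide_right_mono[OF K0(2)[OF that] norm_ge_zero[of c]] by (simp add: r_def k_def norm_divide mult.commute)

  have Ai: "Ai z / deriv Ai 0 = r z" for z
  proof -
    \<comment> \<open>The contour integral witnesses the choice in \<open>Ai\<close>, so
      \<open>Ai\<close> has property \<open>P\<close>. The difference of the two normalised
      solutions decays and has derivative 1 - 1 = 0 at 0, hence vanishes.\<close>
    define P where "P f \<longleftrightarrow> f holomorphic_on UNIV \<and> (\<forall>z. deriv (deriv f) z = z * f z) \<and>
           ((\<lambda>x::real. f (of_real x)) \<longlongrightarrow> 0) at_top \<and> (\<exists>z. f z \<noteq> 0)" for f :: "complex \<Rightarrow> complex"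
    have "deriv ?f = ?f1" using df by (auto intro: DERIV_imp_deriv)
    then have "P ?f"
      unfolding P_def using df df1 tend0[OF K0(2)] airy_weight_1_nonzero
      by (auto simp: holomorphic_on_open intro: DERIV_imp_deriv)
    moreover have "Ai = (SOME f. P f)" by (simp add: Ai_def P_def)
    ultimately have "P Ai" by (metis someI)
    then have hol: "Ai holomorphic_on UNIV" and ode: "\<And>z. deriv (deriv Ai) z = z * Ai z"
      and lim: "((\<lambda>x::real. Ai (of_real x)) \<longlongrightarrow> 0) at_top" and nz: "\<exists>z. Ai z \<noteq> 0"
      by (auto simp: P_def)
    have dA: "(Ai has_field_derivative deriv Ai z) (at z)" for z
      using hol by (auto intro: holomorphic_derivI)
    have dA1: "(deriv Ai has_field_derivative z * Ai z) (at z)" for z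
      using holomorphic_derivI[OF holomorphic_deriv[OF hol]] by (simp add: ode)
    have n0: "deriv Ai 0 \<noteq> 0"
      using airy_solution_unique[OF dA dA1 lim] nz by blast
    have "Ai z / deriv Ai 0 - r z = 0"
    proof (rule airy_solution_unique[of "\<lambda>z. Ai z / deriv Ai 0 - r z" "\<lambda>z. deriv Ai z / deriv Ai 0 - r1 z"])
      show "((\<lambda>z. Ai z / deriv Ai 0 - r z) has_field_derivative deriv Ai z / deriv Ai 0 - r1 z) (at z)" for z
        by (intro DERIV_diff DERIV_cdivide dA dr)
      show "((\<lambda>z. deriv Ai z / deriv Ai 0 - r1 z) has_field_derivative z * (Ai z / deriv Ai 0 - r z)) (at z)" for z
        using DERIV_diff[OF DERIV_cdivide[OF dA1] dr1] by (simp add: right_diff_distrib)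
      show "((\<lambda>x::real. Ai (of_real x) / deriv Ai 0 - r (of_real x)) \<longlongrightarrow> 0) at_top"
        using tendsto_diff[OF tendsto_divide[OF lim tendsto_const n0] tend0[OF rb]] by simp
    qed (use n0 r10 in simp)
    then show ?thesis by simp
  qed

  \<comment> \<open>A Landau-type estimate: the first derivative is controlled by the values at z
    and z + 1 and by the second derivative w r(w) in between, which decays quadratically. The step
    to the right keeps the segment in the sector and no closer to 0. Two values and one remainder
    give the factor 3.\<close>
  have r1b: "cmod (r1 z) \<le> (3 * k) / (1 + cmod z)\<^sup>2" if z: "z \<in> airy_sector" for z
  proof -
    let ?m = "1 + cmod z"
    have m: "?m \<ge> 1" by simp
    have seg: "w \<in> airy_sector \<and> cmod z \<le> cmod w" if ws: "w \<in> closed_segment z (z + 1)" for w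
    proof -
      obtain u where "0 \<le> u \<and> u \<le> 1 \<and> w = (1 - u) *\<^sub>R z + u *\<^sub>R (z + 1)"
        using ws unfolding in_segment(1) by blast
      then have u: "0 \<le> u" "u \<le> 1" "w = (1 - u) *\<^sub>R z + u *\<^sub>R (z + 1)" by blast+
      have w: "Re w = Re z + u" "Im w = Im z" using u(3) by (simp_all add: algebra_simps)
      have sq: "(Re z)\<^sup>2 \<le> (Re z + u)\<^sup>2" using z u by (intro power_mono) (auto simp: airy_sector_def)
      have z': "0 \<le> Re z" "3 * (Im z)\<^sup>2 \<le> (Re z)\<^sup>2" using z by (auto simp: airy_sector_def)
      have "3 * (Im w)\<^sup>2 \<le> (Re w)\<^sup>2" using z'(2) sq unfolding w by linarith
      moreover have "cmod z \<le> cmod w" unfolding cmod_def w using sq by (intro real_sqrt_le_mono) linarith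
      ultimately show ?thesis using z'(1) u(1) by (simp add: airy_sector_def w(1))
    qed
    have rm: "cmod (r w) \<le> k / ?m ^ 3" if "w \<in> airy_sector" "cmod z \<le> cmod w" for w
      using rb[OF that(1)] that(2) k by (auto elim!: order_trans intro!: divide_left_mono power_mono mult_pos_pos zero_less_power pm)
    have wr: "cmod (w * r w) \<le> k / ?m\<^sup>2" if "w \<in> airy_sector" "cmod z \<le> cmod w" for w
    proof -
      have pos: "0 < 1 + cmod w" by (simp add: add_pos_nonneg)
      have "cmod (w * r w) \<le> (1 + cmod w) * (k / (1 + cmod w) ^ 3)"
        unfolding norm_mult using rb[OF that(1)] by (intro mult_mono) auto
      also have "\<dots> = k / (1 + cmod w)\<^sup>2"
        using pos by (simp add: power2_eq_square power3_eq_cube)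
      also have "\<dots> \<le> k / ?m\<^sup>2"
        using that(2) k by (auto intro!: divide_left_mono power_mono mult_pos_pos zero_less_power pm)
      finally show ?thesis .
    qed
    define F where "F i = (if i = 0 then r else if i = 1 then r1 else (\<lambda>z. z * r z))" for i :: nat
    have "cmod (F 0 (z + 1) - (\<Sum>i\<le>1. F i z * (z + 1 - z) ^ i / fact i)) \<le> k / ?m\<^sup>2 * cmod (z + 1 - z) ^ Suc 1 / fact 1"
    proof (rule complex_Taylor[where S = "closed_segment z (z + 1)"])
      fix i :: nat and x assume "i \<le> 1"
      then show "(F i has_field_derivative F (Suc i) x) (at x within closed_segment z (z + 1))"
        by (cases "i = 0") (auto simp: F_def intro: has_field_derivative_at_within dr dr1)
    next
      fix x assume "x \<in> closed_segment z (z + 1)"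
      then show "cmod (F (Suc 1) x) \<le> k / ?m\<^sup>2" using seg wr by (simp add: F_def)
    qed auto
    then have T: "cmod (r (z + 1) - (r z + r1 z)) \<le> k / ?m\<^sup>2" by (simp add: F_def)
    have c3: "k / ?m ^ 3 \<le> k / ?m\<^sup>2"
      using k m by (intro divide_left_mono power_increasing) (auto intro!: mult_pos_pos zero_less_power pm)
    have "cmod (r1 z) = cmod ((r (z + 1) - r z) - (r (z + 1) - (r z + r1 z)))" by simp
    also have "\<dots> \<le> cmod (r (z + 1)) + cmod (r z) + cmod (r (z + 1) - (r z + r1 z))"
      by (meson add_mono norm_triangle_ineq4 order_refl order_trans)
    also have "\<dots> \<le> k / ?m ^ 3 + k / ?m ^ 3 + k / ?m\<^sup>2"
      using seg[of "z + 1"] by (intro add_mono T rm) (auto simp: z)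
    also have "\<dots> \<le> (3 * k) / ?m\<^sup>2" using c3 by simp
    finally show ?thesis .
  qed

  \<comment> \<open>By conjugation symmetry G and r are real on the real axis, so the sign and limit
    of G can be studied by one-variable calculus.\<close>
  define g where "g x = Re (G (of_real x))" for x :: real
  define \<rho> where "\<rho> x = Re (r (of_real x))" for x :: real
  define \<rho>1 where "\<rho>1 x = Re (r1 (of_real x))" for x :: real
  have Greal: "G (of_real x) = of_real (g x)" for x
    using cnjs(2)[of "of_real x"] by (simp add: g_def complex_eq_iff)
  have \<rho>real: "r (of_real x) = of_real (\<rho> x)" for x
    using cnjs(1)[of "of_real x"] by (simp add: \<rho>_def complex_eq_iff)
  have re_deriv: "((\<lambda>x::real. Re (H (of_real x))) has_real_derivative Re D) (at x)"
    if "(H has_field_derivative D) (at (of_real x))" for H D x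
    using has_field_derivative_Re[OF field_vector_diff_chain_at[of of_real 1 x H, OF _ that]]
      has_vector_derivative_of_real[OF DERIV_ident, of "at x"]
    by (auto simp: comp_def)
  have dg: "(g has_real_derivative \<rho> x) (at x)" for x
    unfolding g_def \<rho>_def by (rule re_deriv[OF dG])
  have d\<rho>: "(\<rho> has_real_derivative \<rho>1 x) (at x)" for x
    unfolding \<rho>_def \<rho>1_def by (rule re_deriv[OF dr])
  have d\<rho>1: "(\<rho>1 has_real_derivative x * \<rho> x) (at x)" for x
    using re_deriv[OF dr1, of x] unfolding \<rho>_def \<rho>1_def by simp
  have \<rho>b: "\<bar>\<rho> x\<bar> \<le> k / (1 + x) ^ 3" if "0 \<le> x" for x
    using rb[of "of_real x"] that by (simp add: \<rho>real)
  have d1: "((\<lambda>x. (\<rho> x)\<^sup>2) has_real_derivative 2 * (\<rho> x * \<rho>1 x)) (at x)" for x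
    by (auto intro!: derivative_eq_intros d\<rho>)
  have d2: "((\<lambda>x. \<rho> x * \<rho>1 x) has_real_derivative (\<rho>1 x)\<^sup>2 + x * (\<rho> x)\<^sup>2) (at x)" for x
    by (auto intro!: derivative_eq_intros d\<rho> d\<rho>1 simp: power2_eq_square)
  have lim\<rho>: "((\<lambda>x. (\<rho> x)\<^sup>2) \<longlongrightarrow> 0) at_top"
    using tendsto_power[OF tendsto_Re[OF tend0[OF rb]], of 2] by (simp add: \<rho>_def)
  note cd = convex_decay[OF d1 d2 _ lim\<rho>]
  have \<rho>10: "\<rho>1 0 = 1" by (simp add: \<rho>1_def r10)
  \<comment> \<open>Decay gives \<open>\<rho> 0 * \<rho>1 0 \<le> 0\<close> with
    \<open>\<rho>1 0 = 1\<close>. Equality is impossible: \<open>\<rho>\<close> squared is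
    nonincreasing, so \<open>\<rho>\<close> would vanish on the half line although its slope at 0 is
    1.\<close>
  have \<rho>0: "\<rho> 0 < 0"
  proof -
    have "\<rho> 0 * \<rho>1 0 \<le> 0" by (rule cd(2)) auto
    moreover have "\<rho> 0 \<noteq> 0"
    proof
      assume "\<rho> 0 = 0"
      then have z: "\<rho> x = 0" if "0 \<le> x" for x
        using cd(3)[of 0 x] that by auto
      have "eventually (\<lambda>x. \<rho> x > \<rho> 0) (at_right 0)"
      proof -
        obtain d where "d > 0" "\<And>h. 0 < h \<Longrightarrow> h < d \<Longrightarrow> \<rho> 0 < \<rho> (0 + h)"
          using DERIV_pos_inc_right[OF d\<rho>[of 0]] \<rho>10 by auto
        then show ?thesis by (auto simp: eventually_at_right intro!: exI[of _ d])
      qed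
      moreover have "eventually (\<lambda>x::real. x > 0) (at_right 0)" by (rule eventually_at_right_less)
      ultimately have "eventually (\<lambda>x. \<rho> x > \<rho> 0 \<and> x > 0) (at_right 0)"
        by (rule eventually_conj)
      then obtain x where "\<rho> x > \<rho> 0" "x > 0"
        by (auto dest!: eventually_happens)
      then show False using z[of x] z[of 0] by simp
    qed
    ultimately show ?thesis using \<rho>10 by simp
  qed
  \<comment> \<open>A positive value would force a zero before it; from that zero on
    \<open>\<rho>\<close> squared, being nonincreasing, stays 0.\<close>
  have \<rho>neg: "\<rho> x \<le> 0" if x0: "0 \<le> x" for x
  proof (rule ccontr)
    assume "\<not> \<rho> x \<le> 0"
    moreover have "continuous_on {0..x} \<rho>"
      by (meson DERIV_continuous continuous_at_imp_continuous_on d\<rho>)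
    ultimately obtain y where y: "0 \<le> y" "y \<le> x" "\<rho> y = 0"
      using IVT'[of \<rho> 0 0 x] \<rho>0 x0 by auto
    then show False using cd(3)[of y x] \<open>\<not> \<rho> x \<le> 0\<close> by auto
  qed
  have gmono: "g y \<le> g x" if "0 \<le> x" "x \<le> y" for x y
    by (rule DERIV_nonpos_imp_nonincreasing[OF that(2)]) (use dg \<rho>neg that in force)
  have glower: "- k \<le> g x" if "0 \<le> x" for x
  proof -
    \<comment> \<open>The comparison function k / (1 + x) has derivative -k / (1 + x)^2, and the
      cubic bound on \<open>\<rho>\<close> lies below k / (1 + x)^2.\<close>
    have "g 0 - k / (1 + 0) \<le> g x - k / (1 + x)"
    proof (rule DERIV_nonneg_imp_nondecreasing[OF that])
      fix t assume t: "0 \<le> t" "t \<le> x"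
      have "((\<lambda>t. g t - k / (1 + t)) has_real_derivative \<rho> t + k / (1 + t)\<^sup>2) (at t)"
        using t by (auto intro!: derivative_eq_intros dg simp: power2_eq_square)
      moreover have "0 \<le> \<rho> t + k / (1 + t)\<^sup>2"
      proof -
        have "k / (1 + t) ^ 3 \<le> k / (1 + t)\<^sup>2"
          using k t by (intro divide_left_mono power_increasing) (auto intro!: mult_pos_pos)
        then show ?thesis using \<rho>b[OF t(1)] by linarith
      qed
      ultimately show "\<exists>d. ((\<lambda>t. g t - k / (1 + t)) has_real_derivative d) (at t) \<and> 0 \<le> d" by blast
    qed
    moreover have "g 0 = 0" by (simp add: g_def G0)
    moreover have "0 \<le> k / (1 + x)" using k that by simp
    ultimately show ?thesis by simp
  qed
  \<comment> \<open>\<open>g\<close> is nonincreasing and bounded below, so its infimum is its limit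
    at infinity.\<close>
  define L where "L = Inf (g ` {0..})"
  have bdd: "bdd_below (g ` {0..})" using glower by (intro bdd_belowI[of _ "- k"]) auto
  have gL: "L \<le> g x" if "0 \<le> x" for x
    unfolding L_def using that bdd by (intro cInf_lower) auto
  have glim: "\<exists>S\<ge>0. \<forall>x\<ge>S. \<bar>g x - L\<bar> < e" if e: "e > 0" for e
  proof -
    have "Inf (g ` {0..}) < L + e" using e by (simp add: L_def)
    then obtain S where S: "0 \<le> S" "g S < L + e"
      by (subst (asm) cInf_less_iff[OF _ bdd]) auto
    show ?thesis
    proof (intro exI[of _ S] conjI allI impI S(1))
      fix x assume "S \<le> x"
      then show "\<bar>g x - L\<bar> < e" using gmono[OF S(1), of x] gL[of x] S by auto
    qed
  qed
  have L: "L < 0"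
  proof -
    obtain d where d: "d > 0" "\<And>h. 0 < h \<Longrightarrow> h < d \<Longrightarrow> g (0 + h) < g 0"
      using DERIV_neg_dec_right[OF dg[of 0] \<rho>0] by auto
    then have "g (d / 2) < g 0" using d(2)[of "d / 2"] by simp
    then show ?thesis using gL[of "d / 2"] d(1) by (simp add: g_def G0)
  qed
  \<comment> \<open>G is compared with its value at the foot of the vertical through z. The path has
    length |Im z| \<le> Re z and stays in the sector, where the cubic decay of r leaves a spare
    factor 1 / (1 + Re z). Both the bound and the limit of G are thereby reduced to the real
    axis.\<close>
  have Gcone: "cmod (G z - G (of_real (Re z))) \<le> k / (1 + Re z)" if z: "z \<in> airy_sector" for z
  proof -
    have x: "0 \<le> Re z" and c: "3 * (Im z)\<^sup>2 \<le> (Re z)\<^sup>2" using z by (auto simp: airy_sector_def)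
    have "cmod (G z - G (of_real (Re z))) \<le> k / (1 + Re z) ^ 3 * cmod (z - of_real (Re z))"
    proof (rule field_differentiable_bound[where S = "closed_segment (of_real (Re z)) z" and f' = r])
      fix w assume "w \<in> closed_segment (of_real (Re z)) z"
      then obtain u where u: "0 \<le> u" "u \<le> 1" "w = (1 - u) *\<^sub>R of_real (Re z) + u *\<^sub>R z"
        by (auto simp: in_segment)
      have w: "Re w = Re z" "Im w = u * Im z" unfolding u(3) by (simp_all add: algebra_simps)
      have "(u * Im z)\<^sup>2 \<le> 1 * (Im z)\<^sup>2"
        unfolding power_mult_distrib using u by (intro mult_right_mono power_le_one) auto
      then have ws: "w \<in> airy_sector" using x c by (auto simp: airy_sector_def w)
      have "Re z \<le> cmod w" using complex_Re_le_cmod[of w] w by simp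
      then have "k / (1 + cmod w) ^ 3 \<le> k / (1 + Re z) ^ 3"
        using k x by (intro divide_left_mono power_mono mult_pos_pos zero_less_power) (auto intro: add_pos_nonneg)
      then show "cmod (r w) \<le> k / (1 + Re z) ^ 3" using rb[OF ws] by linarith
    qed (auto intro: has_field_derivative_at_within[OF dG])
    also have "cmod (z - of_real (Re z)) = \<bar>Im z\<bar>" by (simp add: cmod_def)
    also have "k / (1 + Re z) ^ 3 * \<bar>Im z\<bar> \<le> k / (1 + Re z) ^ 3 * (1 + Re z)\<^sup>2"
    proof -
      have "(Im z)\<^sup>2 \<le> (Re z)\<^sup>2" using c by (smt (verit) zero_le_power2)
      then have "\<bar>Im z\<bar> \<le> Re z" using x by (simp add: abs_le_square_iff[symmetric])
      moreover have "Re z \<le> (1 + Re z)\<^sup>2" using x by (simp add: power2_eq_square algebra_simps)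
      ultimately have "\<bar>Im z\<bar> \<le> (1 + Re z)\<^sup>2" by simp
      then show ?thesis using k x by (intro mult_left_mono) auto
    qed
    also have "k / (1 + Re z) ^ 3 * (1 + Re z)\<^sup>2 = k / (1 + Re z)"
      using x by (simp add: power2_eq_square power3_eq_cube)
    finally show ?thesis .
  qed
  have Gb: "cmod (G z) \<le> 2 * k" if z: "z \<in> airy_sector" for z
  proof -
    have x: "0 \<le> Re z" using z by (auto simp: airy_sector_def)
    have "g (Re z) \<le> g 0" using gmono[of 0 "Re z"] x by simp
    then have "cmod (G (of_real (Re z))) \<le> k" using glower[OF x] by (simp add: Greal g_def[of 0] G0)
    moreover have "k / (1 + Re z) \<le> k" using k x by (simp add: divide_le_eq)
    ultimately show ?thesis
      using Gcone[OF z] norm_triangle_sub[of "G z" "G (of_real (Re z))"] by linarith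
  qed
  have Glim: "\<exists>S>0. \<forall>z\<in>airy_sector. S \<le> cmod z \<longrightarrow> cmod (G z - of_real L) < e" if e: "e > 0" for e
  proof -
    obtain S where S: "S \<ge> 0" "\<And>x. x \<ge> S \<Longrightarrow> \<bar>g x - L\<bar> < e / 2" using glim[of "e / 2"] e by auto
    \<comment> \<open>Chosen so that Re z \<ge> q gives k / (1 + Re z) \<le> e/2; the factor 2 in
      the threshold below pays for |z| \<le> 2 Re z.\<close>
    define q where "q = 2 * k / e"
    have q: "0 \<le> q" "k = q * e / 2" using k e by (simp_all add: q_def)
    show ?thesis
    proof (intro exI[of _ "2 * (S + q) + 1"] conjI ballI impI)
      show "0 < 2 * (S + q) + 1" using S q by simp
      fix z assume z: "z \<in> airy_sector" and n: "2 * (S + q) + 1 \<le> cmod z"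
      have x: "S + q \<le> Re z" using order_trans[OF n airy_sector_norm_le[OF z]] by simp
      have "q * e \<le> (1 + Re z) * e" using x S e by (intro mult_right_mono) auto
      then have "k / (1 + Re z) \<le> e / 2" using x S q e by (simp add: divide_le_eq mult.commute)
      then have "cmod (G z - G (of_real (Re z))) \<le> e / 2" using Gcone[OF z] by linarith
      moreover have "cmod (G (of_real (Re z)) - of_real L) < e / 2"
        using S(2)[of "Re z"] x q(1) by (simp add: Greal norm_of_real flip: of_real_diff)
      ultimately show "cmod (G z - of_real L) < e"
        using norm_triangle_ineq[of "G z - G (of_real (Re z))" "G (of_real (Re z)) - of_real L"] by simp
    qed
  qed
  have mono: "k / m \<le> 3 * k / m" if "m > 0" for m
    using k that by (auto intro!: divide_right_mono)
  have "airy_profile r r1 G (3 * k) L"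
  proof
    show "3 * k > 0" using k by simp
    show "cmod (r z) \<le> 3 * k / (1 + cmod z) ^ 3" if "z \<in> airy_sector" for z
      by (rule order_trans[OF rb[OF that] mono[OF zero_less_power[OF pm]]])
    show "cmod (G z) \<le> 3 * k" if "z \<in> airy_sector" for z
      using Gb[OF that] k by linarith
  qed (fact Ai dr dr1 r10 dG G0 cnjs r1b L Glim)+
  then show ?thesis by (rule that)
qed

section \<open>The symbol of the linear problem\<close>


text \<open>The natural scale |(\<i> xi)^(1/3)|: in this variable the symbol grows like a fourth
  power, xi^2 is a sixth power, and the profile depends on cbrt xi times y.\<close>

abbreviation cbrt :: "real \<Rightarrow> real" where
  "cbrt \<xi> \<equiv> \<bar>\<xi>\<bar> powr (1/3)"

abbreviation H2_density :: "(real \<Rightarrow> complex) \<Rightarrow> real \<Rightarrow> real" where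
  "H2_density h \<equiv> \<lambda>\<xi>. (1 + \<xi>\<^sup>2)\<^sup>2 * (cmod (h \<xi>))\<^sup>2"

lemma cbrt_power3: "cbrt \<xi> ^ 3 = \<bar>\<xi>\<bar>"
  by (cases "\<xi> = 0") (auto simp: powr_numeral[symmetric] powr_powr)

lemma cbrt_power6: "cbrt \<xi> ^ 6 = \<xi>\<^sup>2"
proof -
  have "cbrt \<xi> ^ 6 = (cbrt \<xi> ^ 3)\<^sup>2" by (simp flip: power_mult)
  then show ?thesis by (simp add: cbrt_power3)
qed

text \<open>The case xi = 0, s = 0 is excluded because \<open>mpow\<close> gives 1 there while
  \<open>0 powr 0\<close> is 0.\<close>

lemma mpow_eq_cbrt_powr: "\<xi> \<noteq> 0 \<or> s \<noteq> 0 \<Longrightarrow> mpow \<xi> s = cbrt \<xi> powr (3 * s)"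
  by (auto simp: mpow_def powr_powr)

lemma norm_ixi13: "cmod (ixi13 \<xi>) = cbrt \<xi>"
  by (simp add: ixi13_def norm_mult)

lemma norm_ixi23: "cmod (ixi23 \<xi>) = (cbrt \<xi>)\<^sup>2"
  by (cases "\<xi> = 0") (auto simp: ixi23_def norm_mult powr_numeral[symmetric] powr_powr)

lemma ixi13_square: "(ixi13 \<xi>)\<^sup>2 = ixi23 \<xi>"
proof -
  have "cis (pi * sgn \<xi> / 6) ^ 2 = cis (pi * sgn \<xi> / 3)"
    unfolding power2_eq_square cis_mult by (rule arg_cong[where f = cis]) simp
  moreover have "(cbrt \<xi>)\<^sup>2 = \<bar>\<xi>\<bar> powr (2/3)"
    by (cases "\<xi> = 0") (auto simp: powr_numeral[symmetric] powr_powr)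
  ultimately show ?thesis
    unfolding ixi13_def ixi23_def by (simp add: power_mult_distrib flip: of_real_power)
qed

lemma ixi13_cube: "ixi13 \<xi> * ixi23 \<xi> = \<i> * of_real \<xi>"
proof (cases "\<xi> = 0")
  case False
  have "cis (pi * sgn \<xi> / 6) * cis (pi * sgn \<xi> / 3) = cis (pi / 2 * sgn \<xi>)"
    by (simp add: cis_mult field_simps)
  also have "\<dots> = \<i> * of_real (sgn \<xi>)"
    using False by (cases "\<xi> > 0") (auto simp: complex_eq_iff)
  finally have 1: "cis (pi * sgn \<xi> / 6) * cis (pi * sgn \<xi> / 3) = \<i> * of_real (sgn \<xi>)" .
  have 2: "cbrt \<xi> * \<bar>\<xi>\<bar> powr (2/3) = \<bar>\<xi>\<bar>"
    using False by (simp flip: powr_add)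
  have "ixi13 \<xi> * ixi23 \<xi> = (cis (pi * sgn \<xi> / 6) * cis (pi * sgn \<xi> / 3)) * of_real (cbrt \<xi> * \<bar>\<xi>\<bar> powr (2/3))"
    by (simp add: ixi13_def ixi23_def mult_ac)
  also have "\<dots> = \<i> * of_real (sgn \<xi> * \<bar>\<xi>\<bar>)" unfolding 1 2 by simp
  finally show ?thesis by (simp only: sgn_mult_abs)
qed (simp add: ixi13_def)

lemma ixi13_uminus: "ixi13 (- \<xi>) = cnj (ixi13 \<xi>)"
  by (simp add: ixi13_def cis_cnj sgn_minus)

lemma ixi23_uminus: "ixi23 (- \<xi>) = cnj (ixi23 \<xi>)"
  by (simp add: ixi23_def cis_cnj sgn_minus)

lemma Re_ixi13: "Re (ixi13 \<xi>) = sqrt 3 / 2 * cbrt \<xi>"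
  by (cases \<xi> "0::real" rule: linorder_cases) (auto simp: ixi13_def cos_30)

lemma Im_ixi13: "Im (ixi13 \<xi>) = sgn \<xi> / 2 * cbrt \<xi>"
  by (cases \<xi> "0::real" rule: linorder_cases) (auto simp: ixi13_def sin_30)

lemma ixi13_airy_sector: "0 \<le> y \<Longrightarrow> ixi13 \<xi> * of_real y \<in> airy_sector"
  unfolding airy_sector_def
  by (cases "\<xi> = 0") (auto simp: Re_ixi13 Im_ixi13 power_mult_distrib power_divide sgn_if)

lemma ixi13_measurable [measurable]: "ixi13 \<in> borel_measurable borel"
  unfolding ixi13_def sgn_if by measurable

lemma ixi23_measurable [measurable]: "ixi23 \<in> borel_measurable borel"
  unfolding ixi23_def sgn_if by measurable

text \<open>Far out in the sector G is replaced by L: since L < 0 and Re a \<ge> 0, the real part of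
  1 - a |xi| L is a sum of nonnegative terms 1 and a multiple of |xi|^(4/3), so no cancellation
  occurs. Near the origin of the sector the term -1 dominates.\<close>

lemma (in airy_profile) symbol_lower_bound:
  obtains c M0 where "c > 0" "M0 > 0"
    "\<And>M \<xi>. M0 \<le> M \<Longrightarrow> c * (1 + cbrt \<xi> ^ 4)
       \<le> cmod (ixi13 \<xi> * of_real \<bar>\<xi>\<bar> * G (ixi13 \<xi> * of_real M) - 1)"
proof -
  \<comment> \<open>sqrt 3 / 2 is Re a / |a|. The quarter leaves room for two losses: replacing G by
    L costs c u^4 in the first case, and 1 + u^4 \<le> 2 has to stay below 3/4 after multiplication
    by c in the second.\<close>
  define c where "c = min 1 (- L * (sqrt 3 / 2)) / 4"
  have c: "0 < c" "4 * c \<le> 1" "4 * c \<le> - L * (sqrt 3 / 2)"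
    using L by (auto simp: c_def intro!: divide_pos_pos mult_neg_pos)
  obtain S where S: "S > 0" "\<And>z. z \<in> airy_sector \<Longrightarrow> S \<le> cmod z \<Longrightarrow> cmod (G z - of_real L) < c"
    using G_limit[OF c(1)] by blast
  \<comment> \<open>If u M < S for some M \<ge> M0, then u (1 + 4 K) < 1, so both u \<le> 1 and u K
    \<le> 1/4 follow.\<close>
  define M0 where "M0 = S * (1 + 4 * K)"
  have M0: "M0 > 0" using S(1) K by (simp add: M0_def)
  show ?thesis
  proof (rule that[OF c(1) M0])
    fix M \<xi> :: real assume M: "M0 \<le> M"
    define u where "u = cbrt \<xi>"
    define z where "z = ixi13 \<xi> * of_real M"
    define \<kappa> where "\<kappa> = ixi13 \<xi> * of_real \<bar>\<xi>\<bar>"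
    have u: "0 \<le> u" by (simp add: u_def)
    have Mp: "0 < M" using M M0 by simp
    have z: "z \<in> airy_sector" unfolding z_def using Mp by (intro ixi13_airy_sector) simp
    have nz: "cmod z = u * M" using Mp by (simp add: z_def norm_mult norm_ixi13 u_def)
    have u4: "u * \<bar>\<xi>\<bar> = u ^ 4"
      using cbrt_power3[of \<xi>] by (simp add: u_def eval_nat_numeral)
    have n\<kappa>: "cmod \<kappa> = u ^ 4" by (simp add: \<kappa>_def norm_mult norm_ixi13 u_def[symmetric] u4)
    have R\<kappa>: "Re \<kappa> = sqrt 3 / 2 * u ^ 4" by (simp add: \<kappa>_def Re_ixi13 u_def[symmetric] u4[symmetric])
    have "c * (1 + u ^ 4) \<le> cmod (\<kappa> * G z - 1)"
    proof (cases "S \<le> cmod z")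
      case True
      have "2 * c * (1 + u ^ 4) \<le> 1 + (- L * (sqrt 3 / 2)) * u ^ 4"
      proof -
        have "2 * c * u ^ 4 \<le> (- L * (sqrt 3 / 2)) * u ^ 4" using c u by (intro mult_right_mono) auto
        then show ?thesis using c(2) c(1) by (simp add: algebra_simps)
      qed
      also have "\<dots> = Re (1 - \<kappa> * of_real L)" by (simp add: R\<kappa>)
      also have "\<dots> \<le> cmod (1 - \<kappa> * of_real L)" by (rule complex_Re_le_cmod)
      also have "\<dots> = cmod ((\<kappa> * G z - 1) - \<kappa> * (G z - of_real L))"
        by (subst norm_minus_commute) (simp add: algebra_simps)
      also have "\<dots> \<le> cmod (\<kappa> * G z - 1) + cmod (\<kappa> * (G z - of_real L))" by (rule norm_triangle_ineq4)
      also have "cmod (\<kappa> * (G z - of_real L)) \<le> u ^ 4 * c"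
        unfolding norm_mult n\<kappa> using S(2)[OF z True] u by (intro mult_left_mono) auto
      finally show ?thesis using c(1) by (simp add: algebra_simps)
    next
      case False
      then have "u * M < S" by (simp add: nz)
      moreover have "u * M0 \<le> u * M" using M u by (rule mult_left_mono)
      ultimately have "S * (u * (1 + 4 * K)) < S * 1" by (simp add: M0_def mult_ac)
      then have lt: "u * (1 + 4 * K) < 1" using S(1) by (simp only: mult_less_cancel_left_pos)
      then have u1: "u \<le> 1" "u * K \<le> 1 / 4"
        using mult_nonneg_nonneg[OF u less_imp_le[OF K]] u by (auto simp: algebra_simps)
      have u4': "u ^ 4 \<le> u" using power_decreasing[of 1 4 u] u u1 by simp
      have "cmod (\<kappa> * G z) \<le> u * K"
        unfolding norm_mult n\<kappa> using K G_bound u4' z u by (intro mult_mono) auto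
      then have "3 / 4 \<le> cmod (\<kappa> * G z - 1)"
        using norm_triangle_ineq2[of 1 "\<kappa> * G z"] u1 by (simp add: norm_minus_commute)
      moreover have "c * (1 + u ^ 4) \<le> c * 2" using u4' u1 c by (intro mult_left_mono) auto
      ultimately show ?thesis using c by linarith
    qed
    then show "c * (1 + cbrt \<xi> ^ 4) \<le> cmod (ixi13 \<xi> * of_real \<bar>\<xi>\<bar> * G (ixi13 \<xi> * of_real M) - 1)"
      by (simp add: u_def \<kappa>_def z_def)
  qed
qed

section \<open>Integrability from weighted square integrability\<close>

lemma integral_inverse_1_plus_square:
  "has_bochner_integral lborel (\<lambda>x::real. inverse (1 + x\<^sup>2)) pi"
  using integrable_inverse_1_plus_square LBINT_inverse_1_plus_square
  by (simp add: has_bochner_integral_iff set_integrable_def interval_lebesgue_integral_def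
      set_lebesgue_integral_def einterval_def)

text \<open>Cauchy-Schwarz for sqrt (1 + xi^2) |h| = (1 + xi^2)^(-1/2) (1 + xi^2) |h|; the first
  factor has square integral pi. A loss of one power of xi in g is thus affordable, which covers the
  growth of the transform of omega relative to that of F.\<close>

lemma weighted_L2_imp_L1:
  assumes [measurable]: "g \<in> borel_measurable borel" "h \<in> borel_measurable borel"
    and h: "integrable lborel (H2_density h)"
    and le: "\<And>\<xi>. cmod (g \<xi>) \<le> D * sqrt (1 + \<xi>\<^sup>2) * cmod (h \<xi>)" and D: "0 \<le> D"
  shows "integrable lborel (\<lambda>\<xi>. D * sqrt (1 + \<xi>\<^sup>2) * cmod (h \<xi>))" "integrable lborel g" "L2 g"
    "(LBINT \<xi>. cmod (g \<xi>)) \<le> D * sqrt (pi * (LBINT \<xi>. H2_density h \<xi>))"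
proof -
  let ?N = "LBINT \<xi>. H2_density h \<xi>"
  let ?u = "\<lambda>\<xi>::real. sqrt (inverse (1 + \<xi>\<^sup>2))" and ?v = "\<lambda>\<xi>. (1 + \<xi>\<^sup>2) * cmod (h \<xi>)"
  have p: "0 < 1 + \<xi>\<^sup>2" for \<xi> :: real by (simp add: add_pos_nonneg)
  have uv: "?u \<xi> * ?v \<xi> = sqrt (1 + \<xi>\<^sup>2) * cmod (h \<xi>)" for \<xi>
  proof -
    have "sqrt (inverse (1 + \<xi>\<^sup>2)) * (1 + \<xi>\<^sup>2) = sqrt (1 + \<xi>\<^sup>2)"
      using p[of \<xi>] by (simp add: real_sqrt_inverse real_div_sqrt flip: divide_inverse_commute)
    then show ?thesis by (simp flip: mult.assoc)
  qed
  have u2: "(\<integral>\<^sup>+\<xi>. (ennreal (?u \<xi>))\<^sup>2 \<partial>lborel) = ennreal pi"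
  proof -
    have "(\<integral>\<^sup>+\<xi>. (ennreal (?u \<xi>))\<^sup>2 \<partial>lborel) = (\<integral>\<^sup>+\<xi>. ennreal (inverse (1 + \<xi>\<^sup>2)) \<partial>lborel)"
      by (intro nn_integral_cong) (simp add: ennreal_power add_nonneg_nonneg)
    also have "\<dots> = ennreal pi"
      using integral_inverse_1_plus_square
      by (subst nn_integral_eq_integral) (auto simp: has_bochner_integral_iff)
    finally show ?thesis .
  qed
  have v2: "(\<integral>\<^sup>+\<xi>. (ennreal (?v \<xi>))\<^sup>2 \<partial>lborel) = ennreal ?N"
  proof -
    have "(\<integral>\<^sup>+\<xi>. (ennreal (?v \<xi>))\<^sup>2 \<partial>lborel) = (\<integral>\<^sup>+\<xi>. ennreal (H2_density h \<xi>) \<partial>lborel)"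
      by (intro nn_integral_cong) (simp add: ennreal_power power_mult_distrib)
    also have "\<dots> = ennreal ?N" using h by (subst nn_integral_eq_integral) auto
    finally show ?thesis .
  qed
  have N0: "0 \<le> ?N" by (intro integral_nonneg_AE) auto
  have "(\<integral>\<^sup>+\<xi>. ennreal (?u \<xi>) * ennreal (?v \<xi>) \<partial>lborel)\<^sup>2 \<le> ennreal pi * ennreal ?N"
    unfolding u2[symmetric] v2[symmetric] by (rule Cauchy_Schwarz_nn_integral) measurable
  then have cs: "(\<integral>\<^sup>+\<xi>. ennreal (sqrt (1 + \<xi>\<^sup>2) * cmod (h \<xi>)) \<partial>lborel)\<^sup>2 \<le> ennreal (pi * ?N)"
    using N0 by (simp add: uv[symmetric] ennreal_mult del: real_sqrt_inverse)
  then have fin: "(\<integral>\<^sup>+\<xi>. ennreal (sqrt (1 + \<xi>\<^sup>2) * cmod (h \<xi>)) \<partial>lborel) < \<infinity>"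
  proof -
    have "X < \<infinity>" if "X\<^sup>2 \<le> ennreal b" for X b
      using that by (cases X) (auto simp: power2_eq_square top_unique)
    then show ?thesis using cs .
  qed
  then have int: "integrable lborel (\<lambda>\<xi>. sqrt (1 + \<xi>\<^sup>2) * cmod (h \<xi>))"
    by (intro integrableI_bounded) auto
  then show int': "integrable lborel (\<lambda>\<xi>. D * sqrt (1 + \<xi>\<^sup>2) * cmod (h \<xi>))"
    by (simp add: mult.assoc)
  show ig: "integrable lborel g"
    by (rule Bochner_Integration.integrable_bound[OF int']) (use le D in \<open>auto intro!: AE_I2 order_trans[OF le abs_ge_self]\<close>)
  have "(ennreal (LBINT \<xi>. sqrt (1 + \<xi>\<^sup>2) * cmod (h \<xi>)))\<^sup>2 \<le> ennreal (pi * ?N)"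
    using cs int by (subst (asm) nn_integral_eq_integral) auto
  then have "(LBINT \<xi>. sqrt (1 + \<xi>\<^sup>2) * cmod (h \<xi>))\<^sup>2 \<le> pi * ?N"
    using N0 by (subst (asm) ennreal_power) (auto intro!: integral_nonneg_AE)
  then have le2: "(LBINT \<xi>. sqrt (1 + \<xi>\<^sup>2) * cmod (h \<xi>)) \<le> sqrt (pi * ?N)"
    by (rule real_le_rsqrt)
  have "(LBINT \<xi>. cmod (g \<xi>)) \<le> (LBINT \<xi>. D * (sqrt (1 + \<xi>\<^sup>2) * cmod (h \<xi>)))"
    using ig int le by (intro integral_mono) (auto simp: mult.assoc)
  also have "\<dots> \<le> D * sqrt (pi * ?N)" using le2 D by (simp add: mult_left_mono)
  finally show "(LBINT \<xi>. cmod (g \<xi>)) \<le> D * sqrt (pi * ?N)" .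
  have "integrable lborel (\<lambda>\<xi>. (cmod (g \<xi>))\<^sup>2)"
  proof (rule Bochner_Integration.integrable_bound[OF integrable_mult_right[OF h, of "D\<^sup>2"]])
    show "AE \<xi> in lborel. norm ((cmod (g \<xi>))\<^sup>2) \<le> norm (D\<^sup>2 * H2_density h \<xi>)"
    proof (rule AE_I2)
      fix \<xi>
      have "sqrt (1 + \<xi>\<^sup>2) \<le> 1 + \<xi>\<^sup>2"
        by (rule real_le_lsqrt) (auto intro: self_le_power add_nonneg_nonneg)
      then have "D * sqrt (1 + \<xi>\<^sup>2) * cmod (h \<xi>) \<le> D * (1 + \<xi>\<^sup>2) * cmod (h \<xi>)"
        using D by (intro mult_right_mono mult_left_mono) auto
      then have "(cmod (g \<xi>))\<^sup>2 \<le> (D * (1 + \<xi>\<^sup>2) * cmod (h \<xi>))\<^sup>2"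
        using le[of \<xi>] by (intro power_mono) auto
      then show "norm ((cmod (g \<xi>))\<^sup>2) \<le> norm (D\<^sup>2 * H2_density h \<xi>)"
        by (simp add: power_mult_distrib mult.assoc)
    qed
  qed measurable
  then show "L2 g" by (simp add: L2_iff_integrable)
qed

lemma H2_density_imp_integrable:
  assumes "h \<in> borel_measurable borel" "integrable lborel (H2_density h)"
  shows "integrable lborel h"
proof (rule weighted_L2_imp_L1(2)[OF assms(1) assms, of 1])
  show "cmod (h \<xi>) \<le> 1 * sqrt (1 + \<xi>\<^sup>2) * cmod (h \<xi>)" for \<xi>
    using mult_right_mono[of 1 "sqrt (1 + \<xi>\<^sup>2)" "cmod (h \<xi>)"] by simp
qed simp

section \<open>The explicit solution and its norms\<close>


text \<open>A bound free of M and of u. The factor u in the numerator is the one power of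
  \<open>cbrt\<close> that integration over the strip consumes, and -1 / (1 + u y) is the
  primitive.\<close>

lemma integral_cbrt_kernel_le:
  assumes "0 \<le> M" "0 \<le> u"
  shows "(\<integral>\<^sup>+y. indicator {0..M} y * ennreal (u / (1 + u * y)\<^sup>2) \<partial>lborel) \<le> 1"
proof -
  have "(\<integral>\<^sup>+y. ennreal (u / (1 + u * y)\<^sup>2) * indicator {0..M} y \<partial>lborel) = ennreal (- (1 / (1 + u * M)) - - (1 / (1 + u * 0)))"
  proof (rule nn_integral_FTC_Icc)
    fix y assume "y \<in> {0..M}"
    then have y: "0 \<le> y" by simp
    then have "1 + u * y \<noteq> 0" using mult_nonneg_nonneg[OF assms(2) y] by linarith
    then show "((\<lambda>y. - (1 / (1 + u * y))) has_real_derivative u / (1 + u * y)\<^sup>2) (at y)"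
      by (auto intro!: derivative_eq_intros simp: power2_eq_square)
  qed (use assms in auto)
  also have "\<dots> \<le> ennreal 1" using assms by (intro ennreal_leI) simp
  finally show ?thesis by (simp add: mult.commute)
qed

text \<open>The upper limit 21 is 1 + 8 + 12: one power for the y-integral, eight from the squared
  symbol and twelve from the H^2 weight (1 + xi^2)^2. The lower limit 1 is needed at small u, where
  the factor u must still be split off.\<close>

lemma powr_le_symbol_weight:
  fixes u t :: real
  assumes "0 \<le> u" "1 \<le> t" "t \<le> 21"
  shows "u powr t \<le> u * ((1 + u ^ 4)\<^sup>2 * (1 + u ^ 6)\<^sup>2)"
proof (cases "u = 0")
  case False
  then have u: "u > 0" using assms by simp
  have "u powr (t - 1) \<le> 1 + u ^ 20"
  proof (cases "u \<le> 1")
    case True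
    then have "u powr (t - 1) \<le> 1 powr (t - 1)" using assms by (intro powr_mono2) auto
    then show ?thesis using assms by simp (smt (verit) zero_le_power)
  next
    case False
    then have "u powr (t - 1) \<le> u powr 20" using assms by (intro powr_mono) auto
    also have "\<dots> = u ^ 20" using u by (simp add: powr_numeral)
    finally show ?thesis by simp
  qed
  also have "\<dots> \<le> (1 + (u ^ 4)\<^sup>2) * (1 + (u ^ 6)\<^sup>2)"
  proof -
    have "(u ^ 4)\<^sup>2 * (u ^ 6)\<^sup>2 = u ^ 20" by (simp flip: power_mult power_add)
    then show ?thesis by (simp add: algebra_simps)
  qed
  also have "\<dots> \<le> (1 + u ^ 4)\<^sup>2 * (1 + u ^ 6)\<^sup>2"
    using assms(1) by (intro mult_mono) (auto simp: power2_sum)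
  finally have "u * u powr (t - 1) \<le> u * ((1 + u ^ 4)\<^sup>2 * (1 + u ^ 6)\<^sup>2)"
    using assms by (intro mult_left_mono)
  moreover have "u powr t = u * u powr (t - 1)"
    using u by (simp add: powr_diff)
  ultimately show ?thesis by simp
qed simp

lemma enn_sqrt_ennreal: "0 \<le> x \<Longrightarrow> enn_sqrt (ennreal x) = ennreal (sqrt x)"
  by (simp add: enn_sqrt_def)

lemma enn_sqrt_mono: "x \<le> y \<Longrightarrow> enn_sqrt x \<le> enn_sqrt y"
  by (cases x; cases y) (auto simp: enn_sqrt_def top_unique)

text \<open>\<open>H\<close> is a pointwise Hermitian representative of the transform of F. The
  constant \<open>c\<close> in \<open>lower\<close> serves all M above the threshold, so any bound
  in terms of \<open>K\<close> and \<open>c\<close> is uniform in M.\<close>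

locale airy_strip = airy_profile +
  fixes c M :: real and H :: "real \<Rightarrow> complex"
  assumes c: "c > 0" and M: "M > 0"
    and lower: "\<And>\<xi>. c * (1 + cbrt \<xi> ^ 4)
       \<le> cmod (ixi13 \<xi> * of_real \<bar>\<xi>\<bar> * G (ixi13 \<xi> * of_real M) - 1)"
    and H_meas [measurable]: "H \<in> borel_measurable borel"
    and H_herm: "\<And>\<xi>. H (- \<xi>) = cnj (H \<xi>)"
    and H_weight: "integrable lborel (H2_density H)"
begin

definition symbol :: "real \<Rightarrow> complex" where
  "symbol \<xi> = ixi13 \<xi> * of_real \<bar>\<xi>\<bar> * G (ixi13 \<xi> * of_real M) - 1"

definition Ah :: "real \<Rightarrow> complex" where
  "Ah \<xi> = H \<xi> / symbol \<xi>"

text \<open>The coefficient dictated by the trace condition. It also satisfies the condition at y =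
  0, because r'(0) = 1 and a times a^2 is \<i> xi.\<close>

definition coef :: "real \<Rightarrow> complex" where
  "coef \<xi> = ixi23 \<xi> * of_real \<bar>\<xi>\<bar> * Ah \<xi>"

definition wh :: "real \<Rightarrow> real \<Rightarrow> complex" where
  "wh \<xi> y = r (ixi13 \<xi> * of_real y) * coef \<xi>"

definition w1 :: "real \<Rightarrow> real \<Rightarrow> complex" where
  "w1 \<xi> y = ixi13 \<xi> * r1 (ixi13 \<xi> * of_real y) * coef \<xi>"

definition w2 :: "real \<Rightarrow> real \<Rightarrow> complex" where
  "w2 \<xi> y = \<i> * of_real (\<xi> * y) * wh \<xi> y"

text \<open>Taking the real part only adjusts the type: \<open>wh\<close> is Hermitian in xi, so the
  inverse transform is already real.\<close>

definition om :: "real \<Rightarrow> real \<Rightarrow> real" where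
  "om x y = Re (inv_fourier (\<lambda>\<xi>. wh \<xi> y) x)"

definition A :: "real \<Rightarrow> real" where
  "A x = Re (inv_fourier Ah x)"

definition energy :: real where
  "energy = (LBINT \<xi>. H2_density H \<xi>)"

lemma r_continuous: "continuous_on S r"
  using r_deriv by (intro continuous_at_imp_continuous_on ballI DERIV_isCont)

lemma r1_continuous: "continuous_on S r1"
  using r1_deriv by (intro continuous_at_imp_continuous_on ballI DERIV_isCont)

lemma G_continuous: "continuous_on S G"
  using G_deriv by (intro continuous_at_imp_continuous_on ballI DERIV_isCont)

lemma r_measurable [measurable]: "r \<in> borel_measurable borel"
  by (intro borel_measurable_continuous_onI r_continuous)

lemma r1_measurable [measurable]: "r1 \<in> borel_measurable borel"
  by (intro borel_measurable_continuous_onI r1_continuous)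

lemma G_measurable [measurable]: "G \<in> borel_measurable borel"
  by (intro borel_measurable_continuous_onI G_continuous)

lemma Ah_measurable [measurable]: "Ah \<in> borel_measurable borel"
  unfolding Ah_def symbol_def by measurable

lemma coef_measurable [measurable]: "coef \<in> borel_measurable borel"
  unfolding coef_def by measurable

lemma wh_measurable [measurable]: "case_prod wh \<in> borel_measurable (borel \<Otimes>\<^sub>M borel)"
  unfolding wh_def by measurable

lemma w1_measurable [measurable]: "case_prod w1 \<in> borel_measurable (borel \<Otimes>\<^sub>M borel)"
  unfolding w1_def by measurable

lemma w2_measurable [measurable]: "case_prod w2 \<in> borel_measurable (borel \<Otimes>\<^sub>M borel)"
  unfolding w2_def by measurable

lemma om_measurable [measurable]: "case_prod om \<in> borel_measurable (borel \<Otimes>\<^sub>M borel)"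
  unfolding om_def inv_fourier_def by measurable

lemma symbol_nonzero: "symbol \<xi> \<noteq> 0"
proof -
  have "0 < c * (1 + cbrt \<xi> ^ 4)" using c by (intro mult_pos_pos add_pos_nonneg) auto
  then show ?thesis using lower[of \<xi>] by (auto simp: symbol_def)
qed

lemma norm_Ah_le: "cmod (Ah \<xi>) \<le> cmod (H \<xi>) / (c * (1 + cbrt \<xi> ^ 4))"
proof -
  have "0 < c * (1 + cbrt \<xi> ^ 4)" using c by (intro mult_pos_pos add_pos_nonneg) auto
  then show ?thesis
    using lower[of \<xi>] by (auto simp: Ah_def norm_divide symbol_def[symmetric] intro!: divide_left_mono mult_pos_pos)
qed

lemma norm_coef: "cmod (coef \<xi>) = cbrt \<xi> ^ 5 * cmod (Ah \<xi>)"
proof -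
  have "(cbrt \<xi>)\<^sup>2 * \<bar>\<xi>\<bar> = (cbrt \<xi>)\<^sup>2 * cbrt \<xi> ^ 3" by (simp only: cbrt_power3)
  also have "\<dots> = cbrt \<xi> ^ 5" by (simp flip: power_add)
  finally have "(cbrt \<xi>)\<^sup>2 * \<bar>\<xi>\<bar> = cbrt \<xi> ^ 5" .
  then show ?thesis by (simp add: coef_def norm_mult norm_ixi23)
qed

lemma norm_wh_le:
  assumes "0 \<le> y"
  shows "cmod (wh \<xi> y) \<le> K / (1 + cbrt \<xi> * y) ^ 3 * (cbrt \<xi> ^ 5 * cmod (Ah \<xi>))"
proof -
  have "cmod (wh \<xi> y) = cmod (r (ixi13 \<xi> * of_real y)) * (cbrt \<xi> ^ 5 * cmod (Ah \<xi>))"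
    by (simp add: wh_def norm_mult norm_coef)
  moreover have "cmod (r (ixi13 \<xi> * of_real y)) \<le> K / (1 + cbrt \<xi> * y) ^ 3"
    using r_bound[OF ixi13_airy_sector[OF assms, of \<xi>]] assms by (simp add: norm_mult norm_ixi13)
  ultimately show ?thesis by (simp only:) (rule mult_right_mono, simp_all)
qed

lemma norm_w1_le:
  assumes "0 \<le> y"
  shows "cmod (w1 \<xi> y) \<le> K / (1 + cbrt \<xi> * y)\<^sup>2 * (cbrt \<xi> ^ 6 * cmod (Ah \<xi>))"
proof -
  have "cmod (w1 \<xi> y) = cmod (r1 (ixi13 \<xi> * of_real y)) * (cbrt \<xi> ^ 6 * cmod (Ah \<xi>))"
    by (simp add: w1_def norm_mult norm_ixi13 norm_coef eval_nat_numeral)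
  moreover have "cmod (r1 (ixi13 \<xi> * of_real y)) \<le> K / (1 + cbrt \<xi> * y)\<^sup>2"
    using r1_bound[OF ixi13_airy_sector[OF assms, of \<xi>]] assms by (simp add: norm_mult norm_ixi13)
  ultimately show ?thesis by (simp only:) (rule mult_right_mono, simp_all)
qed

lemma norm_Ah_le_weight: "cmod (Ah \<xi>) \<le> 1 / c * sqrt (1 + \<xi>\<^sup>2) * cmod (H \<xi>)"
proof -
  have "cmod (Ah \<xi>) \<le> cmod (H \<xi>) / (c * 1)"
    using norm_Ah_le[of \<xi>] c by (elim order_trans) (intro divide_left_mono mult_left_mono mult_pos_pos, auto intro: add_pos_nonneg)
  also have "\<dots> \<le> 1 / c * sqrt (1 + \<xi>\<^sup>2) * cmod (H \<xi>)"
    using c mult_right_mono[of 1 "sqrt (1 + \<xi>\<^sup>2)" "cmod (H \<xi>)"] by (simp add: divide_right_mono)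
  finally show ?thesis .
qed

text \<open>A majorant independent of y, so that one integrable function serves both the inverse
  transform at each height and Fubini in \<open>integral_om\<close>. The quotient u^5 / (1 + u^4) is
  at most 1 + u, hence at most 2 sqrt (1 + xi^2).\<close>

lemma norm_wh_le_weight:
  assumes y: "0 \<le> y"
  shows "cmod (wh \<xi> y) \<le> 2 * K / c * sqrt (1 + \<xi>\<^sup>2) * cmod (H \<xi>)"
proof -
  define u where "u = cbrt \<xi>"
  have u: "0 \<le> u" "u ^ 6 = \<xi>\<^sup>2" unfolding u_def by (simp_all add: cbrt_power6)
  have one: "1 \<le> 1 + u * y" using u y by simp
  have p: "0 < c * (1 + u ^ 4)" using c u by (intro mult_pos_pos add_pos_nonneg) auto
  have "(1 + u)\<^sup>2 \<le> 4 * (1 + u ^ 6)"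
  proof (cases "u \<le> 1")
    case True
    then have "(1 + u)\<^sup>2 \<le> 2\<^sup>2" using u by (intro power_mono) auto
    also have "\<dots> \<le> 4 * (1 + u ^ 6)" using u by simp
    finally show ?thesis .
  next
    case False
    then have "(1 + u)\<^sup>2 \<le> (2 * u)\<^sup>2" by (intro power_mono) auto
    moreover have "u\<^sup>2 \<le> u ^ 6" using False by (intro power_increasing) auto
    ultimately show ?thesis by (simp add: power_mult_distrib)
  qed
  then have "1 + u \<le> sqrt (4 * (1 + u ^ 6))" by (rule real_le_rsqrt)
  then have s: "1 + u \<le> 2 * sqrt (1 + \<xi>\<^sup>2)" unfolding u(2) real_sqrt_mult by simp
  have "u ^ 5 \<le> (1 + u) * (1 + u ^ 4)" using u(1) by (simp add: algebra_simps eval_nat_numeral)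
  also have "\<dots> \<le> 2 * sqrt (1 + \<xi>\<^sup>2) * (1 + u ^ 4)" using s u by (intro mult_right_mono) auto
  finally have r5: "u ^ 5 \<le> 2 * sqrt (1 + \<xi>\<^sup>2) * (1 + u ^ 4)" .
  have "cmod (wh \<xi> y) \<le> K / (1 + u * y) ^ 3 * (u ^ 5 * cmod (Ah \<xi>))"
    unfolding u_def by (rule norm_wh_le[OF y])
  also have "\<dots> \<le> K * ((2 * sqrt (1 + \<xi>\<^sup>2) * (1 + u ^ 4)) * (cmod (H \<xi>) / (c * (1 + u ^ 4))))"
  proof (intro mult_mono r5)
    have "K / (1 + u * y) ^ 3 \<le> K / 1"
      using K one by (intro divide_left_mono) (auto intro: one_le_power)
    then show "K / (1 + u * y) ^ 3 \<le> K" by simp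
    show "cmod (Ah \<xi>) \<le> cmod (H \<xi>) / (c * (1 + u ^ 4))" unfolding u_def by (rule norm_Ah_le)
  qed (use K u in auto)
  also have "\<dots> = 2 * K / c * sqrt (1 + \<xi>\<^sup>2) * cmod (H \<xi>)"
    using p c by (simp add: field_simps)
  finally show ?thesis .
qed

lemmas Ah_L1_L2 = weighted_L2_imp_L1[OF Ah_measurable H_meas H_weight norm_Ah_le_weight less_imp_le[OF divide_pos_pos[OF zero_less_one c]]]

lemma wh_section_measurable [measurable]: "(\<lambda>\<xi>. wh \<xi> y) \<in> borel_measurable borel"
  unfolding wh_def by measurable

lemma wh_L1_L2:
  assumes "0 \<le> y"
  shows "integrable lborel (\<lambda>\<xi>. wh \<xi> y)" "L2 (\<lambda>\<xi>. wh \<xi> y)"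
  using weighted_L2_imp_L1[OF wh_section_measurable H_meas H_weight norm_wh_le_weight[OF assms]] K c by auto

lemma symbol_uminus: "symbol (- \<xi>) = cnj (symbol \<xi>)"
  by (simp add: symbol_def ixi13_uminus flip: G_cnj)

lemma Ah_uminus: "Ah (- \<xi>) = cnj (Ah \<xi>)"
  by (simp add: Ah_def H_herm symbol_uminus)

lemma wh_uminus: "wh (- \<xi>) y = cnj (wh \<xi> y)"
  by (simp add: wh_def coef_def Ah_uminus ixi13_uminus ixi23_uminus flip: r_cnj)

lemma of_real_om: "of_real (om x y) = inv_fourier (\<lambda>\<xi>. wh \<xi> y) x"
  unfolding om_def by (rule inv_fourier_real) (rule wh_uminus)

lemma of_real_A: "of_real (A x) = inv_fourier Ah x"
  unfolding A_def by (rule inv_fourier_real) (rule Ah_uminus)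

lemma FT_L2_om: "0 \<le> y \<Longrightarrow> FT_L2 (\<lambda>x. of_real (om x y)) (\<lambda>\<xi>. wh \<xi> y)"
  unfolding of_real_om using FT_L2_inv_fourier[OF wh_L1_L2] by (simp add: eta_contract_eq)

lemma FT_L2_A: "FT_L2 (\<lambda>x. of_real (A x)) Ah"
  unfolding of_real_A using FT_L2_inv_fourier[OF Ah_L1_L2(2,3)] by (simp add: eta_contract_eq)

lemma ray_vector_derivative:
  assumes "\<And>z. (f has_field_derivative f' z) (at z)"
  shows "((\<lambda>t. f (a * of_real t)) has_vector_derivative a * f' (a * of_real y)) (at y within S)"
proof -
  have "((\<lambda>t. a * of_real t) has_vector_derivative a) (at y)"
    by (auto intro!: derivative_eq_intros)
  from field_vector_diff_chain_at[OF this assms]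
  show ?thesis by (auto simp: comp_def intro: has_vector_derivative_at_within)
qed

lemma wh_vector_derivative: "((\<lambda>t. wh \<xi> t) has_vector_derivative w1 \<xi> y) (at y within S)"
  unfolding wh_def w1_def
  by (intro has_vector_derivative_mult_left ray_vector_derivative r_deriv)

lemma w1_vector_derivative: "((\<lambda>t. w1 \<xi> t) has_vector_derivative w2 \<xi> y) (at y within S)"
proof -
  have "((\<lambda>t. w1 \<xi> t) has_vector_derivative
      ixi13 \<xi> * (ixi13 \<xi> * (ixi13 \<xi> * of_real y * r (ixi13 \<xi> * of_real y))) * coef \<xi>) (at y within S)"
    unfolding w1_def
    by (intro has_vector_derivative_mult_left has_vector_derivative_mult_right ray_vector_derivative r1_deriv)
  moreover have "ixi13 \<xi> * (ixi13 \<xi> * (ixi13 \<xi> * of_real y * r (ixi13 \<xi> * of_real y))) * coef \<xi> = w2 \<xi> y"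
  proof -
    have "ixi13 \<xi> * (ixi13 \<xi> * (ixi13 \<xi> * of_real y * r (ixi13 \<xi> * of_real y))) * coef \<xi>
        = (ixi13 \<xi> * (ixi13 \<xi>)\<^sup>2) * of_real y * wh \<xi> y"
      by (simp add: wh_def power2_eq_square)
    then show ?thesis by (simp add: ixi13_square ixi13_cube w2_def)
  qed
  ultimately show ?thesis by simp
qed

lemma w1_0: "w1 \<xi> 0 = \<i> * of_real (\<xi> * \<bar>\<xi>\<bar>) * Ah \<xi>"
proof -
  have "w1 \<xi> 0 = (ixi13 \<xi> * ixi23 \<xi>) * of_real \<bar>\<xi>\<bar> * Ah \<xi>"
    by (simp add: w1_def coef_def r1_0 mult.assoc)
  then show ?thesis by (simp add: ixi13_cube)
qed

lemma strip_rep_om: "strip_rep M om wh w1 w2"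
  unfolding strip_rep_def borel_prod[symmetric]
  using om_measurable wh_measurable w1_measurable w2_measurable
    FT_L2_om wh_vector_derivative w1_vector_derivative by auto

text \<open>The scalar equation that \<open>Ah\<close> was built to solve. The primitive in y is
  written with the factor a |xi| instead of a^2 |xi| / a, so xi = 0 needs no separate
  treatment.\<close>

lemma integral_wh: "(LBINT y. indicat_real {0..M} y *\<^sub>R wh \<xi> y) = Ah \<xi> + H \<xi>"
proof -
  have "(LBINT y. indicat_real {0..M} y *\<^sub>R wh \<xi> y)
     = G (ixi13 \<xi> * of_real M) * (ixi13 \<xi> * of_real \<bar>\<xi>\<bar> * Ah \<xi>) - G (ixi13 \<xi> * of_real 0) * (ixi13 \<xi> * of_real \<bar>\<xi>\<bar> * Ah \<xi>)"
  proof (rule integral_FTC_Icc)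
    fix y
    have "((\<lambda>y. G (ixi13 \<xi> * of_real y) * (ixi13 \<xi> * of_real \<bar>\<xi>\<bar> * Ah \<xi>)) has_vector_derivative
        ixi13 \<xi> * r (ixi13 \<xi> * of_real y) * (ixi13 \<xi> * of_real \<bar>\<xi>\<bar> * Ah \<xi>)) (at y within {0..M})"
      by (intro has_vector_derivative_mult_left ray_vector_derivative G_deriv)
    moreover have "ixi13 \<xi> * r (ixi13 \<xi> * of_real y) * (ixi13 \<xi> * of_real \<bar>\<xi>\<bar> * Ah \<xi>) = wh \<xi> y"
      by (simp add: wh_def coef_def ixi13_square[symmetric] power2_eq_square)
    ultimately show "((\<lambda>y. G (ixi13 \<xi> * of_real y) * (ixi13 \<xi> * of_real \<bar>\<xi>\<bar> * Ah \<xi>)) has_vector_derivative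
        wh \<xi> y) (at y within {0..M})" by simp
  next
    show "continuous_on {0..M} (wh \<xi>)"
      by (rule continuous_on_vector_derivative[OF wh_vector_derivative])
  qed (use M in simp)
  also have "\<dots> = (symbol \<xi> + 1) * Ah \<xi>" by (simp add: symbol_def G_0 mult_ac)
  also have "\<dots> = Ah \<xi> + H \<xi>" using symbol_nonzero[of \<xi>] by (simp add: Ah_def field_simps)
  finally show ?thesis .
qed

lemma H_L1: "integrable lborel H"
  by (rule H2_density_imp_integrable[OF H_meas H_weight])

text \<open>Fubini moves the y-integral inside the inverse transform, where
  \<open>integral_wh\<close> evaluates it. The identity holds at every x; only its comparison with F
  is almost everywhere.\<close>

lemma integral_om:
  "set_integrable lborel {0..M} (om x)"
  "(LINT y:{0..M}|lborel. om x y) = A x + Re (inv_fourier H x)"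
proof -
  let ?B = "\<lambda>\<xi>. 2 * K / c * sqrt (1 + \<xi>\<^sup>2) * cmod (H \<xi>)"
  have B: "integrable lborel ?B"
    using K c by (intro weighted_L2_imp_L1(1)[OF wh_section_measurable H_meas H_weight norm_wh_le_weight[of 0]]) auto
  let ?k = "\<lambda>y \<xi>. cis (x * \<xi>) * (indicat_real {0..M} y *\<^sub>R wh \<xi> y)"
  define I where "I = (LBINT \<xi>. ?B \<xi>)"
  have int: "integrable (lborel \<Otimes>\<^sub>M lborel) (case_prod ?k)"
  proof (rule lborel_pair.Fubini_integrable)
    have "integrable lborel (\<lambda>y. indicat_real {0..M} y * I)"
      by (intro integrable_mult_left integrable_real_indicator) (auto simp: emeasure_lborel_Icc_eq)
    then show "integrable lborel (\<lambda>y. LBINT \<xi>. norm (case_prod ?k (y, \<xi>)))"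
    proof (rule Bochner_Integration.integrable_bound)
      show "AE y in lborel. norm (LBINT \<xi>. norm (case_prod ?k (y, \<xi>))) \<le> norm (indicat_real {0..M} y * I)"
      proof (rule AE_I2)
        fix y
        show "norm (LBINT \<xi>. norm (case_prod ?k (y, \<xi>))) \<le> norm (indicat_real {0..M} y * I)"
        proof (cases "y \<in> {0..M}")
          case True
          then have "(LBINT \<xi>. cmod (wh \<xi> y)) \<le> I"
            unfolding I_def using wh_L1_L2(1)[of y] B norm_wh_le_weight[of y] by (intro integral_mono) auto
          then show ?thesis using True abs_ge_self[of I] by (simp add: norm_mult)
        qed simp
      qed
    qed measurable
    show "AE y in lborel. integrable lborel (\<lambda>\<xi>. case_prod ?k (y, \<xi>))"
    proof (rule AE_I2)
      fix y
      show "integrable lborel (\<lambda>\<xi>. case_prod ?k (y, \<xi>))"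
      proof (cases "y \<in> {0..M}")
        case True
        then show ?thesis using integrable_cis_mult[OF wh_L1_L2(1)[of y], of x] by simp
      qed simp
    qed
  qed measurable
  have inner: "(LBINT \<xi>. ?k y \<xi>) = of_real (2 * pi) * of_real (indicat_real {0..M} y * om x y)" for y
  proof -
    have "(LBINT \<xi>. ?k y \<xi>) = (LBINT \<xi>. of_real (indicat_real {0..M} y) * (cis (x * \<xi>) * wh \<xi> y))"
      by (simp add: scaleR_conv_of_real mult_ac)
    also have "\<dots> = of_real (indicat_real {0..M} y) * (LBINT \<xi>. cis (x * \<xi>) * wh \<xi> y)"
      by (rule integral_mult_right_zero)
    also have "(LBINT \<xi>. cis (x * \<xi>) * wh \<xi> y) = of_real (2 * pi) * of_real (om x y)"
      by (simp add: of_real_om inv_fourier_def)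
    finally show ?thesis by simp
  qed
  have "integrable lborel (\<lambda>y. LBINT \<xi>. ?k y \<xi>)"
    using lborel_pair.integrable_fst[OF int] by simp
  then have "integrable lborel (\<lambda>y. Re (LBINT \<xi>. ?k y \<xi>) / (2 * pi))"
    by (intro integrable_divide integrable_Re)
  moreover have "Re (LBINT \<xi>. ?k y \<xi>) / (2 * pi) = indicat_real {0..M} y *\<^sub>R om x y" for y
    unfolding inner by simp
  ultimately show "set_integrable lborel {0..M} (om x)"
    by (simp only: set_integrable_def)
  have "(LBINT y. LBINT \<xi>. ?k y \<xi>) = (LBINT \<xi>. LBINT y. ?k y \<xi>)"
    using lborel_pair.Fubini_integral[OF int] by simp
  also have "\<dots> = (LBINT \<xi>. cis (x * \<xi>) * Ah \<xi> + cis (x * \<xi>) * H \<xi>)"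
    by (simp only: integral_mult_right_zero integral_wh distrib_left)
  also have "\<dots> = (LBINT \<xi>. cis (x * \<xi>) * Ah \<xi>) + (LBINT \<xi>. cis (x * \<xi>) * H \<xi>)"
    by (intro Bochner_Integration.integral_add integrable_cis_mult Ah_L1_L2 H_L1)
  also have "\<dots> = of_real (2 * pi) * (inv_fourier Ah x + inv_fourier H x)"
    by (simp add: inv_fourier_def distrib_left)
  finally have "of_real (2 * pi) * (LBINT y. of_real (indicat_real {0..M} y * om x y))
      = of_real (2 * pi) * (inv_fourier Ah x + inv_fourier H x)"
    unfolding inner by (simp only: integral_mult_right_zero)
  then have "of_real (LBINT y. indicat_real {0..M} y * om x y) = inv_fourier Ah x + inv_fourier H x"
    by (simp only: integral_complex_of_real mult_cancel_left) simp
  then have "Re (of_real (LBINT y. indicat_real {0..M} y * om x y)) = Re (inv_fourier Ah x + inv_fourier H x)"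
    by (rule arg_cong)
  then show "(LINT y:{0..M}|lborel. om x y) = A x + Re (inv_fourier H x)"
    by (simp add: set_lebesgue_integral_def A_def)
qed

lemma trace: "wh \<xi> M = Ai (ixi13 \<xi> * of_real M) / deriv Ai 0 * ixi23 \<xi> * of_real \<bar>\<xi>\<bar> * Ah \<xi>"
  by (simp add: Ai_quotient wh_def coef_def mult.assoc)

end


section \<open>Norm estimates for the explicit solution\<close>

lemma mpow_mult_cbrt_power:
  assumes "\<xi> \<noteq> 0"
  shows "mpow \<xi> s * cbrt \<xi> ^ n = cbrt \<xi> powr (3 * s + real n)"
  using assms by (simp add: mpow_eq_cbrt_powr powr_add powr_realpow)

context airy_strip
begin

text \<open>The H^2 norm of the datum as a real number; \<open>Hs_norm_H\<close> makes the
  identification.\<close>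

definition data_norm :: real where
  "data_norm = sqrt (energy / (2 * pi))"

lemma energy_nonneg: "0 \<le> energy"
  unfolding energy_def by (intro integral_nonneg_AE) auto

lemma data_norm_nonneg: "0 \<le> data_norm"
  using energy_nonneg by (simp add: data_norm_def)

lemma nn_integral_weight:
  assumes "0 \<le> B"
  shows "(\<integral>\<^sup>+\<xi>. ennreal (B * H2_density H \<xi>) \<partial>lborel) = ennreal (B * energy)"
  using H_weight assms by (subst nn_integral_eq_integral) (auto simp: energy_def)

lemma enn_sqrt_energy:
  assumes "0 \<le> B"
  shows "enn_sqrt (ennreal (1 / (2 * pi)) * ennreal (B\<^sup>2 * energy)) = ennreal (B * data_norm)"
proof -
  have "ennreal (1 / (2 * pi)) * ennreal (B\<^sup>2 * energy) = ennreal (B\<^sup>2 * (energy / (2 * pi)))"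
    using energy_nonneg by (simp add: ennreal_mult[symmetric])
  moreover have "sqrt (B\<^sup>2 * (energy / (2 * pi))) = B * data_norm"
    using assms by (simp only: real_sqrt_mult real_sqrt_abs abs_of_nonneg data_norm_def)
  ultimately show ?thesis
    using energy_nonneg enn_sqrt_ennreal[of "B\<^sup>2 * (energy / (2 * pi))"] by simp
qed

text \<open>All strip norms go through this one estimate. The y-integral of u / (1 + u y)^2 is at
  most 1, and what remains of u^t is paid for by the squared symbol and the H^2 weight.\<close>

lemma fnorm_le:
  assumes q: "\<And>\<xi> y. 0 \<le> y \<Longrightarrow> y \<le> M \<Longrightarrow>
      q \<xi> y \<le> K\<^sup>2 * (cmod (Ah \<xi>))\<^sup>2 * cbrt \<xi> powr t / (1 + cbrt \<xi> * y)\<^sup>2"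
    and t: "1 \<le> t" "t \<le> 21"
  shows "fnorm M q \<le> ennreal (K / c * data_norm)"
proof -
  let ?W = "\<lambda>\<xi>. (K / c)\<^sup>2 * H2_density H \<xi>"
  have "(\<integral>\<^sup>+y. indicator {0..M} y * ennreal (q \<xi> y) \<partial>lborel) \<le> ennreal (?W \<xi>)" for \<xi>
  proof -
    define u where "u = cbrt \<xi>"
    have u: "0 \<le> u" "u ^ 6 = \<xi>\<^sup>2" unfolding u_def by (simp_all add: cbrt_power6)
    have p: "0 < c * (1 + u ^ 4)" using c u by (intro mult_pos_pos add_pos_nonneg) auto
    have A: "K\<^sup>2 * (cmod (Ah \<xi>))\<^sup>2 * u powr t \<le> ?W \<xi> * u"
    proof -
      have "K\<^sup>2 * (cmod (Ah \<xi>))\<^sup>2 * u powr t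
          \<le> K\<^sup>2 * (cmod (H \<xi>) / (c * (1 + u ^ 4)))\<^sup>2 * (u * ((1 + u ^ 4)\<^sup>2 * (1 + u ^ 6)\<^sup>2))"
        using norm_Ah_le[of \<xi>] powr_le_symbol_weight[OF u(1) t] K
        by (intro mult_mono power_mono) (auto simp: u_def)
      also have "\<dots> = ?W \<xi> * u"
      proof -
        have "1 + u ^ 4 \<noteq> 0" using p by auto
        then show ?thesis unfolding u(2) by (simp add: power_divide power_mult_distrib mult_ac)
      qed
      finally show ?thesis .
    qed
    have "(\<integral>\<^sup>+y. indicator {0..M} y * ennreal (q \<xi> y) \<partial>lborel)
        \<le> (\<integral>\<^sup>+y. ennreal (?W \<xi>) * (indicator {0..M} y * ennreal (u / (1 + u * y)\<^sup>2)) \<partial>lborel)"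
    proof (rule nn_integral_mono)
      fix y
      show "indicator {0..M} y * ennreal (q \<xi> y) \<le> ennreal (?W \<xi>) * (indicator {0..M} y * ennreal (u / (1 + u * y)\<^sup>2))"
      proof (cases "y \<in> {0..M}")
        case True
        have "q \<xi> y \<le> K\<^sup>2 * (cmod (Ah \<xi>))\<^sup>2 * u powr t / (1 + u * y)\<^sup>2"
          using q[of y \<xi>] True by (simp add: u_def)
        also have "\<dots> \<le> ?W \<xi> * u / (1 + u * y)\<^sup>2" by (intro divide_right_mono A) auto
        finally have "ennreal (q \<xi> y) \<le> ennreal (?W \<xi> * (u / (1 + u * y)\<^sup>2))" by (intro ennreal_leI) simp
        moreover have "ennreal (?W \<xi> * (u / (1 + u * y)\<^sup>2)) = ennreal (?W \<xi>) * ennreal (u / (1 + u * y)\<^sup>2)"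
          by (rule ennreal_mult) (use u in auto)
        ultimately show ?thesis using True by simp
      qed simp
    qed
    also have "\<dots> = ennreal (?W \<xi>) * (\<integral>\<^sup>+y. indicator {0..M} y * ennreal (u / (1 + u * y)\<^sup>2) \<partial>lborel)"
      by (rule nn_integral_cmult) measurable
    also have "\<dots> \<le> ennreal (?W \<xi>) * 1"
      using M u by (intro mult_left_mono integral_cbrt_kernel_le) auto
    finally show ?thesis by simp
  qed
  then have "(\<integral>\<^sup>+\<xi>. \<integral>\<^sup>+y. indicator {0..M} y * ennreal (q \<xi> y) \<partial>lborel \<partial>lborel) \<le> (\<integral>\<^sup>+\<xi>. ennreal (?W \<xi>) \<partial>lborel)"
    by (rule nn_integral_mono)
  also have "\<dots> = ennreal ((K / c)\<^sup>2 * energy)" by (rule nn_integral_weight) simp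
  finally have "fnorm M q \<le> enn_sqrt (ennreal (1 / (2 * pi)) * ennreal ((K / c)\<^sup>2 * energy))"
    unfolding fnorm_def by (intro enn_sqrt_mono mult_left_mono) auto
  also have "\<dots> = ennreal (K / c * data_norm)" using K c by (intro enn_sqrt_energy) simp
  finally show ?thesis .
qed

text \<open>The power 10 is twice the power 5 in \<open>norm_coef\<close>. The squared profile
  decays with exponent 6 while \<open>fnorm_le\<close> asks for 2, so a weight factor
  \<open>g\<close> of order up to 4 in 1 + u y is free. At \<open>\<xi> = 0\<close> the left side
  vanishes with \<open>coef\<close>.\<close>

lemma wh_term:
  assumes y: "0 \<le> y" and f: "0 \<le> f" and fg: "\<xi> \<noteq> 0 \<Longrightarrow> f * cbrt \<xi> ^ 10 = g * cbrt \<xi> powr t"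
    and g: "g \<le> (1 + cbrt \<xi> * y) ^ 4"
  shows "f * (cmod (wh \<xi> y))\<^sup>2 \<le> K\<^sup>2 * (cmod (Ah \<xi>))\<^sup>2 * cbrt \<xi> powr t / (1 + cbrt \<xi> * y)\<^sup>2"
proof (cases "\<xi> = 0")
  case True
  then show ?thesis by (simp add: wh_def coef_def)
next
  case False
  let ?s = "1 + cbrt \<xi> * y"
  have s: "0 < ?s" using y by (simp add: add_pos_nonneg)
  have "f * (cmod (wh \<xi> y))\<^sup>2 \<le> f * (K / ?s ^ 3 * (cbrt \<xi> ^ 5 * cmod (Ah \<xi>)))\<^sup>2"
    using norm_wh_le[OF y, of \<xi>] f by (intro mult_left_mono power_mono) auto
  also have "\<dots> = K\<^sup>2 * (cmod (Ah \<xi>))\<^sup>2 * (f * cbrt \<xi> ^ 10) / ?s ^ 6"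
    by (simp add: power_mult_distrib power_divide power_mult[symmetric] mult_ac)
  also have "\<dots> = (K\<^sup>2 * (cmod (Ah \<xi>))\<^sup>2 * cbrt \<xi> powr t) * g / ?s ^ 6"
    unfolding fg[OF False] by (simp add: mult_ac)
  also have "\<dots> \<le> (K\<^sup>2 * (cmod (Ah \<xi>))\<^sup>2 * cbrt \<xi> powr t) * ?s ^ 4 / ?s ^ 6"
    using g s by (intro divide_right_mono mult_left_mono) auto
  also have "\<dots> = K\<^sup>2 * (cmod (Ah \<xi>))\<^sup>2 * cbrt \<xi> powr t / ?s\<^sup>2"
    using s by (simp add: eval_nat_numeral)
  finally show ?thesis .
qed

text \<open>As in \<open>wh_term\<close>, but a y-derivative brings one more power of u (12 = 2
  times 6) and decays more slowly, so only order 2 is free for \<open>g\<close>.\<close>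

lemma w1_term:
  assumes y: "0 \<le> y" and f: "0 \<le> f" and fg: "\<xi> \<noteq> 0 \<Longrightarrow> f * cbrt \<xi> ^ 12 = g * cbrt \<xi> powr t"
    and g: "g \<le> (1 + cbrt \<xi> * y)\<^sup>2"
  shows "f * (cmod (w1 \<xi> y))\<^sup>2 \<le> K\<^sup>2 * (cmod (Ah \<xi>))\<^sup>2 * cbrt \<xi> powr t / (1 + cbrt \<xi> * y)\<^sup>2"
proof (cases "\<xi> = 0")
  case True
  then show ?thesis by (simp add: w1_def coef_def)
next
  case False
  let ?s = "1 + cbrt \<xi> * y"
  have s: "0 < ?s" using y by (simp add: add_pos_nonneg)
  have "f * (cmod (w1 \<xi> y))\<^sup>2 \<le> f * (K / ?s\<^sup>2 * (cbrt \<xi> ^ 6 * cmod (Ah \<xi>)))\<^sup>2"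
    using norm_w1_le[OF y, of \<xi>] f by (intro mult_left_mono power_mono) auto
  also have "\<dots> = K\<^sup>2 * (cmod (Ah \<xi>))\<^sup>2 * (f * cbrt \<xi> ^ 12) / ?s ^ 4"
    by (simp add: power_mult_distrib power_divide power_mult[symmetric] mult_ac)
  also have "\<dots> = (K\<^sup>2 * (cmod (Ah \<xi>))\<^sup>2 * cbrt \<xi> powr t) * g / ?s ^ 4"
    unfolding fg[OF False] by (simp add: mult_ac)
  also have "\<dots> \<le> (K\<^sup>2 * (cmod (Ah \<xi>))\<^sup>2 * cbrt \<xi> powr t) * ?s\<^sup>2 / ?s ^ 4"
    using g s by (intro divide_right_mono mult_left_mono) auto
  also have "\<dots> = K\<^sup>2 * (cmod (Ah \<xi>))\<^sup>2 * cbrt \<xi> powr t / ?s\<^sup>2"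
    using s by (simp add: eval_nat_numeral)
  finally show ?thesis .
qed

lemma mpow_nonneg: "0 \<le> mpow \<xi> s"
  by (simp add: mpow_def)

text \<open>All five terms scale like the power 14 + 3 a of |xi|^(1/3), one unit of which is absorbed by the
  integration in y; the restriction a \<le> 7/3 is exactly 14 + 3 a \<le> 21.\<close>

lemma Y_norm_le:
  assumes a: "0 \<le> a" "a \<le> 7/3"
  shows "Y_norm a M wh w1 w2 \<le> 5 * ennreal (K / c * data_norm)"
proof -
  let ?E = "ennreal (K / c * data_norm)"
  have t: "1 \<le> 14 + 3 * a" "14 + 3 * a \<le> 21" using a by auto
  have le: "1 \<le> 1 + cbrt \<xi> * y" "(cbrt \<xi> * y)\<^sup>2 \<le> (1 + cbrt \<xi> * y) ^ 4" "cbrt \<xi> * y \<le> (1 + cbrt \<xi> * y)\<^sup>2"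
    "1 \<le> (1 + cbrt \<xi> * y) ^ 4" "1 \<le> (1 + cbrt \<xi> * y)\<^sup>2" if "0 \<le> y" for \<xi> y
  proof -
    have u: "0 \<le> cbrt \<xi> * y" using that by simp
    then show 1: "1 \<le> 1 + cbrt \<xi> * y" "1 \<le> (1 + cbrt \<xi> * y) ^ 4" "1 \<le> (1 + cbrt \<xi> * y)\<^sup>2"
      by (auto intro!: one_le_power)
    have "(cbrt \<xi> * y)\<^sup>2 \<le> (1 + cbrt \<xi> * y)\<^sup>2" using u by (intro power_mono) auto
    also have "\<dots> \<le> (1 + cbrt \<xi> * y) ^ 4" using 1(1) by (intro power_increasing) auto
    finally show "(cbrt \<xi> * y)\<^sup>2 \<le> (1 + cbrt \<xi> * y) ^ 4" .
    have "cbrt \<xi> * y \<le> (1 + cbrt \<xi> * y) ^ 1" by simp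
    also have "\<dots> \<le> (1 + cbrt \<xi> * y)\<^sup>2" using 1(1) by (intro power_increasing) auto
    finally show "cbrt \<xi> * y \<le> (1 + cbrt \<xi> * y)\<^sup>2" .
  qed
  \<comment> \<open>With xi^2 = u^6, two powers of u join y^2 to form (u y)^2; the other four raise
    10 to 14.\<close>
  have p16: "y\<^sup>2 * mpow \<xi> a * \<xi>\<^sup>2 * cbrt \<xi> ^ 10 = (cbrt \<xi> * y)\<^sup>2 * cbrt \<xi> powr (14 + 3 * a)" if "\<xi> \<noteq> 0" for \<xi> y
  proof -
    have "y\<^sup>2 * mpow \<xi> a * \<xi>\<^sup>2 * cbrt \<xi> ^ 10 = (cbrt \<xi> * y)\<^sup>2 * (mpow \<xi> a * cbrt \<xi> ^ 14)"
      unfolding cbrt_power6[of \<xi>, symmetric] by (simp add: eval_nat_numeral mult_ac)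
    then show ?thesis unfolding mpow_mult_cbrt_power[OF that] by (simp add: add.commute)
  qed
  have 1: "fnorm M (\<lambda>\<xi> y. y\<^sup>2 * mpow \<xi> a * \<xi>\<^sup>2 * (cmod (wh \<xi> y))\<^sup>2) \<le> ?E"
    by (rule fnorm_le[OF wh_term[where g = "(cbrt _ * _)\<^sup>2"] t]) (use p16 le mpow_nonneg in auto)
  have 4: "fnorm M (\<lambda>\<xi> y. mpow \<xi> a * (cmod (w2 \<xi> y))\<^sup>2) \<le> ?E"
  proof -
    have "(\<lambda>\<xi> y. mpow \<xi> a * (cmod (w2 \<xi> y))\<^sup>2) = (\<lambda>\<xi> y. y\<^sup>2 * mpow \<xi> a * \<xi>\<^sup>2 * (cmod (wh \<xi> y))\<^sup>2)"
      by (auto simp: w2_def norm_mult power_mult_distrib abs_mult mult_ac)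
    then show ?thesis using 1 by simp
  qed
  have 2: "fnorm M (\<lambda>\<xi> y. mpow \<xi> (4/3 + a) * (cmod (wh \<xi> y))\<^sup>2) \<le> ?E"
  proof (rule fnorm_le[OF wh_term[where g = 1] t])
    show "mpow \<xi> (4/3 + a) * cbrt \<xi> ^ 10 = 1 * cbrt \<xi> powr (14 + 3 * a)" if "\<xi> \<noteq> 0" for \<xi>
      unfolding mpow_mult_cbrt_power[OF that] by (simp add: algebra_simps)
  qed (use le mpow_nonneg in auto)
  have 3: "fnorm M (\<lambda>\<xi> y. mpow \<xi> (2/3 + a) * (cmod (w1 \<xi> y))\<^sup>2) \<le> ?E"
  proof (rule fnorm_le[OF w1_term[where g = 1] t])
    show "mpow \<xi> (2/3 + a) * cbrt \<xi> ^ 12 = 1 * cbrt \<xi> powr (14 + 3 * a)" if "\<xi> \<noteq> 0" for \<xi>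
      unfolding mpow_mult_cbrt_power[OF that] by (simp add: algebra_simps)
  qed (use le mpow_nonneg in auto)
  have p5: "mpow \<xi> (1 + a) * y * cbrt \<xi> ^ 12 = (cbrt \<xi> * y) * cbrt \<xi> powr (14 + 3 * a)" if "\<xi> \<noteq> 0" for \<xi> y
  proof -
    have "mpow \<xi> (1 + a) * y * cbrt \<xi> ^ 12 = (cbrt \<xi> * y) * (mpow \<xi> (1 + a) * cbrt \<xi> ^ 11)"
      by (simp add: eval_nat_numeral mult_ac)
    then show ?thesis unfolding mpow_mult_cbrt_power[OF that] by (simp add: algebra_simps)
  qed
  have 5: "fnorm M (\<lambda>\<xi> y. mpow \<xi> (1 + a) * y * (cmod (w1 \<xi> y))\<^sup>2) \<le> ?E"
  proof (rule fnorm_le[OF w1_term[where g = "cbrt _ * _"] t])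
    show "mpow \<xi> (1 + a) * y * cbrt \<xi> ^ 12 = (cbrt \<xi> * y) * cbrt \<xi> powr (14 + 3 * a)" if "\<xi> \<noteq> 0" for \<xi> y
      using that by (rule p5)
  qed (use le mpow_nonneg in auto)
  have "Y_norm a M wh w1 w2 \<le> ?E + ?E + ?E + ?E + ?E"
    unfolding Y_norm_def by (intro add_mono 1 2 3 4 5)
  also have "\<dots> = 5 * ?E"
  proof -
    have "(5::ennreal) = 1 + 1 + 1 + 1 + 1" by simp
    then show ?thesis by (simp only: distrib_right mult_1)
  qed
  finally show ?thesis .
qed

text \<open>\<open>L2_strip\<close> is the only strip norm expressed in physical space; Plancherel
  at each fixed height, with Tonelli on both sides, brings it to the form that
  \<open>fnorm_le\<close> treats.\<close>

lemma L2_strip_eq: "L2_strip M om = fnorm M (\<lambda>\<xi> y. (cmod (wh \<xi> y))\<^sup>2)"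
proof -
  have "(\<integral>\<^sup>+x. \<integral>\<^sup>+y. indicator {0..M} y * ennreal ((om x y)\<^sup>2) \<partial>lborel \<partial>lborel)
      = (\<integral>\<^sup>+y. \<integral>\<^sup>+x. indicator {0..M} y * ennreal ((om x y)\<^sup>2) \<partial>lborel \<partial>lborel)"
    by (rule lborel_pair.Fubini'[symmetric]) measurable
  also have "\<dots> = (\<integral>\<^sup>+y. \<integral>\<^sup>+\<xi>. ennreal (1 / (2 * pi)) * (indicator {0..M} y * ennreal ((cmod (wh \<xi> y))\<^sup>2)) \<partial>lborel \<partial>lborel)"
  proof (rule nn_integral_cong)
    fix y :: real
    show "(\<integral>\<^sup>+x. indicator {0..M} y * ennreal ((om x y)\<^sup>2) \<partial>lborel)
      = (\<integral>\<^sup>+\<xi>. ennreal (1 / (2 * pi)) * (indicator {0..M} y * ennreal ((cmod (wh \<xi> y))\<^sup>2)) \<partial>lborel)"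
    proof (cases "y \<in> {0..M}")
      case True
      then have y: "0 \<le> y" by simp
      have "(om x y)\<^sup>2 = (cmod (inv_fourier (\<lambda>\<xi>. wh \<xi> y) x))\<^sup>2" for x
        unfolding of_real_om[symmetric] by simp
      then have "(\<integral>\<^sup>+x. ennreal ((om x y)\<^sup>2) \<partial>lborel) = ennreal (1 / (2 * pi)) * sq_int (\<lambda>\<xi>. wh \<xi> y)"
        using plancherel_inv_fourier[OF wh_L1_L2[OF y]] by simp
      also have "\<dots> = (\<integral>\<^sup>+\<xi>. ennreal (1 / (2 * pi)) * ennreal ((cmod (wh \<xi> y))\<^sup>2) \<partial>lborel)"
        by (rule nn_integral_cmult[symmetric]) measurable
      finally show ?thesis using True by simp
    qed simp
  qed
  also have "\<dots> = (\<integral>\<^sup>+\<xi>. \<integral>\<^sup>+y. ennreal (1 / (2 * pi)) * (indicator {0..M} y * ennreal ((cmod (wh \<xi> y))\<^sup>2)) \<partial>lborel \<partial>lborel)"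
    by (rule lborel_pair.Fubini') measurable
  also have "\<dots> = ennreal (1 / (2 * pi)) * (\<integral>\<^sup>+\<xi>. \<integral>\<^sup>+y. indicator {0..M} y * ennreal ((cmod (wh \<xi> y))\<^sup>2) \<partial>lborel \<partial>lborel)"
    by (simp add: nn_integral_cmult)
  finally show ?thesis by (simp add: L2_strip_def fnorm_def)
qed

text \<open>The weight |xi|^(1/9) y^(1/3) equals (u y)^(1/3) and is scale invariant, so this term
  needs the same power 10 as the plain L2 norm, whatever a is. The factor 7 counts these two terms
  and the five of \<open>Y_norm\<close>.\<close>

lemma X_norm_le:
  assumes a: "0 \<le> a" "a \<le> 7/3"
  shows "X_norm a M om wh w1 w2 \<le> 7 * ennreal (K / c * data_norm)"
proof -
  let ?E = "ennreal (K / c * data_norm)"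
  have ge1: "1 \<le> 1 + cbrt \<xi> * y" if "0 \<le> y" for \<xi> y using that by simp
  have 1: "L2_strip M om \<le> ?E"
    unfolding L2_strip_eq
  proof (rule fnorm_le[where t = 10])
    fix \<xi> y :: real assume y: "0 \<le> y"
    have "1 * (cmod (wh \<xi> y))\<^sup>2 \<le> K\<^sup>2 * (cmod (Ah \<xi>))\<^sup>2 * cbrt \<xi> powr 10 / (1 + cbrt \<xi> * y)\<^sup>2"
      by (rule wh_term[OF y, where g = 1]) (use ge1[OF y] in \<open>auto simp: powr_numeral intro!: one_le_power\<close>)
    then show "(cmod (wh \<xi> y))\<^sup>2 \<le> K\<^sup>2 * (cmod (Ah \<xi>))\<^sup>2 * cbrt \<xi> powr 10 / (1 + cbrt \<xi> * y)\<^sup>2" by simp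
  qed auto
  have 2: "fnorm M (\<lambda>\<xi> y. mpow \<xi> (1/9) * y powr (1/3) * (cmod (wh \<xi> y))\<^sup>2) \<le> ?E"
  proof (rule fnorm_le[OF wh_term[where g = "(cbrt _ * _) powr (1/3)"], where t = 10])
    fix \<xi> y :: real assume y: "0 \<le> y"
    show "mpow \<xi> (1/9) * y powr (1/3) * cbrt \<xi> ^ 10 = (cbrt \<xi> * y) powr (1/3) * cbrt \<xi> powr 10" if "\<xi> \<noteq> 0"
      using that y by (simp add: mpow_eq_cbrt_powr powr_mult powr_numeral)
    have "(cbrt \<xi> * y) powr (1/3) \<le> (1 + cbrt \<xi> * y) powr (1/3)"
      using y by (intro powr_mono2) auto
    also have "\<dots> \<le> (1 + cbrt \<xi> * y) powr 4"
      using ge1[OF y] by (intro powr_mono) auto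
    also have "\<dots> = (1 + cbrt \<xi> * y) ^ 4"
      using y by (simp add: powr_numeral add_pos_nonneg)
    finally show "(cbrt \<xi> * y) powr (1/3) \<le> (1 + cbrt \<xi> * y) ^ 4" .
  qed (auto simp: mpow_nonneg)
  have "X_norm a M om wh w1 w2 \<le> ?E + ?E + 5 * ?E"
    unfolding X_norm_def by (intro add_mono 1 2 Y_norm_le a)
  also have "\<dots> = 7 * ?E"
  proof -
    have "(7::ennreal) = 1 + 1 + 5" by simp
    then show ?thesis by (simp only: distrib_right mult_1)
  qed
  finally show ?thesis .
qed

text \<open>For a \<le> 7/3 the order 4/3 + a/2 is at most 5/2, half an order above H^2 in the power
  of 1 + xi^2. The excess sqrt (1 + xi^2) \<le> 1 + u^3 and the multiplier u^5 add up to u^8,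
  exactly what the squared symbol compensates; so 7/3 is also the borderline here.\<close>

lemma Hs_norm_Ah_le:
  assumes "0 \<le> a" "a \<le> 7/3"
  shows "Hs_norm_hat (4/3 + a/2) (\<lambda>\<xi>. of_real (mpow \<xi> (5/6)) * Ah \<xi>) \<le> ennreal (2 / c * data_norm)"
proof -
  have "(1 + \<xi>\<^sup>2) powr (4/3 + a/2) * (cmod (of_real (mpow \<xi> (5/6)) * Ah \<xi>))\<^sup>2
      \<le> (2 / c)\<^sup>2 * H2_density H \<xi>" for \<xi>
  proof -
    define u where "u = cbrt \<xi>"
    have u: "0 \<le> u" "u ^ 6 = \<xi>\<^sup>2" unfolding u_def by (simp_all add: cbrt_power6)
    have p: "0 < c * (1 + u ^ 4)" using c u by (intro mult_pos_pos add_pos_nonneg) auto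
    have m: "(mpow \<xi> (5/6))\<^sup>2 = u ^ 5"
      by (cases "\<xi> = 0") (auto simp: mpow_eq_cbrt_powr u_def powr_numeral[symmetric] powr_powr)
    have "(1 + \<xi>\<^sup>2) powr (4/3 + a/2) \<le> (1 + \<xi>\<^sup>2) powr (2 + 1/2)"
      using assms by (intro powr_mono) auto
    also have "\<dots> = (1 + \<xi>\<^sup>2)\<^sup>2 * sqrt (1 + \<xi>\<^sup>2)"
      by (subst powr_add) (simp add: powr_half_sqrt powr_numeral add_pos_nonneg add_nonneg_nonneg)
    also have "\<dots> \<le> (1 + \<xi>\<^sup>2)\<^sup>2 * (1 + u ^ 3)"
    proof (intro mult_left_mono real_le_lsqrt)
      show "1 + \<xi>\<^sup>2 \<le> (1 + u ^ 3)\<^sup>2"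
        using u by (simp add: power2_sum flip: power_mult)
    qed (use u in auto)
    finally have w: "(1 + \<xi>\<^sup>2) powr (4/3 + a/2) \<le> (1 + \<xi>\<^sup>2)\<^sup>2 * (1 + u ^ 3)" .
    have r: "(1 + u ^ 3) * u ^ 5 \<le> 4 * (1 + u ^ 4)\<^sup>2"
    proof -
      have "u ^ 5 \<le> 1 + u ^ 8"
      proof (cases "u \<le> 1")
        case True
        then have "u ^ 5 \<le> 1" using u by (intro power_le_one) auto
        then show ?thesis using u by (simp add: add_increasing2)
      next
        case False
        then have "u ^ 5 \<le> u ^ 8" by (intro power_increasing) auto
        then show ?thesis by simp
      qed
      moreover have "(1 + u ^ 3) * u ^ 5 = u ^ 5 + u ^ 8" by (simp add: distrib_right flip: power_add)
      moreover have "(1 + u ^ 4)\<^sup>2 = 1 + 2 * u ^ 4 + u ^ 8" by (simp add: power2_sum flip: power_mult)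
      moreover have "0 \<le> u ^ 4" "0 \<le> u ^ 8" using u by auto
      ultimately show ?thesis by linarith
    qed
    have "(1 + \<xi>\<^sup>2) powr (4/3 + a/2) * (cmod (of_real (mpow \<xi> (5/6)) * Ah \<xi>))\<^sup>2
        = (1 + \<xi>\<^sup>2) powr (4/3 + a/2) * (u ^ 5 * (cmod (Ah \<xi>))\<^sup>2)"
      by (simp add: norm_mult power_mult_distrib m)
    also have "\<dots> \<le> (1 + \<xi>\<^sup>2)\<^sup>2 * (1 + u ^ 3) * (u ^ 5 * (cmod (H \<xi>) / (c * (1 + u ^ 4)))\<^sup>2)"
      using norm_Ah_le[of \<xi>] u by (intro mult_mono w power_mono) (auto simp: u_def)
    also have "\<dots> = (1 + \<xi>\<^sup>2)\<^sup>2 * (cmod (H \<xi>) / (c * (1 + u ^ 4)))\<^sup>2 * ((1 + u ^ 3) * u ^ 5)"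
      by (simp only: mult_ac)
    also have "\<dots> \<le> (1 + \<xi>\<^sup>2)\<^sup>2 * (cmod (H \<xi>) / (c * (1 + u ^ 4)))\<^sup>2 * (4 * (1 + u ^ 4)\<^sup>2)"
      by (intro mult_left_mono r) auto
    also have "\<dots> = (2 / c)\<^sup>2 * H2_density H \<xi>"
    proof -
      have "1 + u ^ 4 \<noteq> 0" using p by auto
      then show ?thesis by (simp add: power_divide power_mult_distrib)
    qed
    finally show ?thesis .
  qed
  then have "(\<integral>\<^sup>+\<xi>. ennreal ((1 + \<xi>\<^sup>2) powr (4/3 + a/2) * (cmod (of_real (mpow \<xi> (5/6)) * Ah \<xi>))\<^sup>2) \<partial>lborel)
      \<le> (\<integral>\<^sup>+\<xi>. ennreal ((2 / c)\<^sup>2 * H2_density H \<xi>) \<partial>lborel)"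
    by (intro nn_integral_mono ennreal_leI)
  also have "\<dots> = ennreal ((2 / c)\<^sup>2 * energy)" by (rule nn_integral_weight) simp
  finally have "Hs_norm_hat (4/3 + a/2) (\<lambda>\<xi>. of_real (mpow \<xi> (5/6)) * Ah \<xi>)
      \<le> enn_sqrt (ennreal (1 / (2 * pi)) * ennreal ((2 / c)\<^sup>2 * energy))"
    unfolding Hs_norm_hat_def by (intro enn_sqrt_mono mult_left_mono) auto
  also have "\<dots> = ennreal (2 / c * data_norm)" using c by (intro enn_sqrt_energy) simp
  finally show ?thesis .
qed

text \<open>A is the inverse transform of an integrable function, so its supremum is at most the L1
  norm of \<open>Ah\<close> over 2 pi; by \<open>weighted_L2_imp_L1\<close> this is sqrt (energy /
  (4 pi)) / c, below \<open>data_norm\<close> / c.\<close>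

lemma Linf_norm_A_le: "Linf_norm A \<le> ennreal (1 / c * data_norm)"
proof -
  have "\<bar>A x\<bar> \<le> 1 / c * data_norm" for x
  proof -
    have "\<bar>A x\<bar> = cmod (inv_fourier Ah x)" unfolding of_real_A[symmetric] by simp
    also have "\<dots> \<le> (LBINT \<xi>. cmod (Ah \<xi>)) / (2 * pi)" by (rule norm_inv_fourier_le)
    also have "\<dots> \<le> (1 / c * sqrt (pi * energy)) / (2 * pi)"
      using Ah_L1_L2(4) by (intro divide_right_mono) (auto simp: energy_def)
    also have "\<dots> = 1 / c * (sqrt (pi * energy) / (2 * pi))" by simp
    also have "\<dots> \<le> 1 / c * data_norm"
    proof (intro mult_left_mono)
      have "sqrt (pi * energy) / (2 * pi) = sqrt (energy / (4 * pi))"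
      proof -
        have "sqrt (pi * energy) / (2 * pi) = sqrt (pi * energy) / sqrt ((2 * pi)\<^sup>2)"
          by (simp only: real_sqrt_abs) simp
        also have "\<dots> = sqrt (pi * energy / (2 * pi)\<^sup>2)" by (rule real_sqrt_divide[symmetric])
        finally show ?thesis by (simp add: power2_eq_square)
      qed
      also have "\<dots> \<le> data_norm" unfolding data_norm_def
        using energy_nonneg by (intro real_sqrt_le_mono divide_left_mono) auto
      finally show "sqrt (pi * energy) / (2 * pi) \<le> data_norm" .
    qed (use c in simp)
    finally show ?thesis .
  qed
  then show ?thesis
    unfolding Linf_norm_def by (intro Inf_lower) (auto intro!: image_eqI AE_I2 ennreal_leI)
qed

lemma XA_norm_le:
  assumes "0 \<le> a" "a \<le> 7/3"
  shows "XA_norm a A Ah \<le> ennreal (3 / c * data_norm)"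
proof -
  have "XA_norm a A Ah \<le> ennreal (2 / c * data_norm) + ennreal (1 / c * data_norm)"
    unfolding XA_norm_def by (intro add_mono Hs_norm_Ah_le Linf_norm_A_le assms)
  also have "\<dots> = ennreal (3 / c * data_norm)"
    using data_norm_nonneg c by (simp flip: ennreal_plus add_divide_distrib)
  finally show ?thesis .
qed

lemma Hs_norm_H: "Hs_norm_hat 2 H = ennreal data_norm"
proof -
  have "(1 + \<xi>\<^sup>2) powr 2 * (cmod (H \<xi>))\<^sup>2 = 1\<^sup>2 * H2_density H \<xi>" for \<xi>
    by (simp add: powr_numeral add_pos_nonneg)
  then show ?thesis
    unfolding Hs_norm_hat_def using nn_integral_weight[of "1\<^sup>2"] enn_sqrt_energy[of 1] by simp
qed

text \<open>The constant collects 7 K / c from each of the two X norms and 3 / c from the norm of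
  A.\<close>

lemma solution:
  assumes a: "0 \<le> a" "a \<le> 7/3" and F: "AE x in lborel. F x = Re (inv_fourier H x)"
  shows "solves_system M F om wh w1 w2 A Ah"
    "in_calX a M om wh w1 w2 A Ah"
    "X_norm 0 M om wh w1 w2 + X_norm a M om wh w1 w2 + XA_norm a A Ah
      \<le> ennreal ((14 * K + 3) / c) * Hs_norm_hat 2 H"
proof -
  show "solves_system M F om wh w1 w2 A Ah"
    unfolding solves_system_def
  proof (intro conjI allI ballI strip_rep_om FT_L2_A w1_0)
    show "AE x in lborel. set_integrable lborel {0..M} (om x) \<and> (LINT y:{0..M}|lborel. om x y) = A x + F x"
      using F by eventually_elim (simp add: integral_om)
  qed (simp add: w2_def)
  have X: "X_norm 0 M om wh w1 w2 \<le> 7 * ennreal (K / c * data_norm)" "X_norm a M om wh w1 w2 \<le> 7 * ennreal (K / c * data_norm)"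
    using X_norm_le[of 0] X_norm_le[OF a] by auto
  have fin: "7 * ennreal (K / c * data_norm) < \<infinity>" by (simp add: ennreal_mult_less_top)
  show "in_calX a M om wh w1 w2 A Ah"
    unfolding in_calX_def
    using order.strict_trans1[OF X(1) fin] order.strict_trans1[OF X(2) fin]
      order.strict_trans1[OF XA_norm_le[OF a] ennreal_less_top]
    by (intro conjI allI strip_rep_om FT_L2_A trace) simp_all
  have "X_norm 0 M om wh w1 w2 + X_norm a M om wh w1 w2 + XA_norm a A Ah
      \<le> 7 * ennreal (K / c * data_norm) + 7 * ennreal (K / c * data_norm) + ennreal (3 / c * data_norm)"
    by (intro add_mono X XA_norm_le a)
  also have "\<dots> = ennreal (7 * (K / c * data_norm) + 7 * (K / c * data_norm) + 3 / c * data_norm)"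
  proof -
    have x: "0 \<le> K / c * data_norm" using K c data_norm_nonneg by simp
    have "7 * ennreal (K / c * data_norm) = ennreal (7 * (K / c * data_norm))"
      using ennreal_mult[of 7 "K / c * data_norm"] x by simp
    then show ?thesis
      using x c data_norm_nonneg by (simp only:) (simp flip: ennreal_plus)
  qed
  also have "\<dots> = ennreal ((14 * K + 3) / c) * Hs_norm_hat 2 H"
    using K c data_norm_nonneg unfolding Hs_norm_H
    by (subst ennreal_mult[symmetric]) (auto simp: field_simps)
  finally show "X_norm 0 M om wh w1 w2 + X_norm a M om wh w1 w2 + XA_norm a A Ah
      \<le> ennreal ((14 * K + 3) / c) * Hs_norm_hat 2 H" .
qed

end

text \<open>The transform of the real function F is Hermitian only almost everywhere; symmetrising it makes
  the inverse transforms below real at every point.\<close>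

lemma in_H2_hermitian:
  assumes "in_H2 F Fh"
  obtains H where "H \<in> borel_measurable borel" "\<And>\<xi>. H (- \<xi>) = cnj (H \<xi>)"
    "integrable lborel (H2_density H)"
    "AE x in lborel. F x = Re (inv_fourier H x)"
    "Hs_norm_hat 2 H = Hs_norm_hat 2 Fh"
proof -
  have FT: "FT_L2 (\<lambda>x. of_real (F x)) Fh" and fin: "Hs_norm_hat 2 Fh < \<infinity>"
    using assms by (auto simp: in_H2_def)
  have [measurable]: "Fh \<in> borel_measurable borel" using FT by (simp add: FT_L2_def L2_def)
  have w: "(1 + \<xi>\<^sup>2) powr 2 * (cmod (Fh \<xi>))\<^sup>2 = H2_density Fh \<xi>" for \<xi>
    by (simp add: powr_numeral add_pos_nonneg)
  have "ennreal (1 / (2 * pi)) * (\<integral>\<^sup>+\<xi>. ennreal (H2_density Fh \<xi>) \<partial>lborel) < \<infinity>"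
    using fin unfolding Hs_norm_hat_def enn_sqrt_def w by (auto simp: less_top split: if_splits)
  then have "(\<integral>\<^sup>+\<xi>. ennreal (H2_density Fh \<xi>) \<partial>lborel) < \<infinity>"
    by (auto simp: ennreal_mult_less_top)
  then have W: "integrable lborel (H2_density Fh)"
    by (intro integrableI_bounded) auto
  have Fh1: "integrable lborel Fh"
    by (rule H2_density_imp_integrable[OF _ W]) measurable
  define H where "H \<xi> = (Fh \<xi> + cnj (Fh (- \<xi>))) / 2" for \<xi>
  have [measurable]: "H \<in> borel_measurable borel" unfolding H_def by measurable
  have ae: "AE \<xi> in lborel. H \<xi> = Fh \<xi>"
    using FT_L2_real_imp_hermitian[OF FT Fh1] by eventually_elim (simp add: H_def)
  show ?thesis
  proof (rule that)
    show "H \<in> borel_measurable borel" by measurable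
    show "H (- \<xi>) = cnj (H \<xi>)" for \<xi> by (simp add: H_def add.commute)
    have aeW: "AE \<xi> in lborel. H2_density H \<xi> = H2_density Fh \<xi>"
      using ae by eventually_elim simp
    show "integrable lborel (H2_density H)"
      using W integrable_cong_AE[OF _ _ aeW] by auto
    have inv: "inv_fourier H x = inv_fourier Fh x" for x
    proof -
      have "(LBINT \<xi>. cis (x * \<xi>) * H \<xi>) = (LBINT \<xi>. cis (x * \<xi>) * Fh \<xi>)"
        by (rule integral_cong_AE) (use ae in auto)
      then show ?thesis by (simp add: inv_fourier_def)
    qed
    show "AE x in lborel. F x = Re (inv_fourier H x)"
      using FT_L2_imp_inv_fourier[OF FT Fh1] by eventually_elim (metis inv Re_complex_of_real)
    have "(\<integral>\<^sup>+\<xi>. ennreal ((1 + \<xi>\<^sup>2) powr 2 * (cmod (H \<xi>))\<^sup>2) \<partial>lborel) = (\<integral>\<^sup>+\<xi>. ennreal ((1 + \<xi>\<^sup>2) powr 2 * (cmod (Fh \<xi>))\<^sup>2) \<partial>lborel)"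
      by (rule nn_integral_cong_AE) (use ae in auto)
    then show "Hs_norm_hat 2 H = Hs_norm_hat 2 Fh" by (simp add: Hs_norm_hat_def)
  qed
qed

theorem theorem1p1:
  shows "\<exists>C>0. \<forall>(\<alpha>::real) (F::real \<Rightarrow> real) Fh. 0 < \<alpha> \<and> \<alpha> \<le> 7/3 \<and> in_H2 F Fh \<longrightarrow>
     (\<exists>M0>0. \<forall>M\<ge>M0. \<exists>\<omega> wh w1 w2 A Ah.
        solves_system M F \<omega> wh w1 w2 A Ah \<and> in_calX \<alpha> M \<omega> wh w1 w2 A Ah \<and>
        X_norm 0 M \<omega> wh w1 w2 + X_norm \<alpha> M \<omega> wh w1 w2 + XA_norm \<alpha> A Ah
          \<le> ennreal C * Hs_norm_hat 2 Fh)"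
proof -
  obtain r r1 G K L where "airy_profile r r1 G K L"
    using airy_profile_exists .
  then interpret airy_profile r r1 G K L .
  obtain c M0 where c: "c > 0" "M0 > 0"
    "\<And>M \<xi>. M0 \<le> M \<Longrightarrow> c * (1 + cbrt \<xi> ^ 4)
       \<le> cmod (ixi13 \<xi> * of_real \<bar>\<xi>\<bar> * G (ixi13 \<xi> * of_real M) - 1)"
    using symbol_lower_bound by blast
  show ?thesis
  \<comment> \<open>\<open>K\<close> belongs to the Airy profile, \<open>c\<close> and
    \<open>M0\<close> to the symbol bound; all are fixed before alpha, F and M appear, so the
    threshold too does not depend on the data.\<close>
  proof (rule exI[of _ "(14 * K + 3) / c"], intro conjI allI impI)
    show "0 < (14 * K + 3) / c" using c K by simp
    fix \<alpha> :: real and F :: "real \<Rightarrow> real" and Fh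
    assume hyp: "0 < \<alpha> \<and> \<alpha> \<le> 7/3 \<and> in_H2 F Fh"
    then obtain H where H: "H \<in> borel_measurable borel" "\<And>\<xi>. H (- \<xi>) = cnj (H \<xi>)"
      "integrable lborel (H2_density H)"
      "AE x in lborel. F x = Re (inv_fourier H x)" "Hs_norm_hat 2 H = Hs_norm_hat 2 Fh"
      using in_H2_hermitian by blast
    show "\<exists>M0>0. \<forall>M\<ge>M0. \<exists>\<omega> wh w1 w2 A Ah.
        solves_system M F \<omega> wh w1 w2 A Ah \<and> in_calX \<alpha> M \<omega> wh w1 w2 A Ah \<and>
        X_norm 0 M \<omega> wh w1 w2 + X_norm \<alpha> M \<omega> wh w1 w2 + XA_norm \<alpha> A Ah
          \<le> ennreal ((14 * K + 3) / c) * Hs_norm_hat 2 Fh"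
    proof (rule exI[of _ M0], intro conjI c(2) allI impI)
      fix M assume M: "M0 \<le> M"
      interpret airy_strip r r1 G K L c M H
        by unfold_locales (use c M H in \<open>auto intro: order.strict_trans2\<close>)
      show "\<exists>\<omega> wh w1 w2 A Ah.
        solves_system M F \<omega> wh w1 w2 A Ah \<and> in_calX \<alpha> M \<omega> wh w1 w2 A Ah \<and>
        X_norm 0 M \<omega> wh w1 w2 + X_norm \<alpha> M \<omega> wh w1 w2 + XA_norm \<alpha> A Ah
          \<le> ennreal ((14 * K + 3) / c) * Hs_norm_hat 2 Fh"
        using solution[of \<alpha> F] hyp H(4,5) by (auto intro!: exI)
    qed
  qed
qed

end
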